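(* Let $J,h:\mathbb{R}^n\to\mathbb{R}$ satisfy Assumptions (A1), (A2), (A3) of the context, let the design constants satisfy (A7), and suppose that either both (A4) and (A5) hold, or (A6) holds. Then for any $\Delta>0$ there exist $\delta^*>0$ and a constant $K>0$ such that for any $\delta\in(0,\delta^* )$ there exist $M^+>0$, $a^{**}>0$, $\omega_f^{**}>0$ such that for any $a\in(0,a^{**})$ and $\omega_f\in(0,\omega_f^{**})$ there exists $k^{**}(a)>0$ such that for any $k\in(0,k^{**}(a))$ the solutions of the safe extremum seeking system given in the context satisfy $$h(\theta(t))\ \ge\ h(\theta(t_0))\,e^{-ck\omega_f(t-t_0)}-K\delta$$ for all $\|[\tilde\theta(t_0)^T,z(t_0)^T]^T\|\le\Delta$ and all $t\in[t_0,\infty)$, where $t_0\ge0$ is the initial time.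
   Context: **System.** Let $n\ge 1$, $J,h:\mathbb{R}^n\to\mathbb{R}$. The safe extremum seeking system has states $\hat\theta,G_J,G_h\in\mathbb{R}^n$, $\eta_J,\eta_h\in\mathbb{R}$ and dynamics $$\dot{\hat\theta}=k\omega_f\Big(-G_J+\min\{\|G_h\|^{-2},M^+\}\,\max\{G_J^TG_h-c\,\eta_h,0\}\,G_h\Big),$$ $$\dot G_J=-\omega_f\big(G_J-(J(\theta(t))-\eta_J)M(t)\big),\qquad \dot\eta_J=-\omega_f\big(\eta_J-J(\theta(t))\big),$$ $$\dot G_h=-\omega_f\big(G_h-(h(\theta(t))-\eta_h)M(t)\big),\qquad \dot\eta_h=-\omega_f\big(\eta_h-h(\theta(t))\big),$$ where $\theta(t)=\hat\theta(t)+S(t)$, $S(t)=a[\sin(\omega_1t),\dots,\sin(\omega_nt)]^T$, $M(t)=\frac{2}{a}[\sin(\omega_1t),\dots,\sin(\omega_nt)]^T$, and $k,c,\omega_f,M^+,a,\omega_i>0$ are design constants ($\min\{\|G_h\|^{-2},M^+\}$ is read as $M^+$ when $G_h=0$). Here $c$ and the $\omega_i$ are fixed. **Error variables.** $\theta_c^*$ is the constrained minimizer in (A1); $\tilde\theta=\hat\theta-\theta_c^*$; $\xi=[G_J^T,\eta_J,G_h^T,\eta_h]^T$; $z=\xi-\mu(\tilde\theta,a)$, where $\mu(\tilde\theta,a)$ is the time average, over a common period $T$ of the $\sin(\omega_it)$, of the signals driving the estimators with $\tilde\theta$ frozen: $$\mu(\tilde\theta,a)=\frac1T\int_0^T\big[J(\vartheta(t))M(t)^T,\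 J(\vartheta(t)),\ h(\vartheta(t))M(t)^T,\ h(\vartheta(t))\big]^Tdt,\quad \vartheta(t)=\tilde\theta+\theta_c^*+S(t).$$ One has $\mu(\tilde\theta,a)=[\nabla J^T,J,\nabla h^T,h]^T(\tilde\theta+\theta^*_c)+O(a)$. **Sets.** $\mathcal{C}=\{\theta:h(\theta)\ge0\}$, $\partial\mathcal{C}=\{\theta:h(\theta)=0\}$, $\mathcal{U}=\{\theta:h(\theta)\le0\}$, and for $\rho\in\mathrm{Im}(h)\cap\mathbb{R}_{\le0}$, $\mathcal{C}_\rho=\{\theta:h(\theta)\ge\rho\}$. **Assumptions.** - (A1) $J$ is continuously differentiable with locally Lipschitz Jacobian; $\theta_c^*\in\mathcal{C}$ is the unique minimizer of $J$ on $\mathcal{C}$; if $\theta\in\mathcal{C}$ and $\nabla J(\theta)=0$ then $\theta=\theta_c^*$. - (A2) $h$ is continuously differentiable with locally Lipschitz Jacobian; $\mathcal{C}$ is non-empty; for any $\mathcal{C}_\rho$ there exists $L\in(0,\infty)$ with $\|\nabla h(\theta)\|>L$ for all $\theta\in\mathcal{U}\cap\mathcal{C}_\rho$. - (A3) If $\theta\in\partial\mathcal{C}$ and $\nabla h(\theta)^T\nabla J(\theta)=\|\nabla h(\theta)\|\,\|\nabla J(\theta)\|$, then $\theta=\theta_c^*$. - (A4) There exist $r^*>0$ and $f^*\in[0,1)$ such that $\frac{\nabla J(\theta)^T\nabla h(\theta)}{\|\nabla J(\theta)\|\,\|\nabla h(\theta)\|}\le f^*$ for all $\theta\in\{\rho\le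 h(\theta)\le0\}\cap\{\|\theta-\theta_c^*\|\ge r^*\}$, for any $\rho\in\mathrm{Im}(h)\cap\mathbb{R}_{<0}$. - (A5) The function $\theta\mapsto\max\{-h(\theta),0\}+\max\{J(\theta)-J(\theta_c^* ),0\}$ is positive definite (with respect to $\theta_c^*$) and tends to $\infty$ as $\|\theta-\theta_c^*\|\to\infty$. - (A6) Every set $\mathcal{C}_\rho$ is compact. - (A7) $\omega_f,\omega_i,a,k,c>0$; the ratios $\omega_i/\omega_j$ are rational; $\omega_i\ne\omega_j$ and $\omega_i+\omega_j\ne\omega_k$ for distinct $i,j,k$. *)

theory Defs
  imports "HOL-Analysis.Analysis"
begin

definition grad :: "(real^'n \<Rightarrow> real) \<Rightarrow> real^'n \<Rightarrow> real^'n" where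
  "grad f x = (THE D. GDERIV f x :> D)"

definition C1_loc_lipschitz_grad :: "(real^'n \<Rightarrow> real) \<Rightarrow> bool" where
  "C1_loc_lipschitz_grad f \<longleftrightarrow>
     (\<forall>x. \<exists>D. GDERIV f x :> D) \<and>
     continuous_on UNIV (grad f) \<and>
     (\<forall>x. \<exists>u>0. \<exists>L. L-lipschitz_on (cball x u) (grad f))"

definition safe_set :: "(real^'n \<Rightarrow> real) \<Rightarrow> (real^'n) set" where
  "safe_set h = {\<theta>. h \<theta> \<ge> 0}"

definition safe_boundary :: "(real^'n \<Rightarrow> real) \<Rightarrow> (real^'n) set" where
  "safe_boundary h = {\<theta>. h \<theta> = 0}"

definition unsafe_set :: "(real^'n \<Rightarrow> real) \<Rightarrow> (real^'n) set" where
  "unsafe_set h = {\<theta>. h \<theta> \<le> 0}"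

definition super_set :: "(real^'n \<Rightarrow> real) \<Rightarrow> real \<Rightarrow> (real^'n) set" where
  "super_set h \<rho> = {\<theta>. h \<theta> \<ge> \<rho>}"

definition assm_A1 :: "(real^'n \<Rightarrow> real) \<Rightarrow> (real^'n \<Rightarrow> real) \<Rightarrow> real^'n \<Rightarrow> bool" where
  "assm_A1 J h \<theta>c \<longleftrightarrow>
     C1_loc_lipschitz_grad J \<and>
     \<theta>c \<in> safe_set h \<and>
     (\<forall>\<theta>\<in>safe_set h. \<theta> \<noteq> \<theta>c \<longrightarrow> J \<theta>c < J \<theta>) \<and>
     (\<forall>\<theta>\<in>safe_set h. grad J \<theta> = 0 \<longrightarrow> \<theta> = \<theta>c)"

definition assm_A2 :: "(real^'n \<Rightarrow> real) \<Rightarrow> bool" where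
  "assm_A2 h \<longleftrightarrow>
     C1_loc_lipschitz_grad h \<and>
     safe_set h \<noteq> {} \<and>
     (\<forall>\<rho>\<in>range h \<inter> {..0}. \<exists>L>0. \<forall>\<theta>\<in>unsafe_set h \<inter> super_set h \<rho>. norm (grad h \<theta>) > L)"

definition assm_A3 :: "(real^'n \<Rightarrow> real) \<Rightarrow> (real^'n \<Rightarrow> real) \<Rightarrow> real^'n \<Rightarrow> bool" where
  "assm_A3 J h \<theta>c \<longleftrightarrow>
     (\<forall>\<theta>\<in>safe_boundary h.
        grad h \<theta> \<bullet> grad J \<theta> = norm (grad h \<theta>) * norm (grad J \<theta>) \<longrightarrow> \<theta> = \<theta>c)"

text \<open>
  Since \<open>x / 0 = 0\<close> and \<open>f \<ge> 0\<close>, the inequality below holds automatically at points where a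
  gradient vanishes, i.e. the bound is only demanded where the quotient is meaningful.
\<close>

definition assm_A4 :: "(real^'n \<Rightarrow> real) \<Rightarrow> (real^'n \<Rightarrow> real) \<Rightarrow> real^'n \<Rightarrow> bool" where
  "assm_A4 J h \<theta>c \<longleftrightarrow>
     (\<exists>r>0. \<exists>f\<in>{0..<1}. \<forall>\<rho>\<in>range h \<inter> {..<0}.
        \<forall>\<theta>\<in>{\<theta>. \<rho> \<le> h \<theta> \<and> h \<theta> \<le> 0} \<inter> {\<theta>. norm (\<theta> - \<theta>c) \<ge> r}.
          (grad J \<theta> \<bullet> grad h \<theta>) / (norm (grad J \<theta>) * norm (grad h \<theta>)) \<le> f)"

definition assm_A5 :: "(real^'n \<Rightarrow> real) \<Rightarrow> (real^'n \<Rightarrow> real) \<Rightarrow> real^'n \<Rightarrow> bool" where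
  "assm_A5 J h \<theta>c \<longleftrightarrow>
     (let V = (\<lambda>\<theta>. max (- h \<theta>) 0 + max (J \<theta> - J \<theta>c) 0) in
        V \<theta>c = 0 \<and> (\<forall>\<theta>. \<theta> \<noteq> \<theta>c \<longrightarrow> V \<theta> > 0) \<and>
        filterlim V at_top (filtercomap (\<lambda>\<theta>. norm (\<theta> - \<theta>c)) at_top))"

text \<open>
  If \<open>h > 0\<close> everywhere, there is no such \<open>\<rho>\<close> and the condition is void. Then nothing prevents a
  non-coercive \<open>J\<close> from driving a solution of the system to infinity in finite time, so global
  existence of solutions should only be claimed if \<open>h\<close> takes a value \<open>\<le> 0\<close> or \<open>assm_A5\<close> is available.
\<close>

definition assm_A6 :: "(real^'n \<Rightarrow> real) \<Rightarrow> bool" where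
  "assm_A6 h \<longleftrightarrow> (\<forall>\<rho>\<in>range h \<inter> {..0}. compact (super_set h \<rho>))"

text \<open>
  Only the fixed constants appear here; positivity of the tunable ones (\<open>a\<close>, \<open>k\<close>, \<open>\<omega>f\<close>) is part
  of the ranges over which they are quantified.
\<close>

definition assm_A7 :: "('n::finite \<Rightarrow> real) \<Rightarrow> real \<Rightarrow> bool" where
  "assm_A7 \<omega> c \<longleftrightarrow>
     c > 0 \<and> (\<forall>i. \<omega> i > 0) \<and>
     (\<forall>i j. \<omega> i / \<omega> j \<in> \<rat>) \<and>
     (\<forall>i j. i \<noteq> j \<longrightarrow> \<omega> i \<noteq> \<omega> j) \<and>
     (\<forall>i j k. i \<noteq> j \<and> j \<noteq> k \<and> i \<noteq> k \<longrightarrow> \<omega> i + \<omega> j \<noteq> \<omega> k)"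

definition probe_S :: "real \<Rightarrow> ('n::finite \<Rightarrow> real) \<Rightarrow> real \<Rightarrow> real^'n" where
  "probe_S a \<omega> t = a *\<^sub>R (\<chi> i. sin (\<omega> i * t))"

definition demod_M :: "real \<Rightarrow> ('n::finite \<Rightarrow> real) \<Rightarrow> real \<Rightarrow> real^'n" where
  "demod_M a \<omega> t = (2 / a) *\<^sub>R (\<chi> i. sin (\<omega> i * t))"

definition common_period :: "('n::finite \<Rightarrow> real) \<Rightarrow> real \<Rightarrow> bool" where
  "common_period \<omega> T \<longleftrightarrow> T > 0 \<and> (\<forall>i t. sin (\<omega> i * (t + T)) = sin (\<omega> i * t))"

text \<open>
  The state is \<open>(\<theta>hat, G_J, \<eta>_J, G_h, \<eta>_h)\<close>. As tuples nest to the right, its second component is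
  \<open>\<xi> = (G_J, \<eta>_J, G_h, \<eta>_h)\<close>, and the product norm is the Euclidean norm of the stacked vector.
\<close>

type_synonym 'n estimates = "(real^'n) \<times> real \<times> (real^'n) \<times> real"
type_synonym 'n ses_state = "(real^'n) \<times> 'n estimates"

text \<open>The first argument \<open>\<theta>\<close> is the frozen estimate \<open>\<theta>tilde + \<theta>c\<close>, not the error \<open>\<theta>tilde\<close>.\<close>

definition avg_estimates ::
  "(real^'n \<Rightarrow> real) \<Rightarrow> (real^'n \<Rightarrow> real) \<Rightarrow> ('n::finite \<Rightarrow> real) \<Rightarrow> real \<Rightarrow> real^'n \<Rightarrow> real \<Rightarrow> 'n estimates"
  where
  "avg_estimates J h \<omega> T \<theta> a =
     (1 / T) *\<^sub>R integral {0..T} (\<lambda>t. let \<phi> = \<theta> + probe_S a \<omega> t in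
        (J \<phi> *\<^sub>R demod_M a \<omega> t, J \<phi>, h \<phi> *\<^sub>R demod_M a \<omega> t, h \<phi>))"

definition mu ::
  "(real^'n \<Rightarrow> real) \<Rightarrow> (real^'n \<Rightarrow> real) \<Rightarrow> ('n::finite \<Rightarrow> real) \<Rightarrow> real \<Rightarrow> real^'n \<Rightarrow> real^'n \<Rightarrow> real \<Rightarrow> 'n estimates"
  where
  "mu J h \<omega> T \<theta>c \<theta>err a = avg_estimates J h \<omega> T (\<theta>err + \<theta>c) a"

definition error_state ::
  "(real^'n \<Rightarrow> real) \<Rightarrow> (real^'n \<Rightarrow> real) \<Rightarrow> ('n::finite \<Rightarrow> real) \<Rightarrow> real \<Rightarrow> real^'n \<Rightarrow> real \<Rightarrow> 'n ses_state \<Rightarrow> 'n ses_state"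
  where
  "error_state J h \<omega> T \<theta>c a x =
     (let \<theta>err = fst x - \<theta>c in (\<theta>err, snd x - mu J h \<omega> T \<theta>c \<theta>err a))"

text \<open>The case distinction is needed because \<open>1 / 0 = 0\<close>.\<close>

definition capped_inv_sq :: "real \<Rightarrow> real^'n \<Rightarrow> real" where
  "capped_inv_sq Mp G = (if G = 0 then Mp else min (1 / (norm G)\<^sup>2) Mp)"

fun ses_field ::
  "(real^'n \<Rightarrow> real) \<Rightarrow> (real^'n \<Rightarrow> real) \<Rightarrow> ('n::finite \<Rightarrow> real) \<Rightarrow> real \<Rightarrow> real \<Rightarrow> real \<Rightarrow> real \<Rightarrow> real \<Rightarrow>
   real \<Rightarrow> 'n ses_state \<Rightarrow> 'n ses_state"
  where
  "ses_field J h \<omega> c Mp a \<omega>f k t (\<theta>hat, GJ, \<eta>J, Gh, \<eta>h) =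
     (let \<theta> = \<theta>hat + probe_S a \<omega> t; M = demod_M a \<omega> t in
       ((k * \<omega>f) *\<^sub>R (- GJ + (capped_inv_sq Mp Gh * max (GJ \<bullet> Gh - c * \<eta>h) 0) *\<^sub>R Gh),
        (- \<omega>f) *\<^sub>R (GJ - (J \<theta> - \<eta>J) *\<^sub>R M),
        - \<omega>f * (\<eta>J - J \<theta>),
        (- \<omega>f) *\<^sub>R (Gh - (h \<theta> - \<eta>h) *\<^sub>R M),
        - \<omega>f * (\<eta>h - h \<theta>)))"

definition ses_solution_on ::
  "real set \<Rightarrow> (real^'n \<Rightarrow> real) \<Rightarrow> (real^'n \<Rightarrow> real) \<Rightarrow> ('n::finite \<Rightarrow> real) \<Rightarrow> real \<Rightarrow> real \<Rightarrow> real \<Rightarrow>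
   real \<Rightarrow> real \<Rightarrow> (real \<Rightarrow> 'n ses_state) \<Rightarrow> bool"
  where
  "ses_solution_on I J h \<omega> c Mp a \<omega>f k x \<longleftrightarrow>
     (\<forall>t\<in>I. (x has_vector_derivative ses_field J h \<omega> c Mp a \<omega>f k t (x t)) (at t within I))"

definition applied_param :: "real \<Rightarrow> ('n::finite \<Rightarrow> real) \<Rightarrow> (real \<Rightarrow> 'n ses_state) \<Rightarrow> real \<Rightarrow> real^'n" where
  "applied_param a \<omega> x t = fst (x t) + probe_S a \<omega> t"

end

theory Submission
  imports Defs
begin

text \<open>
  Since \<open>G_h\<close> estimates the gradient of \<open>h\<close>, the term with the maximum in the first equation is, as
  long as the cap \<open>Mp\<close> is inactive, the least correction of the descent direction \<open>- G_J\<close> that lets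
  \<open>h\<close> decay no faster than at the rate \<open>c\<close>. If the estimates are replaced by the exact values \<open>grad J\<close>, \<open>grad h\<close>, \<open>h\<close>, the
  estimate \<open>\<theta>hat\<close> follows \<open>k * \<omega>f\<close> times the vector field \<open>nominal_field\<close>. Along this field the
  derivative of \<open>h\<close> is at least \<open>- c * h\<close> up to an error that is small for large \<open>Mp\<close>
  (\<open>barrier_rate\<close>): where the cap is active the gradient of \<open>h\<close> is short, and on a given ball
  this only happens where \<open>h > 0\<close>. A disturbance of the field by \<open>\<epsilon>\<close> changes the resulting exponential lower bound for
  \<open>h\<close> by a multiple of \<open>\<epsilon>\<close> (\<open>barrier_along_near_flow\<close>). The theorem thus needs two further facts: the
  system follows the nominal field up to \<open>\<epsilon>\<close>, and it stays in a ball on which all constants are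
  uniform. All errors can be made smaller than \<open>\<delta>\<close>, so \<open>K = 1\<close> works.

  The first fact (\<open>slow_dynamics_near_nominal\<close>) rests on the order in which the constants are
  chosen. The estimators are linear filters of rate \<open>\<omega>f\<close>. The effect of their initial error is
  bounded by a power of \<open>1 / a\<close> and decays like \<open>exp (- \<omega>f * (t - t0))\<close>, while \<open>\<theta>hat\<close> moves at speed \<open>k * \<omega>f\<close> times a
  power of \<open>1 / a\<close>. With \<open>k\<close> small relative to \<open>a\<close> the estimate hardly moves until this error
  is gone. What remains is of order \<open>a + \<omega>f\<close>
  (\<open>estimators_track\<close>): the average input of the gradient filter is the gradient up to
  \<open>O(a)\<close>, and its zero-mean part has a bounded antiderivative, so that integration by parts against the
  filter kernel gains a factor \<open>\<omega>f\<close>.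

  For the second fact there are three reasons. If the superlevel sets of \<open>h\<close> are compact, the lower bound on
  \<open>h\<close> itself confines \<open>\<theta>hat\<close> (\<open>confines_if_compact_superlevels\<close>). In the coercive case the function
  \<open>J + C * (min h 0)\<^sup>2\<close> decreases strictly outside a ball, and this together with the lower bound on
  \<open>h\<close> confines \<open>\<theta>hat\<close> (\<open>confines_if_coercive\<close>). If \<open>h > 0\<close> everywhere and \<open>J\<close> is not
  coercive, \<open>\<theta>hat\<close> may escape to infinity. But the claim is trivial once \<open>exp (- c * k * \<omega>f * (t - t0))\<close>
  is so small that the lower bound is not positive; up to that time the distance travelled is bounded in
  terms of the decrease of \<open>J\<close> (\<open>confines_if_always_safe\<close>).

  These confinement results hold only while \<open>\<theta>hat\<close> is in the ball whose constants
  were used, but they yield a smaller radius, so by continuity the ball is never left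
  (\<open>trapped_by_gap\<close>). The same argument, with the field cut off outside a ball, turns the resulting bound
  on the state into global existence of solutions.
\<close>

section \<open>One-dimensional comparison arguments\<close>

lemma nondecreasing_if_deriv_nonneg:
  fixes m :: "real \<Rightarrow> real"
  assumes "t0 \<le> t1"
    and der: "\<And>t. t \<in> {t0..t1} \<Longrightarrow> (m has_real_derivative m' t) (at t within {t0..t1})"
    and "\<And>t. t \<in> {t0..t1} \<Longrightarrow> 0 \<le> m' t"
  shows "m t0 \<le> m t1"
proof -
  obtain x where "x \<in> {t0..t1}" "m t1 - m t0 = m' x * (t1 - t0)"
    using mvt_very_simple[OF assms(1), of m "\<lambda>x. (*) (m' x)"] der
    unfolding has_field_derivative_def by auto
  moreover have "0 \<le> m' x * (t1 - t0)"
    using assms(1,3) calculation(1) by (intro mult_nonneg_nonneg) auto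
  ultimately show ?thesis by linarith
qed

text \<open>
  With the integrating factor \<open>exp (w * t)\<close> both \<open>q - p\<close> and \<open>q + p\<close> become nondecreasing.
\<close>

lemma linear_filter_comparison:
  fixes p q :: "real \<Rightarrow> real"
  assumes le: "t0 \<le> t1"
    and p: "\<And>t. t \<in> {t0..t1} \<Longrightarrow> (p has_real_derivative p' t) (at t within {t0..t1})"
    and q: "\<And>t. t \<in> {t0..t1} \<Longrightarrow> (q has_real_derivative q' t) (at t within {t0..t1})"
    and dom: "\<And>t. t \<in> {t0..t1} \<Longrightarrow> \<bar>p' t + w * p t\<bar> \<le> q' t + w * q t"
    and init: "\<bar>p t0\<bar> \<le> q t0"
  shows "\<bar>p t1\<bar> \<le> q t1"
proof -
  have *: "s * p t1 \<le> q t1" if "s = 1 \<or> s = -1" for s :: real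
  proof -
    have "(q t0 - s * p t0) * exp (w * t0) \<le> (q t1 - s * p t1) * exp (w * t1)"
    proof (rule nondecreasing_if_deriv_nonneg[OF le,
          where m' = "\<lambda>t. ((q' t + w * q t) - s * (p' t + w * p t)) * exp (w * t)"])
      fix t assume t: "t \<in> {t0..t1}"
      show "((\<lambda>t. (q t - s * p t) * exp (w * t)) has_real_derivative
          ((q' t + w * q t) - s * (p' t + w * p t)) * exp (w * t)) (at t within {t0..t1})"
        by (rule derivative_eq_intros p[OF t] q[OF t] refl | simp add: algebra_simps)+
      show "0 \<le> ((q' t + w * q t) - s * (p' t + w * p t)) * exp (w * t)"
        using dom[OF t] that by (auto intro!: mult_nonneg_nonneg)
    qed
    moreover have "0 \<le> (q t0 - s * p t0) * exp (w * t0)"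
      using init that by (auto intro!: mult_nonneg_nonneg)
    ultimately have "0 \<le> (q t1 - s * p t1) * exp (w * t1)" by linarith
    then show ?thesis by (simp add: zero_le_mult_iff)
  qed
  show ?thesis using *[of 1] *[of "-1"] by auto
qed

text \<open>
  Here \<open>(m + d) * exp (w * t)\<close> is nondecreasing. The offset \<open>d\<close> absorbs a disturbance of size
  \<open>w * d\<close> of the differential inequality \<open>m' \<ge> - w * m\<close>.
\<close>

lemma exp_decay_lower_bound:
  fixes m :: "real \<Rightarrow> real"
  assumes le: "t0 \<le> t1" and "0 \<le> d"
    and m: "\<And>t. t \<in> {t0..t1} \<Longrightarrow> (m has_real_derivative m' t) (at t within {t0..t1})"
    and rate: "\<And>t. t \<in> {t0..t1} \<Longrightarrow> - w * (m t + d) \<le> m' t"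
  shows "m t0 * exp (- w * (t1 - t0)) - d \<le> m t1"
proof -
  have "(m t0 + d) * exp (w * t0) \<le> (m t1 + d) * exp (w * t1)"
  proof (rule nondecreasing_if_deriv_nonneg[OF le, where m' = "\<lambda>t. (m' t + w * (m t + d)) * exp (w * t)"])
    fix t assume t: "t \<in> {t0..t1}"
    show "((\<lambda>t. (m t + d) * exp (w * t)) has_real_derivative
        (m' t + w * (m t + d)) * exp (w * t)) (at t within {t0..t1})"
      by (rule derivative_eq_intros m[OF t] refl | simp add: algebra_simps)+
    show "0 \<le> (m' t + w * (m t + d)) * exp (w * t)"
      using rate[OF t] by (auto intro!: mult_nonneg_nonneg)
  qed
  from mult_right_mono[OF this, of "exp (- w * t1)"]
  have "(m t0 + d) * exp (- w * (t1 - t0)) \<le> m t1 + d"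
    by (simp add: mult.assoc flip: exp_add) (simp add: algebra_simps)
  moreover have "0 \<le> d * exp (- w * (t1 - t0))" using \<open>0 \<le> d\<close> by simp
  ultimately show ?thesis by (simp add: algebra_simps)
qed

text \<open>
  At the first time at which \<open>u\<close> reaches \<open>R\<close> the bound \<open>R\<close> holds on the whole past, and the step
  yields the smaller value \<open>R'\<close> there. This shows that a region is never left from estimates
  that are valid only inside it.
\<close>

lemma trapped_by_gap:
  fixes u :: "real \<Rightarrow> real"
  assumes "t0 \<le> t1" and cont: "continuous_on {t0..t1} u"
    and gap: "R' < R"
    and step: "\<And>t. t \<in> {t0..t1} \<Longrightarrow> (\<And>s. s \<in> {t0..t} \<Longrightarrow> u s \<le> R) \<Longrightarrow> u t \<le> R'"
    and init: "u t0 \<le> R"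
    and t: "t \<in> {t0..t1}"
  shows "u t \<le> R"
proof (rule ccontr)
  assume "\<not> u t \<le> R"
  define A where "A = {s \<in> {t0..t1}. R \<le> u s}"
  have "compact A"
  proof -
    have "closed A" unfolding A_def
      using cont closed_atLeastAtMost by (intro continuous_on_closed_Collect_le) auto
    moreover have "bounded A" unfolding A_def
      by (rule bounded_subset[OF bounded_closed_interval[of t0 t1]]) auto
    ultimately show ?thesis by (simp add: compact_eq_bounded_closed)
  qed
  moreover have "A \<noteq> {}" using t \<open>\<not> u t \<le> R\<close> unfolding A_def by force
  ultimately obtain s where s: "s \<in> A" "\<And>r. r \<in> A \<Longrightarrow> s \<le> r"
    using compact_attains_inf[of A] by blast
  have s_in: "s \<in> {t0..t1}" and us: "R \<le> u s" using s(1) by (auto simp: A_def)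
  have before: "u r < R" if "r \<in> {t0..t1}" "r < s" for r
    using s(2)[of r] that unfolding A_def by force
  have "u s \<le> R"
  proof (cases "s = t0")
    case False
    \<comment> \<open>by continuity: all earlier values are below \<open>R\<close>\<close>
    have "s \<in> closure {t0..<s}" using False s_in by simp
    moreover have "continuous_on (closure {t0..<s}) u"
      using False s_in cont by (auto intro: continuous_on_subset)
    moreover have "u r \<le> R" if "r \<in> {t0..<s}" for r
      using before[of r] that s_in by simp
    ultimately show ?thesis using continuous_le_on_closure by blast
  qed (use init in simp)
  then have "u r \<le> R" if "r \<in> {t0..s}" for r
    using before[of r] that s_in by (cases "r = s") auto
  then have "u s \<le> R'" using step[OF s_in] by blast
  then show False using us gap by simp
qed

section \<open>Functions with locally Lipschitz gradient\<close>

lemma has_derivative_grad: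
  assumes "C1_loc_lipschitz_grad f"
  shows "(f has_derivative (\<lambda>h. grad f x \<bullet> h)) (at x)"
proof -
  obtain D where D: "GDERIV f x :> D"
    using assms unfolding C1_loc_lipschitz_grad_def by blast
  have "grad f x = D" unfolding grad_def
  proof (rule the_equality[where P = "\<lambda>D. GDERIV f x :> D", OF D])
    fix D' assume "GDERIV f x :> D'"
    then have "(\<lambda>h. h \<bullet> D') = (\<lambda>h. h \<bullet> D)"
      using D has_derivative_unique unfolding gderiv_def by blast
    then have "(D' - D) \<bullet> D' = (D' - D) \<bullet> D" by (rule fun_cong)
    then have "(D' - D) \<bullet> (D' - D) = 0" by (simp add: inner_diff_right)
    then show "D' = D" by simp
  qed
  then show ?thesis using D unfolding gderiv_def by (simp add: inner_commute)
qed

lemma continuous_on_grad: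
  "C1_loc_lipschitz_grad f \<Longrightarrow> continuous_on A (grad f)"
  unfolding C1_loc_lipschitz_grad_def using continuous_on_subset by blast

lemma C1_continuous_on:
  "C1_loc_lipschitz_grad f \<Longrightarrow> continuous_on A f"
  by (meson has_derivative_grad has_derivative_continuous_on has_derivative_at_withinI)

lemma has_real_derivative_along_curve:
  fixes y :: "real \<Rightarrow> real^'n"
  assumes "C1_loc_lipschitz_grad f" and "(y has_vector_derivative y') (at t within A)"
  shows "((\<lambda>t. f (y t)) has_real_derivative (grad f (y t) \<bullet> y')) (at t within A)"
proof -
  have "((\<lambda>t. f (y t)) has_derivative (\<lambda>h. grad f (y t) \<bullet> (h *\<^sub>R y'))) (at t within A)"
    using has_derivative_compose[OF assms(2)[unfolded has_vector_derivative_def]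
        has_derivative_grad[OF assms(1)]] .
  moreover have "(\<lambda>h. grad f (y t) \<bullet> (h *\<^sub>R y')) = (*) (grad f (y t) \<bullet> y')"
    by (auto simp: fun_eq_iff)
  ultimately show ?thesis unfolding has_field_derivative_def by simp
qed

text \<open>
  One constant serves for all bounds, since only its existence matters. The local Lipschitz constants
  of the gradient combine to one on the compact ball, and the mean value theorem gives the rest.
\<close>

lemma C1_bounds_on_ball:
  fixes f :: "real^'n \<Rightarrow> real"
  assumes "C1_loc_lipschitz_grad f"
  obtains B where "0 < B"
    and "\<And>x. x \<in> cball x0 r \<Longrightarrow> \<bar>f x\<bar> \<le> B"
    and "\<And>x. x \<in> cball x0 r \<Longrightarrow> norm (grad f x) \<le> B"
    and "\<And>x y. x \<in> cball x0 r \<Longrightarrow> y \<in> cball x0 r \<Longrightarrow> \<bar>f x - f y\<bar> \<le> B * norm (x - y)"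
    and "\<And>x y. x \<in> cball x0 r \<Longrightarrow> y \<in> cball x0 r \<Longrightarrow> norm (grad f x - grad f y) \<le> B * norm (x - y)"
    and "\<And>x y. x \<in> cball x0 r \<Longrightarrow> y \<in> cball x0 r \<Longrightarrow>
           \<bar>f x - f y - grad f y \<bullet> (x - y)\<bar> \<le> B * (norm (x - y))\<^sup>2"
proof -
  let ?S = "cball x0 r"
  have "bounded (f ` ?S)" "bounded (grad f ` ?S)"
    using assms by (auto intro!: compact_imp_bounded compact_continuous_image
        C1_continuous_on continuous_on_grad)
  then obtain B1 B2 where B1: "\<And>x. x \<in> ?S \<Longrightarrow> \<bar>f x\<bar> \<le> B1"
    and B2: "\<And>x. x \<in> ?S \<Longrightarrow> norm (grad f x) \<le> B2"
    unfolding bounded_iff ball_simps real_norm_def by blast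
  have "local_lipschitz {0::real} ?S (\<lambda>_. grad f)"
  proof (rule local_lipschitzI)
    fix t x
    obtain u L where "u > 0" "L-lipschitz_on (cball x u) (grad f)"
      using assms unfolding C1_loc_lipschitz_grad_def by blast
    then show "\<exists>u>0. \<exists>L. \<forall>t\<in>cball t u \<inter> {0}. L-lipschitz_on (cball x u \<inter> ?S) (grad f)"
      by (meson inf_le1 lipschitz_on_subset)
  qed
  then obtain L where L: "L-lipschitz_on ?S (grad f)"
    by (metis local_lipschitz_compact_implies_lipschitz[where f="\<lambda>_. grad f" and T="{0::real}"]
        compact_cball compact_sing continuous_on_sing singletonI)
  define B where "B = \<bar>B1\<bar> + \<bar>B2\<bar> + \<bar>L\<bar> + 1"
  have lipg: "norm (grad f x - grad f y) \<le> B * norm (x - y)" if "x \<in> ?S" "y \<in> ?S" for x y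
  proof -
    have "norm (grad f x - grad f y) \<le> L * norm (x - y)"
      using lipschitz_onD[OF L that] by (simp add: dist_norm)
    also have "\<dots> \<le> B * norm (x - y)" unfolding B_def by (intro mult_right_mono) auto
    finally show ?thesis .
  qed
  \<comment> \<open>the estimates of differences of \<open>f\<close> come from the mean value theorem on the segment\<close>
  have mvt: "\<exists>z\<in>?S. norm (z - y) \<le> norm (x - y) \<and> f x - f y = grad f z \<bullet> (x - y)"
    if xy: "x \<in> ?S" "y \<in> ?S" for x y
  proof -
    define g where "g = (\<lambda>s::real. y + s *\<^sub>R (x - y))"
    have "((\<lambda>s. f (g s)) has_derivative (*) (grad f (g s) \<bullet> (x - y))) (at s within {0..1})" for s
    proof -
      have "(g has_vector_derivative (x - y)) (at s within {0..1})"
        unfolding g_def by (auto intro!: derivative_eq_intros)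
      from has_real_derivative_along_curve[OF assms this] show ?thesis
        unfolding has_field_derivative_def .
    qed
    then obtain s where s: "s \<in> {0..1}" "f (g 1) - f (g 0) = grad f (g s) \<bullet> (x - y)"
      using mvt_very_simple[of 0 1 "\<lambda>s. f (g s)" "\<lambda>s. (*) (grad f (g s) \<bullet> (x - y))"] by auto
    have "g s \<in> ?S"
    proof -
      have "g s = (1 - s) *\<^sub>R y + s *\<^sub>R x" by (simp add: g_def algebra_simps)
      then show ?thesis using s(1) xy convexD_alt[OF convex_cball] by auto
    qed
    moreover have "norm (g s - y) \<le> norm (x - y)"
      using s(1) by (simp add: g_def mult_left_le_one_le)
    moreover have "f x - f y = grad f (g s) \<bullet> (x - y)" using s(2) by (simp add: g_def)
    ultimately show ?thesis by blast
  qed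
  show thesis
  proof
    show "0 < B" unfolding B_def by linarith
    show "\<bar>f x\<bar> \<le> B" "norm (grad f x) \<le> B" if "x \<in> ?S" for x
      using B1[OF that] B2[OF that] unfolding B_def by linarith+
    fix x y assume xy: "x \<in> ?S" "y \<in> ?S"
    obtain z where z: "z \<in> ?S" "norm (z - y) \<le> norm (x - y)" "f x - f y = grad f z \<bullet> (x - y)"
      using mvt[OF xy] by blast
    have "norm (grad f z) \<le> B" using B2[OF z(1)] unfolding B_def by linarith
    then show "\<bar>f x - f y\<bar> \<le> B * norm (x - y)"
      unfolding z(3)
      by (rule order_trans[OF Cauchy_Schwarz_ineq2 mult_right_mono[OF _ norm_ge_zero]])
    show "norm (grad f x - grad f y) \<le> B * norm (x - y)" by (rule lipg[OF xy])
    have "f x - f y - grad f y \<bullet> (x - y) = (grad f z - grad f y) \<bullet> (x - y)"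
      unfolding z(3) by (simp add: inner_diff_left)
    also have "\<bar>\<dots>\<bar> \<le> norm (grad f z - grad f y) * norm (x - y)" by (rule Cauchy_Schwarz_ineq2)
    also have "\<dots> \<le> (B * norm (x - y)) * norm (x - y)"
      by (rule mult_right_mono[OF order_trans[OF lipg[OF z(1) xy(2)] mult_left_mono[OF z(2)]]])
        (use \<open>0 < B\<close> in auto)
    finally show "\<bar>f x - f y - grad f y \<bullet> (x - y)\<bar> \<le> B * (norm (x - y))\<^sup>2"
      by (simp add: power2_eq_square mult.assoc)
  qed
qed

section \<open>Global existence for differential equations\<close>

lemma norm_diff_le_if_deriv_bound:
  fixes f :: "real \<Rightarrow> 'a::real_normed_vector" and \<phi> :: "real \<Rightarrow> real"
  assumes "t0 \<le> t1"
    and f: "\<And>t. t \<in> {t0..t1} \<Longrightarrow> (f has_vector_derivative f' t) (at t within {t0..t1})"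
    and \<phi>: "\<And>t. t \<in> {t0..t1} \<Longrightarrow> (\<phi> has_real_derivative \<phi>' t) (at t within {t0..t1})"
    and bnd: "\<And>t. t \<in> {t0..t1} \<Longrightarrow> norm (f' t) \<le> \<phi>' t"
  shows "norm (f t1 - f t0) \<le> \<phi> t1 - \<phi> t0"
proof (cases "t0 = t1")
  case False
  have inner: "at t within {t0..t1} = at t" if "t0 < t" "t < t1" for t
    using that by (rule at_within_Icc_at)
  show ?thesis
  proof (rule differentiable_bound_general[where f' = f' and \<phi>' = \<phi>'])
    show "continuous_on {t0..t1} f" by (rule continuous_on_vector_derivative[OF f])
    show "continuous_on {t0..t1} \<phi>" by (rule DERIV_continuous_on[OF \<phi>])
    fix t assume t: "t0 < t" "t < t1"
    show "(f has_vector_derivative f' t) (at t)" using f[of t] t by (simp add: inner)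
    show "(\<phi> has_vector_derivative \<phi>' t) (at t)"
      using \<phi>[of t] t by (simp add: inner has_real_derivative_iff_has_vector_derivative)
    show "norm (f' t) \<le> \<phi>' t" using bnd t by simp
  qed (use assms False in auto)
qed simp

lemma integral_from_has_vector_derivative:
  fixes f :: "real \<Rightarrow> 'a::banach"
  assumes "continuous_on UNIV f" and "t0 \<le> t"
  shows "((\<lambda>u. integral {t0..u} f) has_vector_derivative f t) (at t within {t0..})"
proof -
  have "((\<lambda>u. integral {t0..u} f) has_vector_derivative f t) (at t within {t0..t + 1})"
    using assms by (intro integral_has_vector_derivative continuous_on_subset[OF assms(1)]) auto
  moreover have "at t within {t0..t + 1} = at t within {t0..}"
    by (rule at_within_nhd[of _ "{..<t + 1}"]) auto
  ultimately show ?thesis by simp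
qed

text \<open>
  Picard iteration contracts the supremum norm weighted with \<open>exp (- 2 * L * (t - t0))\<close> on the
  whole half line, so that one application of Banach's theorem gives the solution for all times.
\<close>

lemma ode_global_solution_if_lipschitz:
  fixes g :: "real \<Rightarrow> 'a::euclidean_space \<Rightarrow> 'a"
  assumes cont: "continuous_on UNIV (\<lambda>(t, x). g t x)"
    and bound: "\<And>t x. norm (g t x) \<le> B"
    and lip: "\<And>t x y. norm (g t x - g t y) \<le> L * norm (x - y)"
  shows "\<exists>x. x t0 = x0 \<and> (\<forall>t\<in>{t0..}. (x has_vector_derivative g t (x t)) (at t within {t0..}))"
proof -
  define \<Lambda> where "\<Lambda> = \<bar>L\<bar> + 1"
  have \<Lambda>: "\<Lambda> > 0" and lip': "norm (g t x - g t y) \<le> \<Lambda> * norm (x - y)" for t x y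
  proof -
    have "L * norm (x - y) \<le> \<Lambda> * norm (x - y)"
      unfolding \<Lambda>_def by (intro mult_right_mono) auto
    then show "norm (g t x - g t y) \<le> \<Lambda> * norm (x - y)" using lip order_trans by blast
  qed (simp add: \<Lambda>_def add_nonneg_pos)
  have "0 \<le> B" using bound norm_ge_zero order_trans by blast
  define e where "e = (\<lambda>t. exp (2 * \<Lambda> * (t - t0)))"
  have e_pos: "0 < e t" for t by (simp add: e_def)
  define I where "I = (\<lambda>(v :: real \<Rightarrow>\<^sub>C 'a) t. x0 + integral {t0..t} (\<lambda>s. g s (e s *\<^sub>R v s)))"
  have gcont: "continuous_on UNIV (\<lambda>s. g s (e s *\<^sub>R apply_bcontfun v s))" for v :: "real \<Rightarrow>\<^sub>C 'a"
  proof -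
    have "continuous_on UNIV (\<lambda>s. (s, e s *\<^sub>R apply_bcontfun v s))"
      unfolding e_def by (intro continuous_intros) auto
    from continuous_on_compose2[OF cont this] show ?thesis by simp
  qed
  have I_deriv: "(I v has_vector_derivative g t (e t *\<^sub>R v t)) (at t within {t0..})" if "t0 \<le> t" for v t
    unfolding I_def using integral_from_has_vector_derivative[OF gcont that]
    by (auto intro!: derivative_eq_intros)
  have I_deriv': "(I v has_vector_derivative g t (e t *\<^sub>R v t)) (at t within {t0..t1})"
    if "t \<in> {t0..t1}" for v t t1
    by (rule has_vector_derivative_within_subset[OF I_deriv]) (use that in auto)
  have I_t0: "I v t0 = x0" for v by (simp add: I_def)
  define T where "T = (\<lambda>v t. (1 / e (max t0 t)) *\<^sub>R I v (max t0 t))"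
  have "T v \<in> bcontfun" for v
  proof (rule bcontfun_normI)
    have "continuous_on {t0..} (I v)"
      by (rule continuous_on_vector_derivative) (rule I_deriv, simp)
    then have "continuous_on UNIV (\<lambda>t. I v (max t0 t))"
      by (rule continuous_on_compose2) (auto intro!: continuous_intros)
    then show "continuous_on UNIV (T v)"
      unfolding T_def e_def by (intro continuous_intros) auto
    fix t
    let ?\<sigma> = "max t0 t"
    have "norm (I v ?\<sigma> - I v t0) \<le> B * (?\<sigma> - t0) - B * (t0 - t0)"
      by (rule norm_diff_le_if_deriv_bound[OF _ I_deriv', where \<phi>' = "\<lambda>_. B"])
        (auto intro!: derivative_eq_intros bound)
    then have "norm (I v ?\<sigma>) \<le> norm x0 + B * (?\<sigma> - t0)"
      using norm_triangle_sub[of "I v ?\<sigma>" x0] by (simp add: I_t0)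
    also have "\<dots> \<le> (norm x0 + B / (2 * \<Lambda>)) * e ?\<sigma>"
    proof -
      have "0 \<le> 2 * \<Lambda> * (?\<sigma> - t0)" using \<Lambda> by simp
      then have "1 \<le> e ?\<sigma>" and "2 * \<Lambda> * (?\<sigma> - t0) \<le> e ?\<sigma>"
        unfolding e_def using exp_ge_add_one_self[of "2 * \<Lambda> * (?\<sigma> - t0)"] by linarith+
      then have "norm x0 * 1 \<le> norm x0 * e ?\<sigma>"
        and "(B / (2 * \<Lambda>)) * (2 * \<Lambda> * (?\<sigma> - t0)) \<le> (B / (2 * \<Lambda>)) * e ?\<sigma>"
        using \<open>0 \<le> B\<close> \<Lambda> by (intro mult_left_mono; simp)+
      moreover have "(B / (2 * \<Lambda>)) * (2 * \<Lambda> * (?\<sigma> - t0)) = B * (?\<sigma> - t0)" using \<Lambda> by simp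
      ultimately show ?thesis by (simp add: algebra_simps)
    qed
    finally show "norm (T v t) \<le> norm x0 + B / (2 * \<Lambda>)"
      unfolding T_def using e_pos[of ?\<sigma>] by (simp add: divide_le_eq)
  qed
  then have apply_T: "apply_bcontfun (Bcontfun (T v)) = T v" for v
    by (simp add: Bcontfun_inverse)
  have "dist (Bcontfun (T v)) (Bcontfun (T w)) \<le> (1 / 2) * dist v w" for v w
  proof (rule dist_bound, unfold apply_T)
    fix t
    let ?\<sigma> = "max t0 t" and ?d = "dist v w"
    have "norm ((I v ?\<sigma> - I w ?\<sigma>) - (I v t0 - I w t0)) \<le> (?d / 2) * e ?\<sigma> - (?d / 2) * e t0"
    proof (rule norm_diff_le_if_deriv_bound[where
          f' = "\<lambda>t. g t (e t *\<^sub>R v t) - g t (e t *\<^sub>R w t)" and \<phi>' = "\<lambda>t. \<Lambda> * (e t * ?d)"])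
      fix s assume s: "s \<in> {t0..?\<sigma>}"
      show "((\<lambda>s. I v s - I w s) has_vector_derivative
          g s (e s *\<^sub>R v s) - g s (e s *\<^sub>R w s)) (at s within {t0..?\<sigma>})"
        using I_deriv'[OF s] by (intro has_vector_derivative_diff) auto
      show "((\<lambda>s. (?d / 2) * e s) has_real_derivative \<Lambda> * (e s * ?d)) (at s within {t0..?\<sigma>})"
        unfolding e_def by (rule derivative_eq_intros refl | simp)+
      have "norm (g s (e s *\<^sub>R v s) - g s (e s *\<^sub>R w s)) \<le> \<Lambda> * norm (e s *\<^sub>R v s - e s *\<^sub>R w s)"
        by (rule lip')
      also have "\<dots> = \<Lambda> * (e s * dist (v s) (w s))"
        using e_pos[of s] by (simp add: dist_norm flip: scaleR_diff_right)
      also have "\<dots> \<le> \<Lambda> * (e s * ?d)"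
        using \<Lambda> e_pos[of s] dist_bounded[of v s w] by (intro mult_left_mono) auto
      finally show "norm (g s (e s *\<^sub>R v s) - g s (e s *\<^sub>R w s)) \<le> \<Lambda> * (e s * ?d)" .
    qed simp
    moreover have "0 \<le> (?d / 2) * e t0" using e_pos[of t0] by (intro mult_nonneg_nonneg) auto
    ultimately have "norm (I v ?\<sigma> - I w ?\<sigma>) \<le> (?d / 2) * e ?\<sigma>"
      unfolding I_t0 by simp
    then show "dist (T v t) (T w t) \<le> (1 / 2) * ?d"
      unfolding T_def using e_pos[of ?\<sigma>]
      by (simp add: dist_norm divide_le_eq flip: scaleR_diff_right)
  qed
  then obtain v where v: "Bcontfun (T v) = v"
    using banach_fix_type[of "1 / 2" "\<lambda>v. Bcontfun (T v)"] by auto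
  have "e t *\<^sub>R v t = I v t" if "t0 \<le> t" for t
  proof -
    have "v t = T v t" using apply_T[of v] v by simp
    then show ?thesis using that e_pos[of t] by (simp add: T_def max_absorb2)
  qed
  then show ?thesis using I_deriv[of _ v] I_t0[of v] by (intro exI[of _ "I v"]) auto
qed

text \<open>
  Composing the field with the projection onto a ball makes it globally Lipschitz without changing
  it inside the ball, and the a priori bound keeps the solution of the modified equation there.
\<close>

lemma ode_global_solution_if_bounded:
  fixes f :: "real \<Rightarrow> 'a::euclidean_space \<Rightarrow> 'a"
  assumes cont: "continuous_on UNIV (\<lambda>(t, x). f t x)"
    and bound: "\<And>t x. x \<in> cball 0 r \<Longrightarrow> norm (f t x) \<le> B"
    and lip: "\<And>t x y. x \<in> cball 0 r \<Longrightarrow> y \<in> cball 0 r \<Longrightarrow> norm (f t x - f t y) \<le> L * norm (x - y)"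
    and gap: "r' < r" and init: "norm x0 \<le> r'"
    and apriori: "\<And>t1 x. t0 \<le> t1 \<Longrightarrow> x t0 = x0 \<Longrightarrow>
      (\<And>t. t \<in> {t0..t1} \<Longrightarrow> (x has_vector_derivative f t (x t)) (at t within {t0..t1})) \<Longrightarrow>
      norm (x t1) \<le> r'"
  shows "\<exists>x. x t0 = x0 \<and> (\<forall>t\<in>{t0..}. (x has_vector_derivative f t (x t)) (at t within {t0..}))"
proof -
  have "0 \<le> r" using gap init norm_ge_zero[of x0] by linarith
  let ?\<pi> = "closest_point (cball 0 r :: 'a set)"
  have \<pi>_in: "?\<pi> x \<in> cball 0 r" for x
    using \<open>0 \<le> r\<close> by (intro closest_point_in_set) auto
  have \<pi>_id: "?\<pi> x = x" if "norm x \<le> r" for x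
    using that by (intro closest_point_self) simp
  have "norm (f t (?\<pi> x) - f t (?\<pi> y)) \<le> \<bar>L\<bar> * norm (x - y)" for t x y
  proof -
    have "norm (f t (?\<pi> x) - f t (?\<pi> y)) \<le> L * norm (?\<pi> x - ?\<pi> y)" using lip \<pi>_in by blast
    also have "\<dots> \<le> \<bar>L\<bar> * norm (?\<pi> x - ?\<pi> y)" by (intro mult_right_mono) auto
    also have "\<dots> \<le> \<bar>L\<bar> * norm (x - y)"
      using closest_point_lipschitz[of "cball 0 r :: 'a set" x y] \<open>0 \<le> r\<close>
      by (intro mult_left_mono) (auto simp: dist_norm)
    finally show ?thesis .
  qed
  moreover have "continuous_on UNIV (\<lambda>(t, x). f t (?\<pi> x))"
  proof -
    have "continuous_on UNIV (\<lambda>z :: real \<times> 'a. (fst z, ?\<pi> (snd z)))"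
      using \<open>0 \<le> r\<close>
      by (intro continuous_intros continuous_on_compose2[OF continuous_on_closest_point[of _ UNIV]]) auto
    from continuous_on_compose2[OF cont this] show ?thesis by (simp add: case_prod_beta')
  qed
  ultimately obtain x where x0: "x t0 = x0"
    and x: "\<And>t. t \<in> {t0..} \<Longrightarrow> (x has_vector_derivative f t (?\<pi> (x t))) (at t within {t0..})"
    using ode_global_solution_if_lipschitz[of "\<lambda>t x. f t (?\<pi> x)" B "\<bar>L\<bar>" t0 x0] bound \<pi>_in by blast
  have "norm (x t) \<le> r" if "t0 \<le> t" for t
  proof (rule trapped_by_gap[OF that _ gap, where u = "\<lambda>t. norm (x t)"])
    have "continuous_on {t0..} x" by (rule continuous_on_vector_derivative[OF x])
    then show "continuous_on {t0..t} (\<lambda>t. norm (x t))"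
      by (intro continuous_on_norm) (auto intro: continuous_on_subset)
    fix s assume s: "s \<in> {t0..t}" and in_ball: "\<And>u. u \<in> {t0..s} \<Longrightarrow> norm (x u) \<le> r"
    show "norm (x s) \<le> r'"
    proof (rule apriori[of s x, OF _ x0])
      fix u assume u: "u \<in> {t0..s}"
      have "(x has_vector_derivative f u (?\<pi> (x u))) (at u within {t0..s})"
        by (rule has_vector_derivative_within_subset[OF x]) (use u in auto)
      then show "(x has_vector_derivative f u (x u)) (at u within {t0..s})"
        using \<pi>_id[OF in_ball[OF u]] by simp
    qed (use s in simp)
  qed (use that x0 init gap in auto)
  then show ?thesis using x x0 \<pi>_id by (intro exI[of _ x]) auto
qed

section \<open>Estimator filters\<close>

text \<open>
  The filter weights the past forcing with the kernel \<open>w * exp (- w * (t1 - t))\<close>, whose mass and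
  whose first moment in \<open>w * (t1 - t)\<close> are at most one. So a forcing that grows linearly into the past
  costs no more than a constant one, which is what allows slowly varying quantities to be frozen at
  their final value.
\<close>

lemma filter_error_bound:
  fixes p :: "real \<Rightarrow> real"
  assumes "t0 \<le> t1" "0 < w" "0 \<le> b" "0 \<le> b'"
    and p: "\<And>t. t \<in> {t0..t1} \<Longrightarrow> (p has_real_derivative p' t) (at t within {t0..t1})"
    and forcing: "\<And>t. t \<in> {t0..t1} \<Longrightarrow> \<bar>p' t + w * p t\<bar> \<le> w * (b + b' * (w * (t1 - t)))"
    and init: "\<bar>p t0\<bar> \<le> X"
  shows "\<bar>p t1\<bar> \<le> b + b' + X * exp (- w * (t1 - t0))"
proof -
  define q where "q = (\<lambda>t. b + b' * (w * (t1 - t) + 1) + X * exp (- w * (t - t0)))"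
  have "\<bar>p t1\<bar> \<le> q t1"
  proof (rule linear_filter_comparison[OF assms(1) p, where w = w
        and q' = "\<lambda>t. - b' * w - w * (X * exp (- w * (t - t0)))"])
    fix t
    show "(q has_real_derivative - b' * w - w * (X * exp (- w * (t - t0)))) (at t within {t0..t1})"
      unfolding q_def by (rule derivative_eq_intros refl | simp)+
    assume t: "t \<in> {t0..t1}"
    show "\<bar>p' t + w * p t\<bar> \<le> - b' * w - w * (X * exp (- w * (t - t0))) + w * q t"
      using forcing[OF t] by (simp add: q_def algebra_simps)
  next
    have "0 \<le> b + b' * (w * (t1 - t0) + 1)"
      using assms by (intro add_nonneg_nonneg mult_nonneg_nonneg) auto
    then show "\<bar>p t0\<bar> \<le> q t0" using init by (simp add: q_def)
  qed
  then show ?thesis by (simp add: q_def)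
qed

text \<open>
  The equations for \<open>(G_J, \<eta>_J)\<close> and for \<open>(G_h, \<eta>_h)\<close> are this system for \<open>f = J\<close> and
  \<open>f = h\<close>, along the estimate \<open>y\<close> and with filter rate \<open>w\<close>.
\<close>

definition estimator_on ::
  "(real^'n \<Rightarrow> real) \<Rightarrow> ('n::finite \<Rightarrow> real) \<Rightarrow> real \<Rightarrow> real \<Rightarrow> real \<Rightarrow> real \<Rightarrow>
   (real \<Rightarrow> real^'n) \<Rightarrow> (real \<Rightarrow> real) \<Rightarrow> (real \<Rightarrow> real^'n) \<Rightarrow> bool" where
  "estimator_on f \<omega> a w t0 t1 y \<eta> G \<longleftrightarrow>
     (\<forall>t\<in>{t0..t1}.
        (\<eta> has_real_derivative - w * (\<eta> t - f (y t + probe_S a \<omega> t))) (at t within {t0..t1}) \<and>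
        (G has_vector_derivative
          (- w) *\<^sub>R (G t - (f (y t + probe_S a \<omega> t) - \<eta> t) *\<^sub>R demod_M a \<omega> t)) (at t within {t0..t1}))"

lemma estimator_on_subinterval:
  assumes "estimator_on f \<omega> a w t0 t1 y \<eta> G" and "s \<le> t1"
  shows "estimator_on f \<omega> a w t0 s y \<eta> G"
proof -
  have sub: "{t0..s} \<subseteq> {t0..t1}" using assms by auto
  then show ?thesis using assms(1) unfolding estimator_on_def
    by (meson DERIV_subset has_vector_derivative_within_subset subsetD)
qed

lemma norm_le_CARD_times:
  fixes x :: "real^'n"
  assumes "\<And>i. \<bar>x $ i\<bar> \<le> b"
  shows "norm x \<le> real CARD('n) * b"
proof -
  have "norm x \<le> (\<Sum>i\<in>UNIV. \<bar>x $ i\<bar>)" by (rule norm_le_l1_cart)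
  also have "\<dots> \<le> (\<Sum>i\<in>(UNIV::'n set). b)" by (intro sum_mono assms)
  finally show ?thesis by simp
qed

lemma norm_probe_S_le:
  "0 < a \<Longrightarrow> norm (probe_S a \<omega> t :: real^'n::finite) \<le> real CARD('n) * a"
  by (rule norm_le_CARD_times) (simp add: probe_S_def abs_mult mult_left_le)

lemma norm_demod_M_le:
  "0 < a \<Longrightarrow> norm (demod_M a \<omega> t :: real^'n::finite) \<le> real CARD('n) * (2 / a)"
  by (rule norm_le_CARD_times) (simp add: demod_M_def abs_mult divide_right_mono)

lemma probe_S_in_ball:
  fixes y :: "real^'n"
  assumes "y \<in> cball \<theta>c R" "0 < a" "a \<le> 1"
  shows "y + probe_S a \<omega> t \<in> cball \<theta>c (R + real CARD('n))"
proof -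
  have "real CARD('n) * a \<le> real CARD('n) * 1" using assms by (intro mult_left_mono) auto
  then have "norm (probe_S a \<omega> t :: real^'n) \<le> real CARD('n)"
    using order_trans[OF norm_probe_S_le[OF assms(2), of \<omega> t]] by simp
  then have "dist y (y + probe_S a \<omega> t) \<le> real CARD('n)" by (simp add: dist_norm)
  then show ?thesis using assms(1) dist_triangle[of \<theta>c "y + probe_S a \<omega> t" y] by simp
qed

lemma estimator_component_derivative:
  fixes G :: "real \<Rightarrow> real^'n"
  assumes "estimator_on f \<omega> a w t0 t1 y \<eta> G" "t \<in> {t0..t1}"
  shows "((\<lambda>t. G t $ i) has_real_derivative
      - w * (G t $ i - (f (y t + probe_S a \<omega> t) - \<eta> t) * ((2 / a) * sin (\<omega> i * t)))) (at t within {t0..t1})"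
proof -
  have "(G has_vector_derivative
      (- w) *\<^sub>R (G t - (f (y t + probe_S a \<omega> t) - \<eta> t) *\<^sub>R demod_M a \<omega> t)) (at t within {t0..t1})"
    using assms unfolding estimator_on_def by blast
  moreover have "((- w) *\<^sub>R (G t - u *\<^sub>R demod_M a \<omega> t)) $ i = - w * (G t $ i - u * ((2 / a) * sin (\<omega> i * t)))" for u
    by (simp add: demod_M_def)
  ultimately show ?thesis
    using bounded_linear.has_vector_derivative[OF bounded_linear_vec_nth, of G _ _ i]
    unfolding has_real_derivative_iff_has_vector_derivative by fastforce
qed

text \<open>
  A filter never exceeds the larger of its input and its initial value. The bound for \<open>G\<close> is of order
  \<open>1 / a\<close> because of the amplitude of the demodulation signal; a choice of \<open>k\<close> that
  depends on \<open>a\<close> makes up for it.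
\<close>

lemma estimators_bounded:
  fixes f :: "real^'n \<Rightarrow> real"
  assumes B: "\<And>x. x \<in> cball \<theta>c (R + real CARD('n)) \<Longrightarrow> \<bar>f x\<bar> \<le> B"
    and "t0 \<le> t1" "0 < a" "a \<le> 1" "0 < w"
    and est: "estimator_on f \<omega> a w t0 t1 y \<eta> G"
    and y: "\<And>t. t \<in> {t0..t1} \<Longrightarrow> y t \<in> cball \<theta>c R"
    and init: "\<bar>\<eta> t0\<bar> \<le> X" "norm (G t0) \<le> X"
  shows "\<bar>\<eta> t1\<bar> \<le> B + X" and "norm (G t1) \<le> real CARD('n) * ((2 * B + X) * (2 / a) + X)"
proof -
  have fB: "\<bar>f (y t + probe_S a \<omega> t)\<bar> \<le> B" if "t \<in> {t0..t1}" for t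
    using B probe_S_in_ball[OF y[OF that] \<open>0 < a\<close> \<open>a \<le> 1\<close>] by blast
  have "0 \<le> B" using fB[of t0] \<open>t0 \<le> t1\<close> by auto
  have "0 \<le> X" using init(1) by linarith
  have forget: "\<bar>p s\<bar> \<le> b + X"
    if s: "s \<in> {t0..t1}" and "0 \<le> b"
      and p: "\<And>t. t \<in> {t0..s} \<Longrightarrow> (p has_real_derivative - w * (p t - g t)) (at t within {t0..s})"
      and g: "\<And>t. t \<in> {t0..s} \<Longrightarrow> \<bar>g t\<bar> \<le> b" and "\<bar>p t0\<bar> \<le> X" for p g b s
  proof -
    have "\<bar>p s\<bar> \<le> b + 0 + X * exp (- w * (s - t0))"
    proof (rule filter_error_bound[OF _ \<open>0 < w\<close> \<open>0 \<le> b\<close> _ p])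
      fix t assume t: "t \<in> {t0..s}"
      have "\<bar>- w * (p t - g t) + w * p t\<bar> = w * \<bar>g t\<bar>"
        using \<open>0 < w\<close> by (simp add: algebra_simps abs_mult)
      then show "\<bar>- w * (p t - g t) + w * p t\<bar> \<le> w * (b + 0 * (w * (s - t)))"
        using g[OF t] \<open>0 < w\<close> by simp
    qed (use that in auto)
    moreover have "X * exp (- w * (s - t0)) \<le> X * 1"
      using s \<open>0 < w\<close> \<open>0 \<le> X\<close> by (intro mult_left_mono) auto
    ultimately show ?thesis by simp
  qed
  have \<eta>: "\<bar>\<eta> s\<bar> \<le> B + X" if "s \<in> {t0..t1}" for s
  proof (rule forget[OF that \<open>0 \<le> B\<close>])
    fix t assume t: "t \<in> {t0..s}"
    show "(\<eta> has_real_derivative - w * (\<eta> t - f (y t + probe_S a \<omega> t))) (at t within {t0..s})"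
      using estimator_on_subinterval[OF est, of s] that t unfolding estimator_on_def by auto
    show "\<bar>f (y t + probe_S a \<omega> t)\<bar> \<le> B" using fB t that by auto
  qed (rule init)
  then show "\<bar>\<eta> t1\<bar> \<le> B + X" using \<open>t0 \<le> t1\<close> by simp
  show "norm (G t1) \<le> real CARD('n) * ((2 * B + X) * (2 / a) + X)"
  proof (rule norm_le_CARD_times)
    fix i
    show "\<bar>G t1 $ i\<bar> \<le> (2 * B + X) * (2 / a) + X"
    proof (rule forget[where p = "\<lambda>t. G t $ i" and s = t1])
      fix t assume t: "t \<in> {t0..t1}"
      show "((\<lambda>t. G t $ i) has_real_derivative
          - w * (G t $ i - (f (y t + probe_S a \<omega> t) - \<eta> t) * ((2 / a) * sin (\<omega> i * t)))) (at t within {t0..t1})"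
        by (rule estimator_component_derivative[OF est t])
      have "\<bar>f (y t + probe_S a \<omega> t) - \<eta> t\<bar> \<le> 2 * B + X" using fB[OF t] \<eta>[OF t] by linarith
      moreover have "\<bar>(2 / a) * sin (\<omega> i * t)\<bar> \<le> 2 / a"
        using \<open>0 < a\<close> by (simp add: abs_mult divide_right_mono)
      ultimately show "\<bar>(f (y t + probe_S a \<omega> t) - \<eta> t) * ((2 / a) * sin (\<omega> i * t))\<bar> \<le> (2 * B + X) * (2 / a)"
        unfolding abs_mult[of "_ - _"] by (intro mult_mono) auto
    next
      show "\<bar>G t0 $ i\<bar> \<le> X" using component_le_norm_cart[of "G t0" i] init by linarith
    qed (use \<open>t0 \<le> t1\<close> \<open>0 \<le> B\<close> \<open>0 \<le> X\<close> \<open>0 < a\<close> in auto)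
  qed
qed

text \<open>
  Demodulation multiplies the sines of the probing signal with each other. By the product-to-sum
  formulas each product is its mean plus cosines of nonzero frequency, as the frequencies are
  distinct.
\<close>

lemma sine_products_antiderivative:
  fixes \<omega> :: "'n::finite \<Rightarrow> real"
  assumes "\<And>i. 0 < \<omega> i" and "inj \<omega>"
  obtains P Q where "0 < Q" "\<And>i. 1 / \<omega> i \<le> Q" "\<And>i j t. \<bar>P i j t\<bar> \<le> Q"
    and "\<And>i j t A. (P i j has_real_derivative
           2 * sin (\<omega> i * t) * sin (\<omega> j * t) - (if i = j then 1 else 0)) (at t within A)"
proof -
  define P where "P = (\<lambda>i j t. if i = j then - sin (2 * \<omega> i * t) / (2 * \<omega> i)
    else sin ((\<omega> i - \<omega> j) * t) / (\<omega> i - \<omega> j) - sin ((\<omega> i + \<omega> j) * t) / (\<omega> i + \<omega> j))"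
  define b where "b = (\<lambda>(i, j). 1 / \<omega> i + 1 / \<bar>\<omega> i - \<omega> j\<bar> + 1 / (\<omega> i + \<omega> j))"
  define Q where "Q = Max (range b)"
  have bQ: "b ij \<le> Q" for ij unfolding Q_def by (intro Max_ge) auto
  have pos: "0 < \<omega> i" "0 < \<omega> i + \<omega> j" for i j using assms(1) by (auto intro: add_pos_pos)
  have quot: "\<bar>sin s / u\<bar> \<le> 1 / \<bar>u\<bar>" for s u :: real
    by (simp add: divide_right_mono)
  have Qi: "1 / \<omega> i \<le> Q" for i
  proof -
    have "1 / \<omega> i \<le> b (i, i)" unfolding b_def using pos(1)[of i] by (simp add: divide_simps)
    then show ?thesis using bQ order_trans by blast
  qed
  show thesis
  proof (rule that[of Q P])
    fix i :: 'n show "1 / \<omega> i \<le> Q" by (rule Qi)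
  next
    show "0 < Q" using Qi[of undefined] pos(1)[of undefined] by (smt (verit) divide_pos_pos)
  next
    fix i j t
    show "\<bar>P i j t\<bar> \<le> Q"
    proof (cases "i = j")
      case True
      have "\<bar>P i j t\<bar> \<le> 1 / \<bar>2 * \<omega> i\<bar>" unfolding P_def using True quot[of "2 * \<omega> i * t" "2 * \<omega> i"] by simp
      also have "\<dots> \<le> 1 / \<omega> i" using pos(1)[of i] by (simp add: field_simps)
      finally show ?thesis using Qi[of i] by linarith
    next
      case False
      have "\<bar>P i j t\<bar> \<le> 1 / \<bar>\<omega> i - \<omega> j\<bar> + 1 / \<bar>\<omega> i + \<omega> j\<bar>"
        unfolding P_def using False quot[of "(\<omega> i - \<omega> j) * t" "\<omega> i - \<omega> j"] quot[of "(\<omega> i + \<omega> j) * t" "\<omega> i + \<omega> j"]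
        by (simp only: if_False)
      also have "\<dots> \<le> b (i, j)" unfolding b_def using pos(1)[of i] pos(2)[of i j] by simp
      finally show ?thesis using bQ[of "(i, j)"] by linarith
    qed
  next
    fix i j t and A :: "real set"
    show "(P i j has_real_derivative 2 * sin (\<omega> i * t) * sin (\<omega> j * t) - (if i = j then 1 else 0)) (at t within A)"
    proof (cases "i = j")
      case True
      have "((\<lambda>t. - sin (2 * \<omega> i * t) / (2 * \<omega> i)) has_real_derivative - cos (2 * \<omega> i * t)) (at t within A)"
        using pos(1)[of i] by (auto intro!: derivative_eq_intros)
      moreover have "- cos (2 * \<omega> i * t) = 2 * sin (\<omega> i * t) * sin (\<omega> i * t) - 1"
        using cos_double_sin[of "\<omega> i * t"] by (simp add: power2_eq_square mult.assoc)
      ultimately show ?thesis using True unfolding P_def by simp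
    next
      case False
      then have "\<omega> i - \<omega> j \<noteq> 0" "\<omega> i + \<omega> j \<noteq> 0" using injD[OF assms(2), of i j] False pos(2)[of i j] by auto
      then have "((\<lambda>t. sin ((\<omega> i - \<omega> j) * t) / (\<omega> i - \<omega> j) - sin ((\<omega> i + \<omega> j) * t) / (\<omega> i + \<omega> j))
          has_real_derivative cos ((\<omega> i - \<omega> j) * t) - cos ((\<omega> i + \<omega> j) * t)) (at t within A)"
        by (auto intro!: derivative_eq_intros)
      moreover have "cos ((\<omega> i - \<omega> j) * t) - cos ((\<omega> i + \<omega> j) * t) = 2 * sin (\<omega> i * t) * sin (\<omega> j * t)"
        by (simp add: left_diff_distrib distrib_right cos_diff cos_add)
      ultimately show ?thesis using False unfolding P_def by simp
    qed
  qed
qed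

text \<open>
  The error of the value estimate obeys the filter equation with a forcing of order \<open>w * a\<close>: the
  probing signal changes \<open>f\<close> by \<open>O(a)\<close>, and \<open>y\<close> moves at a speed of at most \<open>w * a\<close>.
\<close>

lemma value_error_dynamics:
  fixes f :: "real^'n \<Rightarrow> real"
  assumes C1: "C1_loc_lipschitz_grad f"
    and Bg: "\<And>x. x \<in> cball \<theta>c (R + real CARD('n)) \<Longrightarrow> norm (grad f x) \<le> B"
    and Bl: "\<And>x x'. x \<in> cball \<theta>c (R + real CARD('n)) \<Longrightarrow> x' \<in> cball \<theta>c (R + real CARD('n)) \<Longrightarrow>
        \<bar>f x - f x'\<bar> \<le> B * norm (x - x')"
    and a: "0 < a" "a \<le> 1" and "0 < w"
    and est: "estimator_on f \<omega> a w t0 t1 y \<eta> G"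
    and y: "(y has_vector_derivative y') (at t within {t0..t1})" "norm y' \<le> w * a" "y t \<in> cball \<theta>c R"
    and t: "t \<in> {t0..t1}"
  obtains e' where "((\<lambda>t. \<eta> t - f (y t)) has_real_derivative e') (at t within {t0..t1})"
    and "\<bar>e' + w * (\<eta> t - f (y t))\<bar> \<le> w * (B * (real CARD('n) + 1) * a)"
proof
  let ?S = "probe_S a \<omega> t"
  have in_ball: "y t \<in> cball \<theta>c (R + real CARD('n))" "y t + ?S \<in> cball \<theta>c (R + real CARD('n))"
    using y(3) probe_S_in_ball[OF y(3) a] by (auto intro: order_trans)
  have "0 \<le> B" using Bg[OF in_ball(1)] norm_ge_zero order_trans by blast
  have "(\<eta> has_real_derivative - w * (\<eta> t - f (y t + ?S))) (at t within {t0..t1})"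
    using est t unfolding estimator_on_def by blast
  then show "((\<lambda>t. \<eta> t - f (y t)) has_real_derivative
      - w * (\<eta> t - f (y t + ?S)) - grad f (y t) \<bullet> y') (at t within {t0..t1})"
    by (intro DERIV_diff has_real_derivative_along_curve[OF C1 y(1)])
  have "\<bar>f (y t + ?S) - f (y t)\<bar> \<le> B * (real CARD('n) * a)"
    using Bl[OF in_ball(2,1)] mult_left_mono[OF norm_probe_S_le[OF a(1), of \<omega> t] \<open>0 \<le> B\<close>] by simp
  then have "\<bar>w * (f (y t + ?S) - f (y t))\<bar> \<le> w * (B * (real CARD('n) * a))"
    using \<open>0 < w\<close> by (simp add: abs_mult)
  moreover have "\<bar>grad f (y t) \<bullet> y'\<bar> \<le> B * (w * a)"
    by (rule order_trans[OF Cauchy_Schwarz_ineq2 mult_mono[OF Bg[OF in_ball(1)] y(2) \<open>0 \<le> B\<close>]]) simp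
  moreover have "- w * (\<eta> t - f (y t + ?S)) - grad f (y t) \<bullet> y' + w * (\<eta> t - f (y t))
      = w * (f (y t + ?S) - f (y t)) - grad f (y t) \<bullet> y'" by (simp add: algebra_simps)
  ultimately show "\<bar>- w * (\<eta> t - f (y t + ?S)) - grad f (y t) \<bullet> y' + w * (\<eta> t - f (y t))\<bar>
      \<le> w * (B * (real CARD('n) + 1) * a)"
    by (simp add: algebra_simps)
qed

text \<open>
  The constant \<open>C\<close> of the persistent error will be chosen before \<open>a\<close>, whereas \<open>Y\<close> may depend on \<open>a\<close>.
\<close>

definition tracks_gradient ::
  "(real^'n \<Rightarrow> real) \<Rightarrow> ('n::finite \<Rightarrow> real) \<Rightarrow> (real^'n) set \<Rightarrow> real \<Rightarrow> real \<Rightarrow> real \<Rightarrow> real \<Rightarrow> bool" where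
  "tracks_gradient f \<omega> S C a X Y \<longleftrightarrow>
     (\<forall>w t0 t1 y y' \<eta> G.
        0 < w \<and> w \<le> 1 \<and> t0 \<le> t1 \<and> estimator_on f \<omega> a w t0 t1 y \<eta> G \<and>
        (\<forall>t\<in>{t0..t1}. (y has_vector_derivative y' t) (at t within {t0..t1}) \<and>
           norm (y' t) \<le> w * a \<and> y t \<in> S) \<and>
        \<bar>\<eta> t0\<bar> \<le> X \<and> norm (G t0) \<le> X \<longrightarrow>
        \<bar>\<eta> t1 - f (y t1)\<bar> \<le> C * (a + w) + Y * exp (- w * (t1 - t0)) \<and>
        norm (G t1 - grad f (y t1)) \<le> C * (a + w) + Y * exp (- w * (t1 - t0)))"

text \<open>
  Averaging by means of explicit correctors. Write \<open>s\<close> for the \<open>i\<close>-th sine, \<open>e\<close> for the error of the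
  value estimate and \<open>v\<close> for the gradient at the final time. Up to a remainder of order \<open>a\<close>, the input of the
  \<open>i\<close>-th gradient component is \<open>(2 / a) * s * (v \<bullet> probe_S a \<omega> t - e)\<close>. The first
  product is \<open>v $ i\<close> plus the derivative of a bounded function \<open>\<Phi>\<close>. The second one is \<open>e\<close> times the
  derivative of \<open>K = (2 / a) * cos (\<omega> i * t) / \<omega> i\<close>. Subtracting \<open>w * \<Phi>\<close> and \<open>w * (e * K)\<close> from the
  output turns both into terms of order \<open>w\<close>. What remains of the second one is \<open>K * (e' + w * e)\<close>, where
  the factor \<open>1 / a\<close> in \<open>K\<close> is harmless because \<open>e' + w * e\<close> is of order \<open>w * a\<close>.

  Freezing \<open>v\<close> avoids the derivative of the gradient, which need not exist. The price is an error
  proportional to the distance moved since time \<open>t\<close>, which the filter tolerates.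
\<close>

lemma estimators_track:
  fixes f :: "real^'n \<Rightarrow> real"
  assumes C1: "C1_loc_lipschitz_grad f"
    and \<omega>: "\<And>i. 0 < \<omega> i" "inj \<omega>"
  obtains C where "0 < C"
    and "\<And>a X. 0 < a \<Longrightarrow> a \<le> 1 \<Longrightarrow> 0 \<le> X \<Longrightarrow>
      \<exists>Y>0. tracks_gradient f \<omega> (cball \<theta>c R) C a X Y"
proof -
  let ?N = "real CARD('n)"
  let ?ball = "cball \<theta>c (R + ?N)"
  have N1: "1 \<le> ?N" by (simp add: Suc_leI)
  obtain B where B: "0 < B" and Bf: "\<And>x. x \<in> ?ball \<Longrightarrow> \<bar>f x\<bar> \<le> B"
    and Bg: "\<And>x. x \<in> ?ball \<Longrightarrow> norm (grad f x) \<le> B"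
    and Bl: "\<And>x x'. x \<in> ?ball \<Longrightarrow> x' \<in> ?ball \<Longrightarrow> \<bar>f x - f x'\<bar> \<le> B * norm (x - x')"
    and Bgl: "\<And>x x'. x \<in> ?ball \<Longrightarrow> x' \<in> ?ball \<Longrightarrow> norm (grad f x - grad f x') \<le> B * norm (x - x')"
    and Bt: "\<And>x x'. x \<in> ?ball \<Longrightarrow> x' \<in> ?ball \<Longrightarrow>
        \<bar>f x - f x' - grad f x' \<bullet> (x - x')\<bar> \<le> B * (norm (x - x'))\<^sup>2"
    by (rule C1_bounds_on_ball[OF C1, of \<theta>c "R + ?N"]) blast
  obtain P Q where Q: "0 < Q" and Q\<omega>: "\<And>i. 1 / \<omega> i \<le> Q" and PQ: "\<And>i j t. \<bar>P i j t\<bar> \<le> Q"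
    and P: "\<And>i j t A. (P i j has_real_derivative
           2 * sin (\<omega> i * t) * sin (\<omega> j * t) - (if i = j then 1 else 0)) (at t within A)"
    by (rule sine_products_antiderivative[OF \<omega>]) blast
  define c1 where "c1 = B * (?N + 1)"
  define D where "D = 2 * B * ?N\<^sup>2 + 2 * B * ?N + 4 * Q * c1 + 2 * ?N * B * Q"
  define C where "C = ?N * D + c1"
  have pos: "0 < c1" "0 < D" unfolding c1_def D_def using B N1 Q
    by (auto intro!: add_pos_pos mult_pos_pos simp: c1_def)
  show thesis
  proof (rule that[of C])
    show "0 < C" unfolding C_def using pos N1 by (intro add_pos_pos mult_pos_pos) auto
    fix a X :: real assume a: "0 < a" "a \<le> 1" and X: "0 \<le> X"
    define X1 where "X1 = X + B"
    \<comment> \<open>bounds the corrected output at the initial time\<close>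
    define Xp where "Xp = X + B + ?N * B * Q + X1 * (2 * Q / a)"
    define Y where "Y = ?N * (Xp + X1 * (2 * Q / a)) + X1"
    have X1: "0 < X1" unfolding X1_def using X B by simp
    have XQ: "0 < X1 * (2 * Q / a)" using X1 Q a by simp
    have Xp: "0 < Xp" unfolding Xp_def using X B N1 Q XQ by (intro add_nonneg_pos add_nonneg_nonneg) auto
    show "\<exists>Y>0. tracks_gradient f \<omega> (cball \<theta>c R) C a X Y"
      unfolding tracks_gradient_def
    proof (intro exI[of _ Y] conjI allI impI)
      have "0 < Xp + X1 * (2 * Q / a)" using Xp XQ by linarith
      then have Y_part: "0 < ?N * (Xp + X1 * (2 * Q / a))" using N1 by simp
      then show "0 < Y" unfolding Y_def using X1 by linarith
      fix w t0 t1 :: real and y y' :: "real \<Rightarrow> real^'n" and \<eta> :: "real \<Rightarrow> real" and G :: "real \<Rightarrow> real^'n"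
      assume *: "0 < w \<and> w \<le> 1 \<and> t0 \<le> t1 \<and> estimator_on f \<omega> a w t0 t1 y \<eta> G \<and>
        (\<forall>t\<in>{t0..t1}. (y has_vector_derivative y' t) (at t within {t0..t1}) \<and>
           norm (y' t) \<le> w * a \<and> y t \<in> cball \<theta>c R) \<and>
        \<bar>\<eta> t0\<bar> \<le> X \<and> norm (G t0) \<le> X"
      then have w: "0 < w" "w \<le> 1" and "t0 \<le> t1" and est: "estimator_on f \<omega> a w t0 t1 y \<eta> G"
        and y: "\<And>t. t \<in> {t0..t1} \<Longrightarrow> (y has_vector_derivative y' t) (at t within {t0..t1})"
        and speed: "\<And>t. t \<in> {t0..t1} \<Longrightarrow> norm (y' t) \<le> w * a"
        and ball: "\<And>t. t \<in> {t0..t1} \<Longrightarrow> y t \<in> cball \<theta>c R"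
        and init: "\<bar>\<eta> t0\<bar> \<le> X" "norm (G t0) \<le> X" by blast+
      have ball': "y t \<in> ?ball" "y t + probe_S a \<omega> t \<in> ?ball" if "t \<in> {t0..t1}" for t
        using ball[OF that] probe_S_in_ball[OF ball[OF that] a] by (auto intro: order_trans)
      define E where "E = exp (- w * (t1 - t0))"
      have "0 < E" unfolding E_def by simp
      define e where "e = (\<lambda>t. \<eta> t - f (y t))"
      have "\<exists>d. (e has_real_derivative d) (at t within {t0..t1}) \<and> \<bar>d + w * e t\<bar> \<le> w * (c1 * a)"
        if "t \<in> {t0..t1}" for t
        unfolding e_def c1_def
        by (rule value_error_dynamics[OF C1 Bg Bl a w(1) est y[OF that] speed[OF that] ball[OF that] that])
          blast+
      then obtain e' where e': "\<And>t. t \<in> {t0..t1} \<Longrightarrow> (e has_real_derivative e' t) (at t within {t0..t1})"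
        and ew: "\<And>t. t \<in> {t0..t1} \<Longrightarrow> \<bar>e' t + w * e t\<bar> \<le> w * (c1 * a)" by metis
      have e0: "\<bar>e t0\<bar> \<le> X1"
        unfolding e_def X1_def using init(1) Bf[OF ball'(1)[of t0]] \<open>t0 \<le> t1\<close> by auto
      have e1: "\<bar>e t1\<bar> \<le> c1 * a + X1 * E"
        using filter_error_bound[OF \<open>t0 \<le> t1\<close> w(1) _ _ e', of "c1 * a" 0 X1] ew e0 pos(1) a(1)
        unfolding E_def by simp
      have "X1 * E \<le> Y * E"
        unfolding Y_def using \<open>0 < E\<close> Y_part by (intro mult_right_mono) auto
      moreover have "c1 * a \<le> C * (a + w)"
        unfolding C_def using pos a w N1 by (intro mult_mono) (auto intro!: add_nonneg_nonneg mult_nonneg_nonneg)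
      ultimately show "\<bar>\<eta> t1 - f (y t1)\<bar> \<le> C * (a + w) + Y * exp (- w * (t1 - t0))"
        using e1 unfolding e_def E_def by linarith

      define v where "v = grad f (y t1)"
      have vB: "norm v \<le> B" unfolding v_def using Bg ball' \<open>t0 \<le> t1\<close> by simp
      have v_i: "\<bar>v $ j\<bar> \<le> B" for j using component_le_norm_cart[of v j] vB by linarith
      have drift: "norm (y t - y t1) \<le> w * a * (t1 - t)" if "t \<in> {t0..t1}" for t
      proof -
        have sub: "{t..t1} \<subseteq> {t0..t1}" using that by auto
        have "norm (y t1 - y t) \<le> w * a * t1 - w * a * t"
        proof (rule norm_diff_le_if_deriv_bound[where f' = y' and \<phi>' = "\<lambda>_. w * a"])
          fix s assume s: "s \<in> {t..t1}"
          show "(y has_vector_derivative y' s) (at s within {t..t1})"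
            by (rule has_vector_derivative_within_subset[OF y sub]) (use s sub in auto)
          show "norm (y' s) \<le> w * a" using speed s sub by blast
        qed (use that in \<open>auto intro!: derivative_eq_intros\<close>)
        then show ?thesis by (simp add: norm_minus_commute right_diff_distrib)
      qed
      have remainder: "\<bar>f (y t + probe_S a \<omega> t) - f (y t) - v \<bullet> probe_S a \<omega> t\<bar>
          \<le> B * ?N\<^sup>2 * a\<^sup>2 + B * ?N * a\<^sup>2 * (w * (t1 - t))" if t: "t \<in> {t0..t1}" for t
      proof -
        let ?S = "probe_S a \<omega> t"
        have S: "norm ?S \<le> ?N * a" by (rule norm_probe_S_le[OF a(1)])
        have "\<bar>f (y t + ?S) - f (y t) - grad f (y t) \<bullet> ?S\<bar> \<le> B * (norm ?S)\<^sup>2"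
          using Bt[OF ball'(2)[OF t] ball'(1)[OF t]] by simp
        also have "\<dots> \<le> B * (?N * a)\<^sup>2" using S B by (intro mult_left_mono power_mono) auto
        finally have 1: "\<bar>f (y t + ?S) - f (y t) - grad f (y t) \<bullet> ?S\<bar> \<le> B * ?N\<^sup>2 * a\<^sup>2"
          by (simp add: power_mult_distrib mult.assoc)
        have "norm (grad f (y t) - v) \<le> B * norm (y t - y t1)"
          unfolding v_def by (rule Bgl) (use ball'(1) t \<open>t0 \<le> t1\<close> in auto)
        also have "\<dots> \<le> B * (w * a * (t1 - t))" using drift[OF t] B by (intro mult_left_mono) auto
        finally have "norm (grad f (y t) - v) * norm ?S \<le> (B * (w * a * (t1 - t))) * (?N * a)"
          using S B w a t by (intro mult_mono) auto
        then have 2: "\<bar>(grad f (y t) - v) \<bullet> ?S\<bar> \<le> B * ?N * a\<^sup>2 * (w * (t1 - t))"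
          using Cauchy_Schwarz_ineq2[of "grad f (y t) - v" ?S] by (simp add: power2_eq_square mult_ac)
        have "f (y t + ?S) - f (y t) - v \<bullet> ?S
            = (f (y t + ?S) - f (y t) - grad f (y t) \<bullet> ?S) + (grad f (y t) - v) \<bullet> ?S"
          by (simp add: inner_diff_left)
        then show ?thesis using 1 2 by linarith
      qed
      have component: "\<bar>(G t1 - v) $ i\<bar> \<le> D * (a + w) + (Xp + X1 * (2 * Q / a)) * E" for i
      proof -
        define \<Phi> where "\<Phi> = (\<lambda>t. \<Sum>j\<in>UNIV. v $ j * P i j t)"
        have \<Phi>_bound: "\<bar>\<Phi> t\<bar> \<le> ?N * B * Q" for t
        proof -
          have "\<bar>\<Phi> t\<bar> \<le> (\<Sum>j\<in>UNIV. \<bar>v $ j * P i j t\<bar>)" unfolding \<Phi>_def by (rule sum_abs)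
          also have "\<dots> \<le> (\<Sum>j\<in>(UNIV :: 'n set). B * Q)"
            unfolding abs_mult using v_i PQ B by (intro sum_mono mult_mono) auto
          finally show ?thesis by simp
        qed
        have \<Phi>_deriv: "(\<Phi> has_real_derivative (2 / a) * sin (\<omega> i * t) * (v \<bullet> probe_S a \<omega> t) - v $ i)
            (at t within A)" for t A
        proof -
          have "(\<Phi> has_real_derivative
              (\<Sum>j\<in>UNIV. v $ j * (2 * sin (\<omega> i * t) * sin (\<omega> j * t) - (if i = j then 1 else 0)))) (at t within A)"
            unfolding \<Phi>_def by (intro DERIV_sum DERIV_cmult P)
          moreover have "(\<Sum>j\<in>UNIV. v $ j * (2 * sin (\<omega> i * t) * sin (\<omega> j * t) - (if i = j then 1 else 0)))
              = (\<Sum>j\<in>UNIV. 2 * sin (\<omega> i * t) * (v $ j * sin (\<omega> j * t))) - (\<Sum>j\<in>UNIV. if i = j then v $ j else 0)"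
            unfolding sum_subtractf[symmetric] by (intro sum.cong) (auto simp: algebra_simps)
          moreover have "(\<Sum>j\<in>UNIV. 2 * sin (\<omega> i * t) * (v $ j * sin (\<omega> j * t)))
              = (2 / a) * sin (\<omega> i * t) * (v \<bullet> probe_S a \<omega> t)"
            using a(1) by (simp add: inner_vec_def probe_S_def sum_distrib_left mult_ac)
          ultimately show ?thesis by simp
        qed
        define K where "K = (\<lambda>t. (2 / a) * (cos (\<omega> i * t) / \<omega> i))"
        have K_bound: "\<bar>K t\<bar> \<le> 2 * Q / a" for t
        proof -
          have "\<bar>cos (\<omega> i * t) / \<omega> i\<bar> \<le> 1 / \<omega> i"
            using \<omega>(1)[of i] by (simp add: divide_right_mono)
          then have "\<bar>cos (\<omega> i * t) / \<omega> i\<bar> \<le> Q" using Q\<omega>[of i] by linarith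
          then have "\<bar>2 / a\<bar> * \<bar>cos (\<omega> i * t) / \<omega> i\<bar> \<le> (2 / a) * Q"
            using a(1) by (intro mult_mono) auto
          then show ?thesis unfolding K_def abs_mult by (simp only: times_divide_eq_left)
        qed
        have K_deriv: "(K has_real_derivative - ((2 / a) * sin (\<omega> i * t))) (at t within A)" for t A
          unfolding K_def using \<omega>(1)[of i] a(1) by (auto intro!: derivative_eq_intros)
        define p where "p = (\<lambda>t. G t $ i - v $ i - w * \<Phi> t - w * (e t * K t))"
        \<comment> \<open>order \<open>a\<close> from the Taylor remainder, order \<open>w\<close> from the correctors\<close>
        define b where "b = 2 * B * ?N\<^sup>2 * a + (2 * Q * c1 + ?N * B * Q) * w"
        have "\<bar>p t1\<bar> \<le> b + 2 * B * ?N * a + Xp * exp (- w * (t1 - t0))"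
        proof (rule filter_error_bound[OF \<open>t0 \<le> t1\<close> w(1)])
          show "0 \<le> b" unfolding b_def using B Q pos a w N1
            by (intro add_nonneg_nonneg mult_nonneg_nonneg) auto
          show "0 \<le> 2 * B * ?N * a" using B a by simp
          have "\<bar>w * \<Phi> t0\<bar> \<le> 1 * (?N * B * Q)"
            unfolding abs_mult using \<Phi>_bound[of t0] w by (intro mult_mono) auto
          moreover have "\<bar>w * (e t0 * K t0)\<bar> \<le> 1 * (X1 * (2 * Q / a))"
            unfolding abs_mult using e0 K_bound[of t0] w X1 by (intro mult_mono) auto
          moreover have "\<bar>G t0 $ i\<bar> \<le> X" using component_le_norm_cart[of "G t0" i] init(2) by linarith
          ultimately show "\<bar>p t0\<bar> \<le> Xp"
            using v_i[of i] unfolding p_def Xp_def by linarith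
        next
          fix t assume t: "t \<in> {t0..t1}"
          let ?S = "probe_S a \<omega> t" and ?s = "(2 / a) * sin (\<omega> i * t)"
          let ?r = "f (y t + ?S) - f (y t) - v \<bullet> ?S"
          have "((\<lambda>t. e t * K t) has_real_derivative e' t * K t + - ?s * e t) (at t within {t0..t1})"
            by (rule DERIV_mult'[OF e'[OF t] K_deriv, THEN DERIV_cong]) simp
          then show "(p has_real_derivative
              - w * (G t $ i - (f (y t + ?S) - \<eta> t) * ?s) - 0 - w * (?s * (v \<bullet> ?S) - v $ i)
              - w * (e' t * K t + - ?s * e t)) (at t within {t0..t1})"
            unfolding p_def
            by (intro DERIV_diff DERIV_cmult estimator_component_derivative[OF est t] DERIV_const \<Phi>_deriv)
          have "\<bar>?s * ?r\<bar> \<le> (2 / a) * (B * ?N\<^sup>2 * a\<^sup>2 + B * ?N * a\<^sup>2 * (w * (t1 - t)))"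
            unfolding abs_mult[of ?s] using remainder[OF t] a(1)
            by (intro mult_mono) (auto simp: abs_mult divide_right_mono)
          also have "\<dots> = 2 * B * ?N\<^sup>2 * a + 2 * B * ?N * a * (w * (t1 - t))"
            using a(1) by (simp add: field_simps power2_eq_square)
          finally have 1: "\<bar>?s * ?r\<bar> \<le> 2 * B * ?N\<^sup>2 * a + 2 * B * ?N * a * (w * (t1 - t))" .
          have "\<bar>K t * (e' t + w * e t)\<bar> \<le> (2 * Q / a) * (w * (c1 * a))"
            unfolding abs_mult using K_bound[of t] ew[OF t] Q a(1) by (intro mult_mono) auto
          also have "\<dots> = 2 * Q * c1 * w" using a(1) by simp
          finally have 2: "\<bar>K t * (e' t + w * e t)\<bar> \<le> 2 * Q * c1 * w" .
          have 3: "\<bar>w * \<Phi> t\<bar> \<le> ?N * B * Q * w"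
            unfolding abs_mult using mult_left_mono[OF \<Phi>_bound[of t], of w] w(1) by (simp add: mult_ac)
          have "- w * (G t $ i - (f (y t + ?S) - \<eta> t) * ?s) - 0 - w * (?s * (v \<bullet> ?S) - v $ i)
              - w * (e' t * K t + - ?s * e t) + w * p t
              = w * (?s * ?r - K t * (e' t + w * e t) - w * \<Phi> t)"
          proof -
            have "- w * (g - (F - n) * s) - 0 - w * (s * u - v') - w * (d * \<kappa> + - s * (n - m))
                + w * (g - v' - w * \<phi> - w * ((n - m) * \<kappa>))
                = w * (s * (F - m - u) - \<kappa> * (d + w * (n - m)) - w * \<phi>)"
              for g F n s u v' d \<kappa> m \<phi> :: real
              by (simp add: algebra_simps)
            then show ?thesis unfolding p_def e_def .
          qed
          moreover have "\<bar>?s * ?r - K t * (e' t + w * e t) - w * \<Phi> t\<bar>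
              \<le> b + 2 * B * ?N * a * (w * (t1 - t))"
            using 1 2 3 unfolding b_def distrib_right by linarith
          ultimately show "\<bar>- w * (G t $ i - (f (y t + ?S) - \<eta> t) * ?s) - 0 - w * (?s * (v \<bullet> ?S) - v $ i)
              - w * (e' t * K t + - ?s * e t) + w * p t\<bar> \<le> w * (b + 2 * B * ?N * a * (w * (t1 - t)))"
            using w(1) by (simp only: abs_mult abs_of_pos mult_left_mono)
        qed
        moreover have "\<bar>w * \<Phi> t1\<bar> \<le> ?N * B * Q * w"
          unfolding abs_mult using mult_left_mono[OF \<Phi>_bound[of t1], of w] w(1) by (simp add: mult_ac)
        moreover have "\<bar>w * (e t1 * K t1)\<bar> \<le> 2 * Q * c1 * w + X1 * (2 * Q / a) * E"
        proof -
          have "\<bar>w * (e t1 * K t1)\<bar> \<le> w * ((c1 * a + X1 * E) * (2 * Q / a))"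
            unfolding abs_mult using e1 K_bound[of t1] w pos(1) a(1) X1 \<open>0 < E\<close>
            by (intro mult_mono) (auto intro!: add_nonneg_nonneg)
          also have "\<dots> = 2 * Q * c1 * w + w * (X1 * (2 * Q / a) * E)"
            using a(1) by (simp add: field_simps)
          also have "w * (X1 * (2 * Q / a) * E) \<le> 1 * (X1 * (2 * Q / a) * E)"
            using XQ \<open>0 < E\<close> by (intro mult_right_mono w(2) mult_nonneg_nonneg less_imp_le)
          finally show ?thesis by simp
        qed
        moreover have "(G t1 - v) $ i = p t1 + w * \<Phi> t1 + w * (e t1 * K t1)" by (simp add: p_def)
        ultimately have "\<bar>(G t1 - v) $ i\<bar> \<le> (2 * B * ?N\<^sup>2 + 2 * B * ?N) * a + (4 * Q * c1 + 2 * ?N * B * Q) * w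
            + (Xp + X1 * (2 * Q / a)) * E"
          unfolding b_def E_def by (simp add: algebra_simps)
        also have "(2 * B * ?N\<^sup>2 + 2 * B * ?N) * a \<le> D * a"
          unfolding D_def using B Q pos a by (intro mult_right_mono) auto
        also have "(4 * Q * c1 + 2 * ?N * B * Q) * w \<le> D * w"
          unfolding D_def using B Q pos w by (intro mult_right_mono) auto
        finally show ?thesis by (simp add: distrib_left)
      qed
      have "norm (G t1 - v) \<le> ?N * (D * (a + w) + (Xp + X1 * (2 * Q / a)) * E)"
        by (rule norm_le_CARD_times[OF component])
      also have "\<dots> = ?N * D * (a + w) + ?N * (Xp + X1 * (2 * Q / a)) * E" by (simp add: distrib_left)
      also have "?N * D * (a + w) \<le> C * (a + w)"
        unfolding C_def using pos a w by (intro mult_right_mono) auto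
      also have "?N * (Xp + X1 * (2 * Q / a)) * E \<le> Y * E"
        unfolding Y_def using X1 \<open>0 < E\<close> by (intro mult_right_mono) auto
      finally show "norm (G t1 - grad f (y t1)) \<le> C * (a + w) + Y * exp (- w * (t1 - t0))"
        by (simp add: v_def E_def)
    qed
  qed
qed

section \<open>The safety-filtered descent direction\<close>

text \<open>
  The first equation of the system without the factor \<open>k * \<omega>f\<close>, as a function of the estimates \<open>g\<close>,
  \<open>p\<close>, \<open>q\<close> of \<open>grad J\<close>, \<open>grad h\<close>, \<open>h\<close>.
\<close>

definition safe_dir :: "real \<Rightarrow> real \<Rightarrow> real^'n \<Rightarrow> real^'n \<Rightarrow> real \<Rightarrow> real^'n" where
  "safe_dir c Mp g p q = - g + (capped_inv_sq Mp p * max (g \<bullet> p - c * q) 0) *\<^sub>R p"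

text \<open>
  In this form continuity, and later Lipschitz continuity, at \<open>p = 0\<close> is evident.
\<close>

lemma capped_inv_sq_eq:
  assumes "0 < Mp"
  shows "capped_inv_sq Mp p = 1 / max ((norm p)\<^sup>2) (1 / Mp)"
proof (cases "p = 0")
  case False
  then have "0 < (norm p)\<^sup>2" by simp
  show ?thesis
  proof (cases "(norm p)\<^sup>2 \<le> 1 / Mp")
    case True
    then have "Mp \<le> 1 / (norm p)\<^sup>2" using assms \<open>0 < (norm p)\<^sup>2\<close> by (simp add: field_simps)
    then show ?thesis using True False by (simp add: capped_inv_sq_def max_def min_def)
  next
    case nle: False
    then have "1 / (norm p)\<^sup>2 \<le> Mp" using assms \<open>0 < (norm p)\<^sup>2\<close> by (simp add: field_simps)
    then show ?thesis using nle False by (simp add: capped_inv_sq_def max_def min_def)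
  qed
qed (use assms in \<open>simp add: capped_inv_sq_def\<close>)

lemma capped_inv_sq_bounds:
  assumes "0 < Mp"
  shows "0 < capped_inv_sq Mp p" "capped_inv_sq Mp p \<le> Mp" "capped_inv_sq Mp p * (norm p)\<^sup>2 \<le> 1"
    and "1 \<le> Mp * (norm p)\<^sup>2 \<Longrightarrow> capped_inv_sq Mp p * (norm p)\<^sup>2 = 1"
proof -
  let ?m = "max ((norm p)\<^sup>2) (1 / Mp)"
  have m: "0 < ?m" using assms by (simp add: less_max_iff_disj)
  show "0 < capped_inv_sq Mp p" using m unfolding capped_inv_sq_eq[OF assms] by simp
  have "1 / ?m \<le> 1 / (1 / Mp)" using assms by (intro divide_left_mono mult_pos_pos m) auto
  then show "capped_inv_sq Mp p \<le> Mp" unfolding capped_inv_sq_eq[OF assms] by simp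
  show "capped_inv_sq Mp p * (norm p)\<^sup>2 \<le> 1"
    unfolding capped_inv_sq_eq[OF assms] using m by (simp add: divide_le_eq)
  show "capped_inv_sq Mp p * (norm p)\<^sup>2 = 1" if "1 \<le> Mp * (norm p)\<^sup>2"
  proof -
    have "1 / Mp \<le> (norm p)\<^sup>2" using that assms by (simp add: divide_le_eq mult.commute)
    moreover have "p \<noteq> 0" using that by auto
    ultimately show ?thesis unfolding capped_inv_sq_eq[OF assms] by (simp add: max_absorb1)
  qed
qed

lemma continuous_on_safe_dir:
  assumes "0 < Mp" and "continuous_on A g" "continuous_on A p" "continuous_on A q"
  shows "continuous_on A (\<lambda>x. safe_dir c Mp (g x) (p x) (q x))"
proof -
  have "0 < max ((norm (p x))\<^sup>2) (1 / Mp)" for x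
    using assms(1) by (simp add: less_max_iff_disj)
  then have "max ((norm (p x))\<^sup>2) (1 / Mp) \<noteq> 0" for x
    by (rule less_imp_neq[THEN not_sym])
  then show ?thesis unfolding safe_dir_def capped_inv_sq_eq[OF assms(1)]
    using assms(2-4) by (intro continuous_intros) auto
qed

lemma norm_safe_dir_le:
  assumes "0 < Mp" "0 < c" and "norm g \<le> X" "norm p \<le> X" "\<bar>q\<bar> \<le> X"
  shows "norm (safe_dir c Mp g p q) \<le> X + Mp * (X * X + c * X) * X"
proof -
  have "0 \<le> X" using assms(5) by linarith
  have "\<bar>g \<bullet> p\<bar> \<le> X * X"
    using Cauchy_Schwarz_ineq2[of g p] mult_mono[OF assms(3,4) \<open>0 \<le> X\<close>] by simp
  moreover have "\<bar>c * q\<bar> \<le> c * X" using assms by (simp add: abs_mult)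
  moreover have "0 \<le> X * X + c * X" using \<open>0 \<le> X\<close> assms by simp
  ultimately have m: "max (g \<bullet> p - c * q) 0 \<le> X * X + c * X" by (auto simp: abs_le_iff)
  have "norm ((capped_inv_sq Mp p * max (g \<bullet> p - c * q) 0) *\<^sub>R p)
      = capped_inv_sq Mp p * max (g \<bullet> p - c * q) 0 * norm p"
    using capped_inv_sq_bounds(1)[OF assms(1), of p] by (simp add: abs_mult)
  also have "\<dots> \<le> Mp * (X * X + c * X) * X"
    using capped_inv_sq_bounds(1,2)[OF assms(1), of p] m assms \<open>0 \<le> X\<close>
    by (intro mult_mono) (auto intro!: mult_nonneg_nonneg add_nonneg_nonneg)
  finally show ?thesis unfolding safe_dir_def
    using norm_triangle_ineq[of "- g"] assms(3) by (smt (verit) norm_minus_cancel)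
qed

lemma barrier_rate_if_regular:
  assumes "0 < Mp" and "1 \<le> Mp * (norm p)\<^sup>2 \<or> g \<bullet> p \<le> c * q"
  shows "- c * q \<le> p \<bullet> safe_dir c Mp g p q"
proof -
  let ?m = "max (g \<bullet> p - c * q) 0" and ?l = "capped_inv_sq Mp p"
  have eq: "p \<bullet> safe_dir c Mp g p q = - (g \<bullet> p) + ?l * (norm p)\<^sup>2 * ?m"
    unfolding safe_dir_def inner_add_right inner_scaleR_right inner_minus_right
    by (simp add: inner_commute power2_norm_eq_inner)
  have "0 \<le> ?l * (norm p)\<^sup>2 * ?m"
    using capped_inv_sq_bounds(1)[OF assms(1), of p] by (intro mult_nonneg_nonneg) auto
  then show ?thesis
    unfolding eq using assms capped_inv_sq_bounds(4)[OF assms(1), of p] by auto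
qed

text \<open>
  If the cap is inactive, the correction replaces \<open>- (g \<bullet> p)\<close> by at least \<open>- c * q\<close>. If it is active,
  then \<open>q > 0\<close>, and \<open>p\<close> is so short that \<open>g \<bullet> p\<close> costs at most \<open>d\<close>.
\<close>

lemma barrier_rate:
  assumes "0 < Mp" "0 < c" "0 \<le> d" and "norm g \<le> B" and "B\<^sup>2 \<le> Mp * d\<^sup>2"
    and regular: "q \<le> 0 \<Longrightarrow> 1 \<le> Mp * (norm p)\<^sup>2"
  shows "- c * q - d \<le> p \<bullet> safe_dir c Mp g p q"
proof -
  let ?m = "max (g \<bullet> p - c * q) 0" and ?l = "capped_inv_sq Mp p"
  have eq: "p \<bullet> safe_dir c Mp g p q = - (g \<bullet> p) + ?l * (norm p)\<^sup>2 * ?m"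
    unfolding safe_dir_def inner_add_right inner_scaleR_right inner_minus_right
    by (simp add: inner_commute power2_norm_eq_inner)
  have "0 \<le> ?l * (norm p)\<^sup>2 * ?m"
    using capped_inv_sq_bounds(1)[OF assms(1), of p] by (intro mult_nonneg_nonneg) auto
  show ?thesis
  proof (cases "1 \<le> Mp * (norm p)\<^sup>2 \<or> g \<bullet> p \<le> c * q")
    case True
    then show ?thesis using barrier_rate_if_regular[OF assms(1) True] \<open>0 \<le> d\<close> by linarith
  next
    case False
    then have "0 < q" using regular by force
    \<comment> \<open>the cap is active, hence \<open>p\<close> is so short that \<open>g \<bullet> p\<close> is at most \<open>d\<close>\<close>
    have "(norm g * norm p)\<^sup>2 \<le> B\<^sup>2 * (norm p)\<^sup>2"
      unfolding power_mult_distrib by (intro mult_right_mono power_mono assms(4)) auto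
    also have "\<dots> \<le> (Mp * d\<^sup>2) * (norm p)\<^sup>2" by (intro mult_right_mono assms(5)) auto
    also have "\<dots> = d\<^sup>2 * (Mp * (norm p)\<^sup>2)" by simp
    also have "\<dots> \<le> d\<^sup>2 * 1" using False by (intro mult_left_mono) auto
    finally have "norm g * norm p \<le> d" using \<open>0 \<le> d\<close> by (simp add: power2_le_iff_abs_le)
    then have "g \<bullet> p \<le> d" using norm_cauchy_schwarz[of g p] by linarith
    moreover have "0 < c * q" using \<open>0 < c\<close> \<open>0 < q\<close> by simp
    ultimately show ?thesis using eq \<open>0 \<le> ?l * (norm p)\<^sup>2 * ?m\<close> by linarith
  qed
qed

lemma inner_safe_dir:
  "g \<bullet> safe_dir c Mp g p q
     = - (norm g)\<^sup>2 + capped_inv_sq Mp p * max (g \<bullet> p - c * q) 0 * (g \<bullet> p)"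
  unfolding safe_dir_def inner_add_right inner_scaleR_right inner_minus_right
  by (simp add: power2_norm_eq_inner)

text \<open>
  For \<open>q \<ge> 0\<close> the correction moves \<open>- g\<close> towards its projection onto the hyperplane orthogonal to
  \<open>p\<close>, but not beyond it.
\<close>

lemma norm_safe_dir_sq_le_descent:
  assumes "0 < Mp" "0 < c" "0 \<le> q"
  shows "(norm (safe_dir c Mp g p q))\<^sup>2 \<le> - (g \<bullet> safe_dir c Mp g p q)"
proof -
  define l m where "l = capped_inv_sq Mp p" and "m = max (g \<bullet> p - c * q) 0"
  have l: "0 < l" "l * (norm p)\<^sup>2 \<le> 1" unfolding l_def using capped_inv_sq_bounds[OF assms(1)] by auto
  have m: "0 \<le> m" "m * m \<le> m * (g \<bullet> p)"
    unfolding m_def using assms by (auto simp: max_def intro!: mult_left_mono)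
  have "(norm (safe_dir c Mp g p q))\<^sup>2 = (norm g)\<^sup>2 - 2 * (l * m * (g \<bullet> p)) + l * m * m * (l * (norm p)\<^sup>2)"
    unfolding safe_dir_def l_def[symmetric] m_def[symmetric] power2_norm_eq_inner
    by (simp add: inner_simps algebra_simps inner_commute)
  also have "l * m * m * (l * (norm p)\<^sup>2) \<le> l * m * m * 1"
    using l m by (intro mult_left_mono) auto
  also have "l * m * m * 1 \<le> l * m * (g \<bullet> p)"
    using mult_left_mono[OF m(2), of l] l by (simp add: mult.assoc)
  finally show ?thesis unfolding inner_safe_dir l_def[symmetric] m_def[symmetric] by simp
qed

text \<open>
  The correction would have to cancel all of \<open>- g\<close>, but the positive \<open>c * q\<close> keeps it from
  completing even the projection orthogonal to \<open>p\<close>.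
\<close>

lemma descent_if_safe:
  assumes "0 < Mp" "0 < c" "0 < q" "g \<noteq> 0"
  shows "g \<bullet> safe_dir c Mp g p q < 0"
proof -
  define l m where "l = capped_inv_sq Mp p" and "m = max (g \<bullet> p - c * q) 0"
  have l: "0 < l" "l * (norm p)\<^sup>2 \<le> 1" unfolding l_def using capped_inv_sq_bounds[OF assms(1)] by auto
  have "0 < (norm g)\<^sup>2" using assms by simp
  have "l * m * (g \<bullet> p) < (norm g)\<^sup>2"
  proof (cases "m = 0")
    case False
    have cq: "0 < c * q" using assms by simp
    from False have gp: "0 < g \<bullet> p" "m < g \<bullet> p" and m: "0 < m" unfolding m_def using cq by (auto simp: max_def split: if_splits)
    have "l * m * (g \<bullet> p) < l * (g \<bullet> p) * (g \<bullet> p)" using l gp by simp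
    also have "\<dots> = l * (g \<bullet> p)\<^sup>2" by (simp add: power2_eq_square)
    also have "\<dots> \<le> l * (norm g * norm p)\<^sup>2"
      using l gp norm_cauchy_schwarz[of g p] by (intro mult_left_mono power_mono) auto
    also have "\<dots> = (norm g)\<^sup>2 * (l * (norm p)\<^sup>2)" by (simp add: power_mult_distrib)
    also have "\<dots> \<le> (norm g)\<^sup>2 * 1" using l by (intro mult_left_mono) auto
    finally show ?thesis by simp
  qed (use \<open>0 < (norm g)\<^sup>2\<close> in simp)
  then show ?thesis unfolding inner_safe_dir l_def[symmetric] m_def[symmetric] by simp
qed

text \<open>
  Removing the component along \<open>p\<close> leaves at least the fraction \<open>1 - f\<^sup>2\<close> of the squared length of \<open>g\<close>,
  by the bound on the angle. The other term is due to the push back to the safe set, whose length is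
  \<open>c * \<bar>q\<bar> / norm p\<close>.
\<close>

lemma descent_if_unsafe:
  assumes "0 < Mp" "0 < c" "q \<le> 0" and regular: "1 \<le> Mp * (norm p)\<^sup>2" and "0 < L" "L \<le> norm p"
    and f: "0 \<le> f" "f < 1" and angle: "g \<bullet> p \<le> f * (norm g * norm p)"
  shows "g \<bullet> safe_dir c Mp g p q \<le> - (1 - f\<^sup>2) * (norm g)\<^sup>2 + c * \<bar>q\<bar> / L * norm g"
proof -
  define l m where "l = capped_inv_sq Mp p" and "m = max (g \<bullet> p - c * q) 0"
  have l: "0 < l" and lp: "l * (norm p)\<^sup>2 = 1"
    unfolding l_def using capped_inv_sq_bounds[OF assms(1)] regular by auto
  have p: "0 < norm p" using \<open>0 < L\<close> \<open>L \<le> norm p\<close> by linarith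
  have aq: "c * \<bar>q\<bar> = - (c * q)" "0 \<le> c * \<bar>q\<bar>" using assms by (auto simp: abs_if)
  have "l * m * (g \<bullet> p) \<le> f\<^sup>2 * (norm g)\<^sup>2 + c * \<bar>q\<bar> / L * norm g"
  proof (cases "0 < g \<bullet> p")
    case True
    then have m: "m = g \<bullet> p + c * \<bar>q\<bar>" unfolding m_def aq(1) using aq by simp
    have "l * m * (g \<bullet> p) = l * (g \<bullet> p)\<^sup>2 + l * (c * \<bar>q\<bar>) * (g \<bullet> p)"
      unfolding m by (simp add: algebra_simps power2_eq_square)
    also have "l * (g \<bullet> p)\<^sup>2 \<le> l * (f * (norm g * norm p))\<^sup>2"
      using True l angle by (intro mult_left_mono power_mono) auto
    also have "l * (f * (norm g * norm p))\<^sup>2 = f\<^sup>2 * (norm g)\<^sup>2 * (l * (norm p)\<^sup>2)"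
      by (simp add: power_mult_distrib)
    also have "\<dots> = f\<^sup>2 * (norm g)\<^sup>2" using lp by simp
    also have "l * (c * \<bar>q\<bar>) * (g \<bullet> p) \<le> l * (c * \<bar>q\<bar>) * (norm g * norm p)"
      by (rule mult_left_mono[OF norm_cauchy_schwarz mult_nonneg_nonneg[OF less_imp_le[OF l] aq(2)]])
    also have "l * (c * \<bar>q\<bar>) * (norm g * norm p) = c * \<bar>q\<bar> / norm p * norm g"
    proof -
      have "l = 1 / (norm p)\<^sup>2" using lp p by (simp add: field_simps)
      then show ?thesis using p by (simp add: power2_eq_square)
    qed
    also have "c * \<bar>q\<bar> / norm p * norm g \<le> c * \<bar>q\<bar> / L * norm g"
      by (rule mult_right_mono[OF divide_left_mono[OF \<open>L \<le> norm p\<close> aq(2)]])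
        (use p \<open>0 < L\<close> in auto)
    finally show ?thesis by simp
  next
    case False
    have "l * m * (g \<bullet> p) \<le> 0"
      using False l by (intro mult_nonneg_nonpos) (auto simp: m_def)
    moreover have "0 \<le> f\<^sup>2 * (norm g)\<^sup>2 + c * \<bar>q\<bar> / L * norm g"
      using mult_nonneg_nonneg[OF divide_nonneg_pos[OF aq(2) \<open>0 < L\<close>] norm_ge_zero]
      by (intro add_nonneg_nonneg) auto
    ultimately show ?thesis by linarith
  qed
  then show ?thesis unfolding inner_safe_dir l_def[symmetric] m_def[symmetric]
    by (simp add: algebra_simps)
qed

section \<open>Perturbed nominal flow\<close>

definition nominal_field ::
  "(real^'n \<Rightarrow> real) \<Rightarrow> (real^'n \<Rightarrow> real) \<Rightarrow> real \<Rightarrow> real \<Rightarrow> real^'n \<Rightarrow> real^'n" where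
  "nominal_field J h c Mp \<theta> = safe_dir c Mp (grad J \<theta>) (grad h \<theta>) (h \<theta>)"

text \<open>
  The factor \<open>\<kappa>\<close> is the time scale \<open>k * \<omega>f\<close>. The disturbance \<open>\<epsilon>\<close> is measured relative to it, so that
  estimates in the scaled time \<open>\<kappa> * (t1 - t0)\<close> are uniform in \<open>\<kappa>\<close>.
\<close>

definition near_flow ::
  "('a::real_normed_vector \<Rightarrow> 'a) \<Rightarrow> real \<Rightarrow> real \<Rightarrow> 'a set \<Rightarrow> real \<Rightarrow> real \<Rightarrow> (real \<Rightarrow> 'a) \<Rightarrow> bool" where
  "near_flow N \<kappa> \<epsilon> S t0 t1 y \<longleftrightarrow>
     (\<exists>y'. \<forall>t\<in>{t0..t1}. (y has_vector_derivative y' t) (at t within {t0..t1}) \<and>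
            norm (y' t - \<kappa> *\<^sub>R N (y t)) \<le> \<kappa> * \<epsilon> \<and> y t \<in> S)"

lemma near_flow_subinterval:
  assumes "near_flow N \<kappa> \<epsilon> S t0 t1 y" "t0 \<le> s0" "s1 \<le> t1"
  shows "near_flow N \<kappa> \<epsilon> S s0 s1 y"
proof -
  have "{s0..s1} \<subseteq> {t0..t1}" using assms by auto
  then show ?thesis using assms(1) unfolding near_flow_def
    by (meson has_vector_derivative_within_subset subsetD)
qed

lemma near_flow_mono:
  assumes "near_flow N \<kappa> \<epsilon> S t0 t1 y" "\<epsilon> \<le> \<epsilon>'" "0 \<le> \<kappa>"
  shows "near_flow N \<kappa> \<epsilon>' S t0 t1 y"
  using assms mult_left_mono[of \<epsilon> \<epsilon>' \<kappa>] unfolding near_flow_def by (meson order_trans)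

lemma inner_near_bounds:
  fixes g :: "'a::real_inner"
  assumes "norm (y' - \<kappa> *\<^sub>R v) \<le> \<kappa> * \<epsilon>" and "norm g \<le> B"
  shows "\<bar>g \<bullet> y' - \<kappa> * (g \<bullet> v)\<bar> \<le> B * (\<kappa> * \<epsilon>)"
proof -
  have "g \<bullet> y' - \<kappa> * (g \<bullet> v) = g \<bullet> (y' - \<kappa> *\<^sub>R v)" by (simp add: inner_diff_right)
  also have "\<bar>\<dots>\<bar> \<le> norm g * norm (y' - \<kappa> *\<^sub>R v)" by (rule Cauchy_Schwarz_ineq2)
  also have "\<dots> \<le> B * (\<kappa> * \<epsilon>)"
    by (rule mult_mono) (use assms norm_ge_zero order_trans in \<open>blast+\<close>)
  finally show ?thesis .
qed

subsection \<open>The barrier along the flow\<close>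

lemma grad_h_bounded_below_on_ball:
  assumes "assm_A2 h" "0 \<le> R"
  obtains L where "0 < L" "\<And>\<theta>. \<theta> \<in> cball \<theta>c R \<Longrightarrow> h \<theta> \<le> 0 \<Longrightarrow> L < norm (grad h \<theta>)"
proof -
  have C1: "C1_loc_lipschitz_grad h" using assms unfolding assm_A2_def by blast
  have "cball \<theta>c R \<noteq> {}" using \<open>0 \<le> R\<close> by simp
  then obtain \<theta>m where "\<theta>m \<in> cball \<theta>c R" and min: "\<And>\<theta>. \<theta> \<in> cball \<theta>c R \<Longrightarrow> h \<theta>m \<le> h \<theta>"
    using continuous_attains_inf[of "cball \<theta>c R" h] C1_continuous_on[OF C1] by auto
  show thesis
  proof (cases "h \<theta>m \<le> 0")
    case True
    then have "h \<theta>m \<in> range h \<inter> {..0}" by auto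
    then obtain L where "L > 0" "\<And>\<theta>. \<theta> \<in> unsafe_set h \<inter> super_set h (h \<theta>m) \<Longrightarrow> L < norm (grad h \<theta>)"
      using assms unfolding assm_A2_def by blast
    then show thesis using that[of L] min unfolding unsafe_set_def super_set_def by auto
  next
    case False
    then show thesis using that[of 1] min by fastforce
  qed
qed

text \<open>
  The bound on the gradient of \<open>h\<close> away from zero is taken on the part of the ball where
  \<open>h \<le> 0\<close>; there a large \<open>Mp\<close> makes the cap inactive. Half of the admissible
  error \<open>c * d\<close> is spent on the cap, the other half on the disturbance.
\<close>

lemma barrier_along_near_flow:
  fixes h J :: "real^'n \<Rightarrow> real"
  assumes A2: "assm_A2 h" and C1J: "C1_loc_lipschitz_grad J" and "0 < c" "0 < d" "0 \<le> R"
  obtains Mp0 \<epsilon>0 where "0 < Mp0" "0 < \<epsilon>0"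
    and "\<And>Mp \<kappa> t0 t1 y. Mp0 \<le> Mp \<Longrightarrow> 0 < \<kappa> \<Longrightarrow> t0 \<le> t1 \<Longrightarrow>
      near_flow (nominal_field J h c Mp) \<kappa> \<epsilon>0 (cball \<theta>c R) t0 t1 y \<Longrightarrow>
      h (y t0) * exp (- c * \<kappa> * (t1 - t0)) - d \<le> h (y t1)"
proof -
  have C1: "C1_loc_lipschitz_grad h" using A2 unfolding assm_A2_def by blast
  obtain L where L: "0 < L" "\<And>\<theta>. \<theta> \<in> cball \<theta>c R \<Longrightarrow> h \<theta> \<le> 0 \<Longrightarrow> L < norm (grad h \<theta>)"
    using grad_h_bounded_below_on_ball[OF A2 \<open>0 \<le> R\<close>, of \<theta>c] by blast
  obtain BJ where BJ: "0 < BJ" "\<And>\<theta>. \<theta> \<in> cball \<theta>c R \<Longrightarrow> norm (grad J \<theta>) \<le> BJ"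
    using C1_bounds_on_ball[OF C1J, of \<theta>c R] by metis
  obtain Bh where Bh: "0 < Bh" "\<And>\<theta>. \<theta> \<in> cball \<theta>c R \<Longrightarrow> norm (grad h \<theta>) \<le> Bh"
    using C1_bounds_on_ball[OF C1, of \<theta>c R] by metis
  define e where "e = c * d / 2"
  have e: "0 < e" using assms by (simp add: e_def)
  \<comment> \<open>the first summand serves \<open>barrier_rate\<close>, the second one makes the cap inactive where \<open>h \<le> 0\<close>\<close>
  define Mp0 where "Mp0 = BJ\<^sup>2 / e\<^sup>2 + 1 / L\<^sup>2"
  define \<epsilon>0 where "\<epsilon>0 = e / Bh"
  have Mp0: "0 < Mp0" unfolding Mp0_def using L e BJ by (intro add_pos_pos divide_pos_pos) auto
  show thesis
  proof (rule that[OF Mp0])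
    show "0 < \<epsilon>0" unfolding \<epsilon>0_def using e Bh by simp
    fix Mp \<kappa> t0 t1 :: real and y :: "real \<Rightarrow> real^'n"
    assume Mp: "Mp0 \<le> Mp" and \<kappa>: "0 < \<kappa>" and le: "t0 \<le> t1"
      and "near_flow (nominal_field J h c Mp) \<kappa> \<epsilon>0 (cball \<theta>c R) t0 t1 y"
    then obtain y' where y: "\<And>t. t \<in> {t0..t1} \<Longrightarrow> (y has_vector_derivative y' t) (at t within {t0..t1})"
      and near: "\<And>t. t \<in> {t0..t1} \<Longrightarrow> norm (y' t - \<kappa> *\<^sub>R nominal_field J h c Mp (y t)) \<le> \<kappa> * \<epsilon>0"
      and ball: "\<And>t. t \<in> {t0..t1} \<Longrightarrow> y t \<in> cball \<theta>c R"
      unfolding near_flow_def by blast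
    have "0 < Mp" using Mp Mp0 by linarith
    have cap: "BJ\<^sup>2 \<le> Mp * e\<^sup>2"
    proof -
      have "BJ\<^sup>2 / e\<^sup>2 \<le> Mp" using Mp L unfolding Mp0_def by (smt (verit) divide_nonneg_nonneg zero_le_power2)
      then show ?thesis using e by (simp add: divide_le_eq)
    qed
    have regular: "1 \<le> Mp * (norm (grad h \<theta>))\<^sup>2" if "\<theta> \<in> cball \<theta>c R" "h \<theta> \<le> 0" for \<theta>
    proof -
      have "1 / L\<^sup>2 \<le> Mp" using Mp unfolding Mp0_def by (smt (verit) divide_nonneg_nonneg zero_le_power2)
      then have "1 \<le> Mp * L\<^sup>2" using L by (simp add: divide_le_eq)
      also have "\<dots> \<le> Mp * (norm (grad h \<theta>))\<^sup>2"
        using L(1) L(2)[OF that] \<open>0 < Mp\<close> by (intro mult_left_mono power_mono) auto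
      finally show ?thesis .
    qed
    have "h (y t0) * exp (- (c * \<kappa>) * (t1 - t0)) - d \<le> h (y t1)"
    proof (rule exp_decay_lower_bound[OF le, where m' = "\<lambda>t. grad h (y t) \<bullet> y' t"])
      fix t assume t: "t \<in> {t0..t1}"
      show "((\<lambda>t. h (y t)) has_real_derivative grad h (y t) \<bullet> y' t) (at t within {t0..t1})"
        by (rule has_real_derivative_along_curve[OF C1 y[OF t]])
      have "- c * h (y t) - e \<le> grad h (y t) \<bullet> nominal_field J h c Mp (y t)"
        unfolding nominal_field_def
        by (rule barrier_rate[OF \<open>0 < Mp\<close> \<open>0 < c\<close> _ BJ(2)[OF ball[OF t]] cap])
          (use e regular ball[OF t] in auto)
      from mult_left_mono[OF this less_imp_le[OF \<kappa>]]
      have "\<kappa> * (- c * h (y t) - e) \<le> \<kappa> * (grad h (y t) \<bullet> nominal_field J h c Mp (y t))" .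
      moreover have "Bh * (\<kappa> * \<epsilon>0) = \<kappa> * e" unfolding \<epsilon>0_def using Bh by simp
      ultimately have "\<kappa> * (- c * h (y t) - e) - \<kappa> * e \<le> grad h (y t) \<bullet> y' t"
        using inner_near_bounds[OF near[OF t] Bh(2)[OF ball[OF t]]] by linarith
      then show "- (c * \<kappa>) * (h (y t) + d) \<le> grad h (y t) \<bullet> y' t"
        unfolding e_def by (simp add: algebra_simps)
    qed (use \<open>0 < d\<close> in auto)
    then show "h (y t0) * exp (- c * \<kappa> * (t1 - t0)) - d \<le> h (y t1)" by (simp add: mult.assoc)
  qed
qed

text \<open>A nonpositive minimum value would be attained where the gradient of \<open>h\<close> vanishes.\<close>

lemma unsafe_value_not_minimal:
  assumes A2: "assm_A2 h" and "h \<theta> \<le> 0"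
  shows "\<exists>\<theta>'. h \<theta>' < h \<theta>"
proof (rule ccontr)
  assume "\<not> (\<exists>\<theta>'. h \<theta>' < h \<theta>)"
  then have min: "h \<theta> \<le> h \<theta>'" for \<theta>' by (simp add: not_less)
  have C1: "C1_loc_lipschitz_grad h" using A2 unfolding assm_A2_def by blast
  have "(\<lambda>v. grad h \<theta> \<bullet> v) = (\<lambda>v. 0)"
    by (rule differential_zero_maxmin[of \<theta> UNIV h]) (use has_derivative_grad[OF C1] min in auto)
  then have "grad h \<theta> = 0" by (metis inner_eq_zero_iff)
  moreover have "h \<theta> \<in> range h \<inter> {..0}" using \<open>h \<theta> \<le> 0\<close> by auto
  then obtain L where "L > 0" "\<And>\<theta>'. \<theta>' \<in> unsafe_set h \<inter> super_set h (h \<theta>) \<Longrightarrow> L < norm (grad h \<theta>')"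
    using A2 unfolding assm_A2_def by blast
  ultimately show False using \<open>h \<theta> \<le> 0\<close> unfolding unsafe_set_def super_set_def by force
qed

text \<open>
  A superlevel set that contains the ball with a margin: this is the room for the undershoot of \<open>h\<close>
  that is caused by disturbances.
\<close>

lemma lower_level_than_ball:
  assumes A2: "assm_A2 h" and "h \<theta>0 \<le> 0" and "0 \<le> r"
  obtains \<rho> where "\<rho> \<in> range h" "\<rho> < 0" "\<And>\<theta>. \<theta> \<in> cball \<theta>c r \<Longrightarrow> \<rho> < h \<theta>"
proof -
  have C1: "C1_loc_lipschitz_grad h" using A2 unfolding assm_A2_def by blast
  have "cball \<theta>c r \<noteq> {}" using \<open>0 \<le> r\<close> by simp
  then obtain \<theta>m where "\<theta>m \<in> cball \<theta>c r" and min: "\<And>\<theta>. \<theta> \<in> cball \<theta>c r \<Longrightarrow> h \<theta>m \<le> h \<theta>"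
    using continuous_attains_inf[of "cball \<theta>c r" h] C1_continuous_on[OF C1] by auto
  define \<theta>1 where "\<theta>1 = (if h \<theta>m \<le> 0 then \<theta>m else \<theta>0)"
  have "h \<theta>1 \<le> 0" "h \<theta>1 \<le> h \<theta>m" using \<open>h \<theta>0 \<le> 0\<close> by (auto simp: \<theta>1_def)
  moreover obtain \<theta>' where "h \<theta>' < h \<theta>1"
    using unsafe_value_not_minimal[OF A2 \<open>h \<theta>1 \<le> 0\<close>] by blast
  ultimately show thesis using that[of "h \<theta>'"] min by force
qed

subsection \<open>Confinement to a ball\<close>

text \<open>
  Confinement to the ball of radius \<open>R - 1\<close>, given the larger ball of radius \<open>R\<close>, is what
  \<open>trapped_by_gap\<close> requires. The lower bound on \<open>h\<close> with tolerance \<open>d\<close> is assumed here, since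
  \<open>barrier_along_near_flow\<close> provides it under the same hypothesis once \<open>R\<close> is known. The predicate
  \<open>allowed\<close> restricts the scaled duration of the flow.
\<close>

definition confines ::
  "(real^'n \<Rightarrow> real) \<Rightarrow> (real^'n \<Rightarrow> real) \<Rightarrow> real^'n \<Rightarrow> real \<Rightarrow> real \<Rightarrow> (real \<Rightarrow> bool) \<Rightarrow> real \<Rightarrow> real \<Rightarrow> real \<Rightarrow> bool" where
  "confines J h \<theta>c c r allowed R d Mp0 \<longleftrightarrow>
     (\<forall>Mp\<ge>Mp0. \<exists>\<epsilon>>0. \<forall>\<kappa>>0. \<forall>t0 t1 y.
        t0 \<le> t1 \<and> near_flow (nominal_field J h c Mp) \<kappa> \<epsilon> (cball \<theta>c R) t0 t1 y \<and>
        y t0 \<in> cball \<theta>c r \<and> allowed (\<kappa> * (t1 - t0)) \<and>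
        (\<forall>t\<in>{t0..t1}. h (y t0) * exp (- c * \<kappa> * (t - t0)) - d \<le> h (y t)) \<longrightarrow>
        y t1 \<in> cball \<theta>c (R - 1))"

lemma decayed_ge_min:
  fixes q :: real
  assumes "0 \<le> s"
  shows "min q 0 \<le> q * exp (- s)"
proof (cases "0 \<le> q")
  case False
  have "q * 1 \<le> q * exp (- s)" using False assms by (intro mult_left_mono_neg) auto
  then show ?thesis by (simp add: min_def)
qed simp

text \<open>
  The lower bound on \<open>h\<close> keeps the flow in one compact superlevel set.
\<close>

lemma confines_if_compact_superlevels:
  fixes h J :: "real^'n \<Rightarrow> real"
  assumes A2: "assm_A2 h" and A6: "assm_A6 h" and "h \<theta>0 \<le> 0" and "0 \<le> r" "0 < c"
  obtains R d Mp0 where "r + 1 \<le> R" "0 < d" "0 < Mp0" "confines J h \<theta>c c r allowed R d Mp0"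
proof -
  obtain \<rho> where \<rho>: "\<rho> \<in> range h" "\<rho> < 0" "\<And>\<theta>. \<theta> \<in> cball \<theta>c r \<Longrightarrow> \<rho> < h \<theta>"
    using lower_level_than_ball[OF A2 \<open>h \<theta>0 \<le> 0\<close> \<open>0 \<le> r\<close>] by metis
  have C1: "C1_loc_lipschitz_grad h" using A2 unfolding assm_A2_def by blast
  have "cball \<theta>c r \<noteq> {}" using \<open>0 \<le> r\<close> by simp
  then obtain \<theta>m where \<theta>m: "\<theta>m \<in> cball \<theta>c r" and min: "\<And>\<theta>. \<theta> \<in> cball \<theta>c r \<Longrightarrow> h \<theta>m \<le> h \<theta>"
    using continuous_attains_inf[of "cball \<theta>c r" h] C1_continuous_on[OF C1] by auto
  define d where "d = min (h \<theta>m) 0 - \<rho>"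
  have "0 < d" using \<rho>(2) \<rho>(3)[OF \<theta>m] by (simp add: d_def)
  have "bounded (super_set h \<rho>)"
    using A6 \<rho> unfolding assm_A6_def by (intro compact_imp_bounded) auto
  then obtain R0 where R0: "super_set h \<rho> \<subseteq> cball \<theta>c R0"
    using bounded_any_center[of "super_set h \<rho>" \<theta>c] by (auto simp: subset_iff)
  define R where "R = max R0 r + 1"
  have conf: "confines J h \<theta>c c r allowed R d 1"
    unfolding confines_def
  proof (intro allI impI exI[of _ 1] conjI)
    fix Mp \<kappa> t0 t1 :: real and y :: "real \<Rightarrow> real^'n"
    assume "0 < \<kappa>" and H: "t0 \<le> t1 \<and> near_flow (nominal_field J h c Mp) \<kappa> 1 (cball \<theta>c R) t0 t1 y \<and>
        y t0 \<in> cball \<theta>c r \<and> allowed (\<kappa> * (t1 - t0)) \<and>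
        (\<forall>t\<in>{t0..t1}. h (y t0) * exp (- c * \<kappa> * (t - t0)) - d \<le> h (y t))"
    have "h (y t0) * exp (- (c * \<kappa> * (t1 - t0))) - d \<le> h (y t1)" using H by auto
    moreover have "min (h (y t0)) 0 \<le> h (y t0) * exp (- (c * \<kappa> * (t1 - t0)))"
      by (rule decayed_ge_min) (use H \<open>0 < \<kappa>\<close> \<open>0 < c\<close> in auto)
    moreover have "h \<theta>m \<le> h (y t0)" using min H by blast
    ultimately have "\<rho> \<le> h (y t1)" unfolding d_def by linarith
    then have "y t1 \<in> cball \<theta>c R0" using R0 unfolding super_set_def by blast
    then show "y t1 \<in> cball \<theta>c (R - 1)" by (simp add: R_def)
  qed simp
  show thesis by (rule that[OF _ \<open>0 < d\<close> _ conf]) (auto simp: R_def)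
qed

text \<open>
  If every point is safe, then \<open>J\<close> pays for the distance travelled: \<open>norm N \<le> 1 + (norm N)\<^sup>2\<close>, and
  \<open>(norm N)\<^sup>2\<close> is at most the rate at which \<open>J\<close> decreases, while \<open>J\<close> is bounded below.
\<close>

lemma confines_if_always_safe:
  fixes h J :: "real^'n \<Rightarrow> real"
  assumes A1: "assm_A1 J h \<theta>c" and safe: "\<And>\<theta>. 0 < h \<theta>" and "0 \<le> r" "0 < c" "0 < H"
  obtains R d Mp0 where "r + 1 \<le> R" "0 < d" "0 < Mp0"
    "confines J h \<theta>c c r (\<lambda>s. s \<le> H) R d Mp0"
proof -
  have C1J: "C1_loc_lipschitz_grad J" using A1 unfolding assm_A1_def by blast
  have Jmin: "J \<theta>c \<le> J \<theta>" for \<theta>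
  proof -
    have "\<theta> \<in> safe_set h" using safe[of \<theta>] by (simp add: safe_set_def)
    then show ?thesis using A1 unfolding assm_A1_def by (cases "\<theta> = \<theta>c") auto
  qed
  obtain B0 where B0: "0 < B0" "\<And>\<theta>. \<theta> \<in> cball \<theta>c r \<Longrightarrow> \<bar>J \<theta>\<bar> \<le> B0"
    using C1_bounds_on_ball[OF C1J, of \<theta>c r] by metis
  have "J \<theta>c \<le> B0" using B0(2)[of \<theta>c] \<open>0 \<le> r\<close> by simp
  define R where "R = r + (2 * H + B0 - J \<theta>c) + 1"
  obtain B where B: "0 < B" "\<And>\<theta>. \<theta> \<in> cball \<theta>c R \<Longrightarrow> norm (grad J \<theta>) \<le> B"
    using C1_bounds_on_ball[OF C1J, of \<theta>c R] by metis
  define \<epsilon> where "\<epsilon> = 1 / (1 + B)"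
  have "0 < 1 + B" using B by simp
  then have \<epsilon>: "0 < \<epsilon>" "(1 + B) * \<epsilon> = 1" by (auto simp: \<epsilon>_def)
  have conf: "confines J h \<theta>c c r (\<lambda>s. s \<le> H) R 1 1"
    unfolding confines_def
  proof (intro allI impI exI[of _ \<epsilon>] conjI)
    fix Mp \<kappa> t0 t1 :: real and y :: "real \<Rightarrow> real^'n"
    assume "1 \<le> Mp" "0 < \<kappa>" and *: "t0 \<le> t1 \<and> near_flow (nominal_field J h c Mp) \<kappa> \<epsilon> (cball \<theta>c R) t0 t1 y \<and>
        y t0 \<in> cball \<theta>c r \<and> \<kappa> * (t1 - t0) \<le> H \<and>
        (\<forall>t\<in>{t0..t1}. h (y t0) * exp (- c * \<kappa> * (t - t0)) - 1 \<le> h (y t))"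
    let ?N = "nominal_field J h c Mp"
    obtain y' where y: "\<And>t. t \<in> {t0..t1} \<Longrightarrow> (y has_vector_derivative y' t) (at t within {t0..t1})"
      and near: "\<And>t. t \<in> {t0..t1} \<Longrightarrow> norm (y' t - \<kappa> *\<^sub>R ?N (y t)) \<le> \<kappa> * \<epsilon>"
      and ball: "\<And>t. t \<in> {t0..t1} \<Longrightarrow> y t \<in> cball \<theta>c R"
      using * unfolding near_flow_def by blast
    define \<phi> where "\<phi> = (\<lambda>t. 2 * \<kappa> * t - J (y t))"
    have "norm (y t1 - y t0) \<le> \<phi> t1 - \<phi> t0"
    proof (rule norm_diff_le_if_deriv_bound[where f' = y' and \<phi>' = "\<lambda>t. 2 * \<kappa> - grad J (y t) \<bullet> y' t"])
      fix t assume t: "t \<in> {t0..t1}"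
      show "(\<phi> has_real_derivative 2 * \<kappa> - grad J (y t) \<bullet> y' t) (at t within {t0..t1})"
        unfolding \<phi>_def
        by (auto intro!: derivative_eq_intros has_real_derivative_along_curve[OF C1J y[OF t]])
      \<comment> \<open>expanding \<open>(n - 1)\<^sup>2 \<ge> 0\<close>\<close>
      have "norm (?N (y t)) \<le> 1 + (norm (?N (y t)))\<^sup>2"
        using zero_le_power2[of "norm (?N (y t)) - 1"] norm_ge_zero[of "?N (y t)"]
        unfolding power2_diff one_power2 mult_1_right by linarith
      also have "\<dots> \<le> 1 - grad J (y t) \<bullet> ?N (y t)"
        using norm_safe_dir_sq_le_descent[of Mp c "h (y t)" "grad J (y t)" "grad h (y t)"]
          \<open>1 \<le> Mp\<close> \<open>0 < c\<close> safe[of "y t"] by (simp add: nominal_field_def)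
      finally have "\<kappa> * norm (?N (y t)) \<le> \<kappa> * (1 - grad J (y t) \<bullet> ?N (y t))"
        using \<open>0 < \<kappa>\<close> by (intro mult_left_mono) auto
      then have "\<kappa> * norm (?N (y t)) \<le> \<kappa> - \<kappa> * (grad J (y t) \<bullet> ?N (y t))"
        by (simp add: right_diff_distrib)
      moreover have "norm (y' t) \<le> \<kappa> * norm (?N (y t)) + \<kappa> * \<epsilon>"
        using near[OF t] norm_triangle_sub[of "y' t" "\<kappa> *\<^sub>R ?N (y t)"] \<open>0 < \<kappa>\<close> by simp
      moreover have "\<bar>grad J (y t) \<bullet> y' t - \<kappa> * (grad J (y t) \<bullet> ?N (y t))\<bar> \<le> B * (\<kappa> * \<epsilon>)"
        by (rule inner_near_bounds[OF near[OF t] B(2)[OF ball[OF t]]])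
      moreover have "\<kappa> * \<epsilon> + B * (\<kappa> * \<epsilon>) = \<kappa>"
        using arg_cong[OF \<epsilon>(2), of "\<lambda>x. \<kappa> * x"] by (simp add: algebra_simps)
      ultimately show "norm (y' t) \<le> 2 * \<kappa> - grad J (y t) \<bullet> y' t" by linarith
    qed (use * y in auto)
    also have "\<dots> = 2 * (\<kappa> * (t1 - t0)) + J (y t0) - J (y t1)" by (simp add: \<phi>_def algebra_simps)
    also have "\<dots> \<le> 2 * H + B0 - J \<theta>c"
      using * B0(2)[of "y t0"] Jmin[of "y t1"] by linarith
    finally have "dist (y t0) (y t1) \<le> R - 1 - r" by (simp add: dist_norm norm_minus_commute R_def)
    moreover have "dist \<theta>c (y t0) \<le> r" using * by simp
    ultimately show "y t1 \<in> cball \<theta>c (R - 1)"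
      using dist_triangle[of \<theta>c "y t1" "y t0"] by simp
  qed (use \<epsilon> in simp)
  show thesis by (rule that[OF _ _ _ conf]) (use \<open>J \<theta>c \<le> B0\<close> \<open>0 < H\<close> in \<open>auto simp: R_def\<close>)
qed

text \<open>
  Without the quotient, the bound includes points where a gradient vanishes. At points with \<open>h \<theta> = 0\<close> it
  is available as soon as \<open>h\<close> takes a negative value.
\<close>

lemma A4_angle:
  assumes "assm_A4 J h \<theta>c"
  obtains r f where "0 < r" "0 \<le> f" "f < 1"
    and "\<And>\<theta>. h \<theta> < 0 \<or> h \<theta> = 0 \<and> (\<exists>\<theta>'. h \<theta>' < 0) \<Longrightarrow> r \<le> norm (\<theta> - \<theta>c) \<Longrightarrow>
           grad J \<theta> \<bullet> grad h \<theta> \<le> f * (norm (grad J \<theta>) * norm (grad h \<theta>))"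
proof -
  obtain r f where r: "0 < r" and f: "f \<in> {0..<1}"
    and *: "\<And>\<rho> \<theta>. \<rho> \<in> range h \<inter> {..<0} \<Longrightarrow> \<theta> \<in> {\<theta>. \<rho> \<le> h \<theta> \<and> h \<theta> \<le> 0} \<inter> {\<theta>. r \<le> norm (\<theta> - \<theta>c)} \<Longrightarrow>
      (grad J \<theta> \<bullet> grad h \<theta>) / (norm (grad J \<theta>) * norm (grad h \<theta>)) \<le> f"
    using assms unfolding assm_A4_def by blast
  show thesis
  proof (rule that[of r f])
    fix \<theta> assume neg: "h \<theta> < 0 \<or> h \<theta> = 0 \<and> (\<exists>\<theta>'. h \<theta>' < 0)" and far: "r \<le> norm (\<theta> - \<theta>c)"
    then obtain \<theta>' where "h \<theta>' < 0" "h \<theta>' \<le> h \<theta>" "h \<theta> \<le> 0"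
      by (metis less_imp_le order_refl)
    then have q: "(grad J \<theta> \<bullet> grad h \<theta>) / (norm (grad J \<theta>) * norm (grad h \<theta>)) \<le> f"
      using far by (intro *[of "h \<theta>'"]) auto
    show "grad J \<theta> \<bullet> grad h \<theta> \<le> f * (norm (grad J \<theta>) * norm (grad h \<theta>))"
    proof (cases "norm (grad J \<theta>) * norm (grad h \<theta>) = 0")
      case False
      then have "0 < norm (grad J \<theta>) * norm (grad h \<theta>)" by (simp add: zero_less_mult_iff)
      then show ?thesis using q by (simp add: divide_le_eq)
    qed auto
  qed (use r f in auto)
qed

lemma has_real_derivative_neg_part_sq:
  "((\<lambda>x::real. (min x 0)\<^sup>2) has_real_derivative 2 * min x 0) (at x)"
proof -
  consider "x < 0" | "x = 0" | "0 < x" by linarith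
  then show ?thesis
  proof cases
    case 1
    have "((\<lambda>x. x\<^sup>2) has_real_derivative 2 * min x 0) (at x)"
      using 1 by (auto intro!: derivative_eq_intros)
    then show ?thesis
      by (rule has_field_derivative_transform_within_open[of _ _ _ "{..<0}"]) (use 1 in auto)
  next
    case 2
    have "((\<lambda>h. (min h 0)\<^sup>2 / h) \<longlongrightarrow> 0) (at (0::real))"
    proof (rule Lim_null_comparison[where g = "\<lambda>h. \<bar>h\<bar>"])
      show "\<forall>\<^sub>F h in at (0::real). norm ((min h 0)\<^sup>2 / h) \<le> \<bar>h\<bar>"
        by (intro always_eventually allI) (simp add: min_def power2_eq_square)
    qed (auto intro!: tendsto_eq_intros)
    then show ?thesis using 2 by (simp add: DERIV_def)
  next
    case 3
    have "((\<lambda>x. 0) has_real_derivative 2 * min x 0) (at x)" using 3 by simp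
    then show ?thesis
      by (rule has_field_derivative_transform_within_open[of _ _ _ "{0<..}"]) (use 3 in auto)
  qed
qed

lemma nonneg_quadratic_bound:
  fixes u v w :: real
  assumes "0 < u"
  shows "- u * w\<^sup>2 + v * w \<le> v\<^sup>2 / (4 * u)"
proof -
  have "0 \<le> (2 * u * w - v)\<^sup>2 / (4 * u)" using assms by simp
  also have "\<dots> = u * w\<^sup>2 - v * w + v\<^sup>2 / (4 * u)"
    using assms by (simp add: power2_eq_square field_simps)
  finally show ?thesis by simp
qed

text \<open>
  This is the derivative of \<open>J + C * (min h 0)\<^sup>2\<close> along the nominal field. In the unsafe region \<open>J\<close> may
  grow, by completing the square at a rate of at most \<open>c * C * q\<^sup>2\<close>; the penalty decreases at twice
  this rate. Where \<open>q \<ge> 0\<close> it is \<open>J\<close> itself that decreases.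
\<close>

lemma lyapunov_descent:
  fixes g p :: "real^'n"
  assumes "0 < Mp" "0 < c" "0 < L" "0 \<le> f" "f < 1"
    and safe: "0 \<le> q \<Longrightarrow> g \<noteq> 0"
    and unsafe: "q \<le> 0 \<Longrightarrow> L \<le> norm p \<and> 1 \<le> Mp * (norm p)\<^sup>2 \<and> g \<bullet> p \<le> f * (norm g * norm p)"
    and C: "C = c / (4 * L\<^sup>2 * (1 - f\<^sup>2))"
  shows "(g + (2 * C * min q 0) *\<^sub>R p) \<bullet> safe_dir c Mp g p q < 0"
proof -
  have f2: "0 < 1 - f\<^sup>2" using assms by (simp add: power_less_one_iff abs_square_less_1)
  have "0 < C" unfolding C using assms f2 by simp
  consider "q < 0" | "q = 0" | "0 < q" by linarith
  then show ?thesis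
  proof cases
    case 1
    have "g \<bullet> safe_dir c Mp g p q \<le> - (1 - f\<^sup>2) * (norm g)\<^sup>2 + c * \<bar>q\<bar> / L * norm g"
      using 1 unsafe assms by (intro descent_if_unsafe) auto
    also have "\<dots> \<le> (c * \<bar>q\<bar> / L)\<^sup>2 / (4 * (1 - f\<^sup>2))" by (rule nonneg_quadratic_bound[OF f2])
    also have "\<dots> = c * C * q\<^sup>2" unfolding C by (simp add: power_mult_distrib power_divide power2_eq_square field_simps)
    finally have "g \<bullet> safe_dir c Mp g p q \<le> c * C * q\<^sup>2" .
    moreover have "- c * q \<le> p \<bullet> safe_dir c Mp g p q"
      using 1 unsafe assms(1) by (intro barrier_rate_if_regular) auto
    then have "2 * C * q * (p \<bullet> safe_dir c Mp g p q) \<le> 2 * C * q * (- c * q)"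
      using 1 \<open>0 < C\<close> by (intro mult_left_mono_neg) (auto simp: mult_nonneg_nonpos)
    moreover have "0 < c * C * q\<^sup>2" using 1 \<open>0 < C\<close> \<open>0 < c\<close> by simp
    ultimately show ?thesis using 1 by (simp add: inner_add_left power2_eq_square algebra_simps)
  next
    case 2
    have "g \<bullet> safe_dir c Mp g p q \<le> - (1 - f\<^sup>2) * (norm g)\<^sup>2 + c * \<bar>q\<bar> / L * norm g"
      using 2 unsafe assms by (intro descent_if_unsafe) auto
    moreover have "0 < (1 - f\<^sup>2) * (norm g)\<^sup>2" using f2 safe 2 by simp
    moreover have "c * \<bar>q\<bar> / L * norm g = 0" "min q 0 = 0" using 2 by auto
    ultimately show ?thesis unfolding \<open>min q 0 = 0\<close> mult_zero_right scaleR_zero_left add_0_right by linarith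
  next
    case 3
    then show ?thesis using descent_if_safe[of Mp c q g p] assms(1,2) safe by (simp add: min_absorb2)
  qed
qed

text \<open>
  After the last time at which \<open>u \<le> r\<close> the function \<open>W\<close> is nonincreasing.
\<close>

lemma last_exit_bound:
  fixes u W :: "real \<Rightarrow> real"
  assumes "t0 \<le> t1" and cu: "continuous_on {t0..t1} u" and cW: "continuous_on {t0..t1} W"
    and init: "u t0 \<le> r"
    and inside: "\<And>t. t \<in> {t0..t1} \<Longrightarrow> u t \<le> r \<Longrightarrow> W t \<le> b"
    and outside: "\<And>t. t \<in> {t0..t1} \<Longrightarrow> r < u t \<Longrightarrow> \<exists>D. (W has_real_derivative D) (at t within {t0..t1}) \<and> D \<le> 0"
  shows "W t1 \<le> b"
proof -
  define A where "A = {s \<in> {t0..t1}. u s \<le> r}"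
  have "closed A" unfolding A_def
    by (intro continuous_on_closed_Collect_le cu) auto
  moreover have "bounded A" unfolding A_def
    by (rule bounded_subset[OF bounded_closed_interval[of t0 t1]]) auto
  ultimately have "compact A" by (simp add: compact_eq_bounded_closed)
  moreover have "A \<noteq> {}" using init \<open>t0 \<le> t1\<close> unfolding A_def by auto
  ultimately obtain s where s: "s \<in> A" "\<And>t. t \<in> A \<Longrightarrow> t \<le> s"
    using compact_attains_sup[of A] by blast
  have s_in: "s \<in> {t0..t1}" "u s \<le> r" using s(1) by (auto simp: A_def)
  have "- W s \<le> - W t1"
  proof (rule DERIV_nonneg_imp_increasing_open[where f = "\<lambda>t. - W t"])
    show "s \<le> t1" using s_in by simp
    show "continuous_on {s..t1} (\<lambda>t. - W t)"
      using s_in by (intro continuous_on_minus continuous_on_subset[OF cW]) auto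
    fix t assume t: "s < t" "t < t1"
    then have "r < u t" using s(2)[of t] s_in unfolding A_def by force
    then obtain D where "(W has_real_derivative D) (at t within {t0..t1})" "D \<le> 0"
      using outside[of t] t s_in by auto
    moreover have "at t within {t0..t1} = at t" using t s_in by (intro at_within_Icc_at) auto
    ultimately show "\<exists>y. ((\<lambda>t. - W t) has_real_derivative y) (at t) \<and> 0 \<le> y"
      by (intro exI[of _ "- D"]) (auto intro: DERIV_minus)
  qed
  then show ?thesis using inside[OF s_in] by linarith
qed

lemma A5_bounds:
  assumes "assm_A5 J h \<theta>c"
  obtains R0 where "\<And>\<theta>. a \<le> h \<theta> \<Longrightarrow> J \<theta> \<le> b \<Longrightarrow> \<theta> \<in> cball \<theta>c R0"
proof -
  let ?V = "\<lambda>\<theta>. max (- h \<theta>) 0 + max (J \<theta> - J \<theta>c) 0"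
  have "filterlim ?V at_top (filtercomap (\<lambda>\<theta>. norm (\<theta> - \<theta>c)) at_top)"
    using assms unfolding assm_A5_def Let_def by blast
  then have "\<forall>\<^sub>F \<theta> in filtercomap (\<lambda>\<theta>. norm (\<theta> - \<theta>c)) at_top. \<bar>a\<bar> + \<bar>b - J \<theta>c\<bar> + 1 \<le> ?V \<theta>"
    unfolding filterlim_at_top by blast
  then obtain R0 where R0: "\<And>\<theta>. R0 \<le> norm (\<theta> - \<theta>c) \<Longrightarrow> \<bar>a\<bar> + \<bar>b - J \<theta>c\<bar> + 1 \<le> ?V \<theta>"
    unfolding eventually_filtercomap_at_top_linorder by blast
  show thesis
  proof (rule that[of R0])
    fix \<theta> assume "a \<le> h \<theta>" "J \<theta> \<le> b"
    then have "?V \<theta> < \<bar>a\<bar> + \<bar>b - J \<theta>c\<bar> + 1" by (simp add: max_def abs_if)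
    then have "norm (\<theta> - \<theta>c) < R0" using R0[of \<theta>] by linarith
    then show "\<theta> \<in> cball \<theta>c R0" by (simp add: dist_norm norm_minus_commute)
  qed
qed

text \<open>
  The level \<open>\<rho>\<close> delimits the region in which the lower bound on \<open>h\<close> keeps a flow that starts in the
  ball, and \<open>d\<close> is the error of that bound which this tolerates.
\<close>

lemma regular_level:
  assumes A2: "assm_A2 h" and "0 \<le> r"
  obtains \<rho> d L where "0 < d" "0 < L" "\<And>\<theta>. \<theta> \<in> cball \<theta>c r \<Longrightarrow> \<rho> + d \<le> min (h \<theta>) 0"
    "\<And>\<theta>. \<rho> \<le> h \<theta> \<Longrightarrow> h \<theta> \<le> 0 \<Longrightarrow> L < norm (grad h \<theta>)"
proof (cases "\<exists>\<theta>0. h \<theta>0 \<le> 0")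
  case True
  then obtain \<theta>0 where "h \<theta>0 \<le> 0" by blast
  have C1: "C1_loc_lipschitz_grad h" using A2 unfolding assm_A2_def by blast
  obtain \<rho> where \<rho>: "\<rho> \<in> range h" "\<rho> < 0" "\<And>\<theta>. \<theta> \<in> cball \<theta>c r \<Longrightarrow> \<rho> < h \<theta>"
    using lower_level_than_ball[OF A2 \<open>h \<theta>0 \<le> 0\<close> \<open>0 \<le> r\<close>] by metis
  have "cball \<theta>c r \<noteq> {}" using \<open>0 \<le> r\<close> by simp
  then obtain \<theta>m where \<theta>m: "\<theta>m \<in> cball \<theta>c r" and min: "\<And>\<theta>. \<theta> \<in> cball \<theta>c r \<Longrightarrow> h \<theta>m \<le> h \<theta>"
    using continuous_attains_inf[of "cball \<theta>c r" h] C1_continuous_on[OF C1] by auto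
  have "\<rho> \<in> range h \<inter> {..0}" using \<rho>(1,2) by auto
  then obtain L where L: "0 < L" "\<And>\<theta>. \<theta> \<in> unsafe_set h \<inter> super_set h \<rho> \<Longrightarrow> L < norm (grad h \<theta>)"
    using A2 unfolding assm_A2_def by blast
  show thesis
  proof (rule that[of "min (h \<theta>m) 0 - \<rho>" L \<rho>])
    show "0 < min (h \<theta>m) 0 - \<rho>" using \<rho>(2) \<rho>(3)[OF \<theta>m] by simp
    show "\<rho> + (min (h \<theta>m) 0 - \<rho>) \<le> min (h \<theta>) 0" if "\<theta> \<in> cball \<theta>c r" for \<theta>
      using min[OF that] by simp
    show "L < norm (grad h \<theta>)" if "\<rho> \<le> h \<theta>" "h \<theta> \<le> 0" for \<theta>
      using L(2)[of \<theta>] that by (simp add: unsafe_set_def super_set_def)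
  qed (rule L(1))
next
  case False
  then have pos: "0 < h \<theta>" for \<theta> by (simp add: not_le)
  show thesis
  proof (rule that[of 1 1 "-1"])
    show "- 1 + 1 \<le> min (h \<theta>) 0" for \<theta> using pos[of \<theta>] by simp
    show "1 < norm (grad h \<theta>)" if "h \<theta> \<le> 0" for \<theta> using pos[of \<theta>] that by linarith
  qed simp_all
qed

text \<open>
  The lower bound on \<open>h\<close> and an upper bound on \<open>W = J + C * (min h 0)\<^sup>2\<close> bound \<open>J\<close>, hence by coercivity the
  distance from \<open>\<theta>c\<close>. Outside the ball of radius \<open>r0\<close>, \<open>W\<close> decreases strictly along the nominal
  field; on the compact part of this region that matters it does so with a margin \<open>e\<close>, which leaves
  room for the disturbance.
\<close>

lemma confines_if_coercive:
  fixes h J :: "real^'n \<Rightarrow> real"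
  assumes A1: "assm_A1 J h \<theta>c" and A2: "assm_A2 h" and A4: "assm_A4 J h \<theta>c" and A5: "assm_A5 J h \<theta>c"
    and "0 \<le> r" "0 < c"
  obtains R d Mp0 where "r + 1 \<le> R" "0 < d" "0 < Mp0" "confines J h \<theta>c c r allowed R d Mp0"
proof -
  have C1J: "C1_loc_lipschitz_grad J" using A1 unfolding assm_A1_def by blast
  have C1h: "C1_loc_lipschitz_grad h" using A2 unfolding assm_A2_def by blast
  obtain rs f where "0 < rs" and f: "0 \<le> f" "f < 1"
    and angle: "\<And>\<theta>. h \<theta> < 0 \<or> h \<theta> = 0 \<and> (\<exists>\<theta>'. h \<theta>' < 0) \<Longrightarrow> rs \<le> norm (\<theta> - \<theta>c) \<Longrightarrow>
      grad J \<theta> \<bullet> grad h \<theta> \<le> f * (norm (grad J \<theta>) * norm (grad h \<theta>))"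
    using A4_angle[OF A4] by metis
  obtain \<rho> d L where d: "0 < d" and L: "0 < L" and \<rho>: "\<And>\<theta>. \<theta> \<in> cball \<theta>c r \<Longrightarrow> \<rho> + d \<le> min (h \<theta>) 0"
    and Lh: "\<And>\<theta>. \<rho> \<le> h \<theta> \<Longrightarrow> h \<theta> \<le> 0 \<Longrightarrow> L < norm (grad h \<theta>)"
    using regular_level[OF A2 \<open>0 \<le> r\<close>] by metis
  define C where "C = c / (4 * L\<^sup>2 * (1 - f\<^sup>2))"
  have "0 < 1 - f\<^sup>2" using f by (simp add: power_less_one_iff abs_square_less_1)
  then have "0 < C" unfolding C_def using \<open>0 < c\<close> L by simp
  define W where "W = (\<lambda>\<theta>. J \<theta> + C * (min (h \<theta>) 0)\<^sup>2)"
  define G where "G = (\<lambda>\<theta>. grad J \<theta> + (2 * C * min (h \<theta>) 0) *\<^sub>R grad h \<theta>)"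
  have contW: "continuous_on A W" for A
    unfolding W_def by (intro continuous_intros C1_continuous_on C1J C1h)
  have contG: "continuous_on A G" for A
    unfolding G_def by (intro continuous_intros C1_continuous_on continuous_on_grad C1J C1h)
  define r0 where "r0 = max rs r"
  have "compact (W ` cball \<theta>c r0)" by (intro compact_continuous_image contW) simp
  then obtain b where b: "\<And>\<theta>. \<theta> \<in> cball \<theta>c r0 \<Longrightarrow> W \<theta> \<le> b"
    using compact_imp_bounded[of "W ` cball \<theta>c r0"] unfolding bounded_iff ball_simps real_norm_def
    by (meson abs_le_D1)
  obtain R0 where R0: "\<And>\<theta>. \<rho> \<le> h \<theta> \<Longrightarrow> J \<theta> \<le> b \<Longrightarrow> \<theta> \<in> cball \<theta>c R0"
    using A5_bounds[OF A5, of \<rho> b] by metis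
  define R where "R = max R0 r + 1"
  define S where "S = {\<theta> \<in> cball \<theta>c R. \<rho> \<le> h \<theta> \<and> r0 \<le> dist \<theta>c \<theta>}"
  have "compact S"
  proof -
    have "S = cball \<theta>c R \<inter> {\<theta>. \<rho> \<le> h \<theta>} \<inter> {\<theta>. r0 \<le> dist \<theta>c \<theta>}" unfolding S_def by auto
    moreover have "closed {\<theta>. \<rho> \<le> h \<theta>}" "closed {\<theta>. r0 \<le> dist \<theta>c \<theta>}"
      by (intro closed_Collect_le continuous_intros C1_continuous_on[OF C1h])+
    ultimately show ?thesis by (auto intro!: compact_Int_closed)
  qed
  have "compact (G ` cball \<theta>c R)" by (intro compact_continuous_image contG) simp
  then obtain B0 where "\<And>\<theta>. \<theta> \<in> cball \<theta>c R \<Longrightarrow> norm (G \<theta>) \<le> B0"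
    using compact_imp_bounded[of "G ` cball \<theta>c R"] unfolding bounded_iff by blast
  then have B: "0 < max B0 1" "\<And>\<theta>. \<theta> \<in> cball \<theta>c R \<Longrightarrow> norm (G \<theta>) \<le> max B0 1"
    by (auto simp: le_max_iff_disj)
  define B where "B = max B0 1"
  note B = B[folded B_def]
  have descent: "\<exists>e>0. \<forall>\<theta>\<in>S. G \<theta> \<bullet> nominal_field J h c Mp \<theta> \<le> - e" if Mp: "1 / L\<^sup>2 \<le> Mp" for Mp
  proof -
    have "0 < Mp" using Mp L by (smt (verit) divide_pos_pos zero_less_power)
    have "1 \<le> Mp * L\<^sup>2" using Mp L by (simp add: divide_le_eq)
    have neg: "G \<theta> \<bullet> nominal_field J h c Mp \<theta> < 0" if "\<theta> \<in> S" for \<theta>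
      unfolding G_def nominal_field_def
    proof (rule lyapunov_descent[OF \<open>0 < Mp\<close> \<open>0 < c\<close> L f _ _ C_def])
      have far: "r0 \<le> norm (\<theta> - \<theta>c)" "\<rho> \<le> h \<theta>" using that by (auto simp: S_def dist_norm norm_minus_commute)
      then have ne: "\<theta> \<noteq> \<theta>c" using \<open>0 < rs\<close> by (auto simp: r0_def)
      show "grad J \<theta> \<noteq> 0" if "0 \<le> h \<theta>"
        using A1 that ne unfolding assm_A1_def safe_set_def by blast
      assume "h \<theta> \<le> 0"
      then have "L < norm (grad h \<theta>)" using Lh far by blast
      moreover have "Mp * L\<^sup>2 \<le> Mp * (norm (grad h \<theta>))\<^sup>2"
        using calculation L \<open>0 < Mp\<close> by (intro mult_left_mono power_mono) auto
      moreover have "h \<theta> < 0 \<or> h \<theta> = 0 \<and> (\<exists>\<theta>'. h \<theta>' < 0)"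
        using unsafe_value_not_minimal[OF A2 \<open>h \<theta> \<le> 0\<close>] \<open>h \<theta> \<le> 0\<close> by (cases "h \<theta> = 0") auto
      ultimately show "L \<le> norm (grad h \<theta>) \<and> 1 \<le> Mp * (norm (grad h \<theta>))\<^sup>2 \<and>
          grad J \<theta> \<bullet> grad h \<theta> \<le> f * (norm (grad J \<theta>) * norm (grad h \<theta>))"
        using angle[of \<theta>] far(1) \<open>1 \<le> Mp * L\<^sup>2\<close> by (auto simp: r0_def)
    qed
    show ?thesis
    proof (cases "S = {}")
      case False
      have "continuous_on S (\<lambda>\<theta>. G \<theta> \<bullet> nominal_field J h c Mp \<theta>)"
        unfolding nominal_field_def
        by (intro continuous_on_inner contG continuous_on_safe_dir \<open>0 < Mp\<close> continuous_on_grad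
            C1_continuous_on C1J C1h)
      then obtain \<theta>m where "\<theta>m \<in> S" "\<And>\<theta>. \<theta> \<in> S \<Longrightarrow> G \<theta> \<bullet> nominal_field J h c Mp \<theta> \<le> G \<theta>m \<bullet> nominal_field J h c Mp \<theta>m"
        using continuous_attains_sup[OF \<open>compact S\<close> False] by blast
      then show ?thesis using neg[of \<theta>m] by (intro exI[of _ "- (G \<theta>m \<bullet> nominal_field J h c Mp \<theta>m)"]) auto
    qed (auto intro: exI[of _ 1])
  qed
  have conf: "confines J h \<theta>c c r allowed R d (1 / L\<^sup>2)"
    unfolding confines_def
  proof (intro allI impI)
    fix Mp assume "1 / L\<^sup>2 \<le> Mp"
    then obtain e where e: "0 < e" "\<And>\<theta>. \<theta> \<in> S \<Longrightarrow> G \<theta> \<bullet> nominal_field J h c Mp \<theta> \<le> - e"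
      using descent by blast
    let ?N = "nominal_field J h c Mp"
    show "\<exists>\<epsilon>>0. \<forall>\<kappa>>0. \<forall>t0 t1 y.
        t0 \<le> t1 \<and> near_flow ?N \<kappa> \<epsilon> (cball \<theta>c R) t0 t1 y \<and>
        y t0 \<in> cball \<theta>c r \<and> allowed (\<kappa> * (t1 - t0)) \<and>
        (\<forall>t\<in>{t0..t1}. h (y t0) * exp (- c * \<kappa> * (t - t0)) - d \<le> h (y t)) \<longrightarrow>
        y t1 \<in> cball \<theta>c (R - 1)"
    proof (intro exI[of _ "e / B"] conjI allI impI)
      fix \<kappa> t0 t1 :: real and y :: "real \<Rightarrow> real^'n"
      assume \<kappa>: "0 < \<kappa>" and *: "t0 \<le> t1 \<and> near_flow ?N \<kappa> (e / B) (cball \<theta>c R) t0 t1 y \<and>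
        y t0 \<in> cball \<theta>c r \<and> allowed (\<kappa> * (t1 - t0)) \<and>
        (\<forall>t\<in>{t0..t1}. h (y t0) * exp (- c * \<kappa> * (t - t0)) - d \<le> h (y t))"
      then obtain y' where y: "\<And>t. t \<in> {t0..t1} \<Longrightarrow> (y has_vector_derivative y' t) (at t within {t0..t1})"
        and near: "\<And>t. t \<in> {t0..t1} \<Longrightarrow> norm (y' t - \<kappa> *\<^sub>R ?N (y t)) \<le> \<kappa> * (e / B)"
        and ball: "\<And>t. t \<in> {t0..t1} \<Longrightarrow> y t \<in> cball \<theta>c R"
        unfolding near_flow_def by blast
      have cy: "continuous_on {t0..t1} y" by (rule continuous_on_vector_derivative[OF y])
      have level: "\<rho> \<le> h (y t)" if "t \<in> {t0..t1}" for t
      proof -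
        have "min (h (y t0)) 0 \<le> h (y t0) * exp (- (c * \<kappa> * (t - t0)))"
          by (rule decayed_ge_min) (use that \<kappa> \<open>0 < c\<close> in auto)
        moreover have "h (y t0) * exp (- (c * \<kappa> * (t - t0))) - d \<le> h (y t)" using * that by auto
        ultimately show ?thesis using \<rho>[of "y t0"] * by linarith
      qed
      have "W (y t1) \<le> b"
      proof (rule last_exit_bound[where W = "\<lambda>t. W (y t)" and u = "\<lambda>t. dist \<theta>c (y t)" and r = r0])
        show "continuous_on {t0..t1} (\<lambda>t. dist \<theta>c (y t))" by (intro continuous_intros cy)
        show "continuous_on {t0..t1} (\<lambda>t. W (y t))"
          by (rule continuous_on_compose2[OF contW cy]) auto
        show "dist \<theta>c (y t0) \<le> r0" using * by (simp add: r0_def le_max_iff_disj)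
        show "W (y t) \<le> b" if "dist \<theta>c (y t) \<le> r0" for t using b that by simp
        fix t assume t: "t \<in> {t0..t1}" and "r0 < dist \<theta>c (y t)"
        then have "y t \<in> S" using ball level unfolding S_def by auto
        have "((\<lambda>t. W (y t)) has_real_derivative G (y t) \<bullet> y' t) (at t within {t0..t1})"
        proof -
          have "((\<lambda>t. (min (h (y t)) 0)\<^sup>2) has_real_derivative 2 * min (h (y t)) 0 * (grad h (y t) \<bullet> y' t)) (at t within {t0..t1})"
            by (rule DERIV_chain2[OF has_real_derivative_neg_part_sq
                  has_real_derivative_along_curve[OF C1h y[OF t]]])
          then have "((\<lambda>t. W (y t)) has_real_derivative
              grad J (y t) \<bullet> y' t + C * (2 * min (h (y t)) 0 * (grad h (y t) \<bullet> y' t))) (at t within {t0..t1})"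
            unfolding W_def
            by (intro DERIV_add DERIV_cmult has_real_derivative_along_curve[OF C1J y[OF t]])
          then show ?thesis unfolding G_def by (simp add: inner_add_left mult.assoc mult.left_commute)
        qed
        moreover have "G (y t) \<bullet> y' t \<le> 0"
        proof -
          have "\<kappa> * (G (y t) \<bullet> ?N (y t)) \<le> \<kappa> * (- e)"
            using e(2)[OF \<open>y t \<in> S\<close>] \<kappa> by (intro mult_left_mono) auto
          moreover have "\<bar>G (y t) \<bullet> y' t - \<kappa> * (G (y t) \<bullet> ?N (y t))\<bar> \<le> B * (\<kappa> * (e / B))"
            by (rule inner_near_bounds[OF near[OF t] B(2)[OF ball[OF t]]])
          moreover have "B * (\<kappa> * (e / B)) = \<kappa> * e" using B by simp
          ultimately show ?thesis by simp
        qed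
        ultimately show "\<exists>D. ((\<lambda>t. W (y t)) has_real_derivative D) (at t within {t0..t1}) \<and> D \<le> 0" by blast
      qed (use * in auto)
      then have "J (y t1) \<le> b"
        unfolding W_def using \<open>0 < C\<close> by (smt (verit) mult_nonneg_nonneg zero_le_power2)
      then have "y t1 \<in> cball \<theta>c R0" using R0 level[of t1] * by auto
      then show "y t1 \<in> cball \<theta>c (R - 1)" by (simp add: R_def)
    qed (use e B in simp)
  qed
  show thesis by (rule that[OF _ d _ conf]) (use L in \<open>auto simp: R_def\<close>)
qed

text \<open>
  If \<open>h\<close> has no value below or at zero, compactness of the superlevel sets is void, and in the absence of
  coercivity only flows of scaled duration at most \<open>H\<close> are confined.
\<close>

lemma nominal_flow_safe_and_confined:
  fixes h J :: "real^'n \<Rightarrow> real"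
  assumes A1: "assm_A1 J h \<theta>c" and A2: "assm_A2 h"
    and confinement: "(assm_A4 J h \<theta>c \<and> assm_A5 J h \<theta>c) \<or> assm_A6 h"
    and "0 \<le> r" "0 < c" "0 < H" "0 < \<delta>"
  obtains Mp R \<epsilon> where "0 < Mp" "r + 1 \<le> R" "0 < \<epsilon>"
    and "\<And>\<kappa> t0 t1 y. 0 < \<kappa> \<Longrightarrow> t0 \<le> t1 \<Longrightarrow>
      near_flow (nominal_field J h c Mp) \<kappa> \<epsilon> (cball \<theta>c R) t0 t1 y \<Longrightarrow> y t0 \<in> cball \<theta>c r \<Longrightarrow>
      (assm_A4 J h \<theta>c \<and> assm_A5 J h \<theta>c) \<or> (\<exists>\<theta>. h \<theta> \<le> 0) \<or> \<kappa> * (t1 - t0) \<le> H \<Longrightarrow>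
      y t1 \<in> cball \<theta>c (R - 1) \<and> h (y t0) * exp (- c * \<kappa> * (t1 - t0)) - \<delta> \<le> h (y t1)"
proof -
  let ?P = "(assm_A4 J h \<theta>c \<and> assm_A5 J h \<theta>c) \<or> (\<exists>\<theta>. h \<theta> \<le> 0)"
  have C1J: "C1_loc_lipschitz_grad J" using A1 unfolding assm_A1_def by blast
  obtain R d Mp1 where R: "r + 1 \<le> R" and "0 < d" "0 < Mp1"
    and conf: "confines J h \<theta>c c r (\<lambda>s. ?P \<or> s \<le> H) R d Mp1"
  proof (cases "assm_A4 J h \<theta>c \<and> assm_A5 J h \<theta>c")
    case True
    then show thesis
      using confines_if_coercive[OF A1 A2 _ _ \<open>0 \<le> r\<close> \<open>0 < c\<close>, where allowed = "\<lambda>s. ?P \<or> s \<le> H"] that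
      by metis
  next
    case False
    then have A6: "assm_A6 h" using confinement by blast
    show thesis
    proof (cases "\<exists>\<theta>. h \<theta> \<le> 0")
      case True
      then obtain \<theta>0 where "h \<theta>0 \<le> 0" by blast
      from confines_if_compact_superlevels[OF A2 A6 this \<open>0 \<le> r\<close> \<open>0 < c\<close>,
          where \<theta>c = \<theta>c and J = J and allowed = "\<lambda>s. ?P \<or> s \<le> H"]
      show thesis using that by metis
    next
      case safe: False
      then have eq: "(\<lambda>s. ?P \<or> s \<le> H) = (\<lambda>s. s \<le> H)" using \<open>\<not> (_ \<and> _)\<close> by auto
      have "0 < h \<theta>" for \<theta> using safe by (simp add: not_le)
      from confines_if_always_safe[OF A1 this \<open>0 \<le> r\<close> \<open>0 < c\<close> \<open>0 < H\<close>]
      show thesis using that unfolding eq by metis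
    qed
  qed
  have "0 < min d \<delta>" "0 \<le> R" using \<open>0 < d\<close> \<open>0 < \<delta>\<close> R \<open>0 \<le> r\<close> by auto
  then obtain Mp2 \<epsilon>2 where "0 < Mp2" "0 < \<epsilon>2"
    and barrier: "\<And>Mp \<kappa> t0 t1 y. Mp2 \<le> Mp \<Longrightarrow> 0 < \<kappa> \<Longrightarrow> t0 \<le> t1 \<Longrightarrow>
      near_flow (nominal_field J h c Mp) \<kappa> \<epsilon>2 (cball \<theta>c R) t0 t1 y \<Longrightarrow>
      h (y t0) * exp (- c * \<kappa> * (t1 - t0)) - min d \<delta> \<le> h (y t1)"
    using barrier_along_near_flow[OF A2 C1J \<open>0 < c\<close>, of "min d \<delta>" R \<theta>c] by metis
  define Mp where "Mp = max Mp1 Mp2"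
  obtain \<epsilon>1 where "0 < \<epsilon>1" and conf1: "\<And>\<kappa> t0 t1 y. 0 < \<kappa> \<Longrightarrow>
        t0 \<le> t1 \<and> near_flow (nominal_field J h c Mp) \<kappa> \<epsilon>1 (cball \<theta>c R) t0 t1 y \<and>
        y t0 \<in> cball \<theta>c r \<and> (?P \<or> \<kappa> * (t1 - t0) \<le> H) \<and>
        (\<forall>t\<in>{t0..t1}. h (y t0) * exp (- c * \<kappa> * (t - t0)) - d \<le> h (y t)) \<Longrightarrow>
        y t1 \<in> cball \<theta>c (R - 1)"
    using conf[unfolded confines_def, rule_format, of Mp] unfolding Mp_def by auto
  show thesis
  proof (rule that[of Mp R "min \<epsilon>1 \<epsilon>2"])
    show "0 < Mp" unfolding Mp_def using \<open>0 < Mp1\<close> by simp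
    show "0 < min \<epsilon>1 \<epsilon>2" using \<open>0 < \<epsilon>1\<close> \<open>0 < \<epsilon>2\<close> by simp
    fix \<kappa> t0 t1 :: real and y :: "real \<Rightarrow> real^'n"
    assume \<kappa>: "0 < \<kappa>" and "t0 \<le> t1" and y: "y t0 \<in> cball \<theta>c r"
      and flow: "near_flow (nominal_field J h c Mp) \<kappa> (min \<epsilon>1 \<epsilon>2) (cball \<theta>c R) t0 t1 y"
      and allowed: "(assm_A4 J h \<theta>c \<and> assm_A5 J h \<theta>c) \<or> (\<exists>\<theta>. h \<theta> \<le> 0) \<or> \<kappa> * (t1 - t0) \<le> H"
    have b: "h (y t0) * exp (- c * \<kappa> * (t - t0)) - min d \<delta> \<le> h (y t)" if "t \<in> {t0..t1}" for t
    proof (rule barrier[OF _ \<kappa>])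
      show "near_flow (nominal_field J h c Mp) \<kappa> \<epsilon>2 (cball \<theta>c R) t0 t y"
        using near_flow_subinterval[OF near_flow_mono[OF flow, of \<epsilon>2]] \<kappa> that by auto
    qed (use that Mp_def in auto)
    have "y t1 \<in> cball \<theta>c (R - 1)"
    proof (rule conf1[OF \<kappa>], intro conjI ballI)
      show "near_flow (nominal_field J h c Mp) \<kappa> \<epsilon>1 (cball \<theta>c R) t0 t1 y"
        by (rule near_flow_mono[OF flow]) (use \<kappa> in auto)
      show "h (y t0) * exp (- c * \<kappa> * (t - t0)) - d \<le> h (y t)" if "t \<in> {t0..t1}" for t
        using b[OF that] by linarith
    qed (use \<open>t0 \<le> t1\<close> y allowed in auto)
    then show "y t1 \<in> cball \<theta>c (R - 1) \<and> h (y t0) * exp (- c * \<kappa> * (t1 - t0)) - \<delta> \<le> h (y t1)"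
      using b[of t1] \<open>t0 \<le> t1\<close> by simp
  qed (rule R)
qed

section \<open>Reduction of the extremum seeking system to the nominal flow\<close>

lemma ses_field_eq:
  "ses_field J h \<omega> c Mp a \<omega>f k t z =
     (let \<theta> = fst z + probe_S a \<omega> t; M = demod_M a \<omega> t in
       ((k * \<omega>f) *\<^sub>R safe_dir c Mp (fst (snd z)) (fst (snd (snd (snd z)))) (snd (snd (snd (snd z)))),
        (- \<omega>f) *\<^sub>R (fst (snd z) - (J \<theta> - fst (snd (snd z))) *\<^sub>R M),
        - \<omega>f * (fst (snd (snd z)) - J \<theta>),
        (- \<omega>f) *\<^sub>R (fst (snd (snd (snd z))) - (h \<theta> - snd (snd (snd (snd z)))) *\<^sub>R M),
        - \<omega>f * (snd (snd (snd (snd z))) - h \<theta>)))"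
  by (cases z rule: prod_cases5) (simp add: safe_dir_def Let_def)

lemma ses_solution_on_subset:
  "ses_solution_on I J h \<omega> c Mp a \<omega>f k x \<Longrightarrow> I' \<subseteq> I \<Longrightarrow> ses_solution_on I' J h \<omega> c Mp a \<omega>f k x"
  unfolding ses_solution_on_def by (meson has_vector_derivative_within_subset subsetD)

lemma ses_solution_components:
  assumes "ses_solution_on {t0..t1} J h \<omega> c Mp a \<omega>f k x"
  shows "estimator_on J \<omega> a \<omega>f t0 t1 (\<lambda>t. fst (x t)) (\<lambda>t. fst (snd (snd (x t)))) (\<lambda>t. fst (snd (x t)))"
    and "estimator_on h \<omega> a \<omega>f t0 t1 (\<lambda>t. fst (x t)) (\<lambda>t. snd (snd (snd (snd (x t))))) (\<lambda>t. fst (snd (snd (snd (x t)))))"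
    and "\<And>t. t \<in> {t0..t1} \<Longrightarrow> ((\<lambda>t. fst (x t)) has_vector_derivative
           (k * \<omega>f) *\<^sub>R safe_dir c Mp (fst (snd (x t))) (fst (snd (snd (snd (x t))))) (snd (snd (snd (snd (x t))))))
           (at t within {t0..t1})"
proof -
  note fst' = bounded_linear.has_vector_derivative[OF bounded_linear_fst]
  note snd' = bounded_linear.has_vector_derivative[OF bounded_linear_snd]
  have x: "(x has_vector_derivative ses_field J h \<omega> c Mp a \<omega>f k t (x t)) (at t within {t0..t1})"
    if "t \<in> {t0..t1}" for t
    using assms that unfolding ses_solution_on_def by blast
  note x1 = fst'[OF x] and x2 = fst'[OF snd'[OF x]] and x3 = fst'[OF snd'[OF snd'[OF x]]]
    and x4 = fst'[OF snd'[OF snd'[OF snd'[OF x]]]] and x5 = snd'[OF snd'[OF snd'[OF snd'[OF x]]]]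
  note simps = ses_field_eq Let_def fst_conv snd_conv
  show "estimator_on J \<omega> a \<omega>f t0 t1 (\<lambda>t. fst (x t)) (\<lambda>t. fst (snd (snd (x t)))) (\<lambda>t. fst (snd (x t)))"
    unfolding estimator_on_def has_real_derivative_iff_has_vector_derivative
    using x2[unfolded simps] x3[unfolded simps] by blast
  show "estimator_on h \<omega> a \<omega>f t0 t1 (\<lambda>t. fst (x t)) (\<lambda>t. snd (snd (snd (snd (x t))))) (\<lambda>t. fst (snd (snd (snd (x t)))))"
    unfolding estimator_on_def has_real_derivative_iff_has_vector_derivative
    using x4[unfolded simps] x5[unfolded simps] by blast
  show "\<And>t. t \<in> {t0..t1} \<Longrightarrow> ((\<lambda>t. fst (x t)) has_vector_derivative
           (k * \<omega>f) *\<^sub>R safe_dir c Mp (fst (snd (x t))) (fst (snd (snd (snd (x t))))) (snd (snd (snd (snd (x t))))))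
           (at t within {t0..t1})"
    using x1[unfolded simps] by blast
qed

lemma estimate_components_le_norm:
  fixes z :: "'n::finite estimates"
  shows "norm (fst z) \<le> norm z" "\<bar>fst (snd z)\<bar> \<le> norm z"
    "norm (fst (snd (snd z))) \<le> norm z" "\<bar>snd (snd (snd z))\<bar> \<le> norm z"
    "norm z \<le> norm (fst z) + \<bar>fst (snd z)\<bar> + norm (fst (snd (snd z))) + \<bar>snd (snd (snd z))\<bar>"
proof -
  obtain z1 z2 z3 z4 where z: "z = (z1, z2, z3, z4)" by (cases z rule: prod_cases4)
  have "norm (z2, z3, z4) \<le> norm z" "norm (z3, z4) \<le> norm (z2, z3, z4)"
    unfolding z using norm_snd_le by metis+
  then show "norm (fst z) \<le> norm z" "\<bar>fst (snd z)\<bar> \<le> norm z"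
    "norm (fst (snd (snd z))) \<le> norm z" "\<bar>snd (snd (snd z))\<bar> \<le> norm z"
    using norm_fst_le[of z1 "(z2, z3, z4)"] norm_fst_le[of z2 "(z3, z4)"] norm_fst_le[of z3 z4] norm_snd_le[of z4 z3]
    unfolding z by auto
  show "norm z \<le> norm (fst z) + \<bar>fst (snd z)\<bar> + norm (fst (snd (snd z))) + \<bar>snd (snd (snd z))\<bar>"
    unfolding z using norm_Pair_le[of z1 "(z2, z3, z4)"] norm_Pair_le[of z2 "(z3, z4)"] norm_Pair_le[of z3 z4] by auto
qed

text \<open>
  The initial condition of the theorem measures the estimates relative to their averages, so these
  bound the initial size of the estimates, by a multiple of \<open>1 / a\<close>.
\<close>

lemma avg_estimates_bounded:
  fixes J h :: "real^'n \<Rightarrow> real"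
  assumes BJ: "\<And>x. x \<in> cball \<theta>c (R + real CARD('n)) \<Longrightarrow> \<bar>J x\<bar> \<le> B"
    and Bh: "\<And>x. x \<in> cball \<theta>c (R + real CARD('n)) \<Longrightarrow> \<bar>h x\<bar> \<le> B"
    and "0 < T" "0 < a" "a \<le> 1" and \<theta>: "\<theta> \<in> cball \<theta>c R"
  shows "norm (avg_estimates J h \<omega> T \<theta> a) \<le> 2 * (B * (real CARD('n) * (2 / a)) + B)"
proof -
  define m where "m = real CARD('n) * (2 / a)"
  let ?b = "2 * (B * m + B)"
  define g where "g = (\<lambda>t. let \<phi> = \<theta> + probe_S a \<omega> t in
        (J \<phi> *\<^sub>R demod_M a \<omega> t, J \<phi>, h \<phi> *\<^sub>R demod_M a \<omega> t, h \<phi>))"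
  have "norm (g t) \<le> ?b" for t
  proof -
    let ?\<phi> = "\<theta> + probe_S a \<omega> t" and ?M = "demod_M a \<omega> t :: real^'n"
    have in_ball: "?\<phi> \<in> cball \<theta>c (R + real CARD('n))" by (rule probe_S_in_ball[OF \<theta> assms(4,5)])
    have M: "norm ?M \<le> m" unfolding m_def by (rule norm_demod_M_le[OF \<open>0 < a\<close>])
    have "norm (g t) \<le> \<bar>J ?\<phi>\<bar> * norm ?M + \<bar>J ?\<phi>\<bar> + \<bar>h ?\<phi>\<bar> * norm ?M + \<bar>h ?\<phi>\<bar>"
      using estimate_components_le_norm(5)[of "g t"] by (simp add: g_def Let_def)
    also have "\<dots> \<le> B * m + B + B * m + B"
      using BJ[OF in_ball] Bh[OF in_ball] M by (intro add_mono mult_mono) auto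
    finally show ?thesis by simp
  qed
  have "0 \<le> ?b" using \<open>\<And>t. norm (g t) \<le> ?b\<close> norm_ge_zero order_trans by blast
  have "norm (integral {0..T} g) \<le> ?b * T"
  proof (cases "g integrable_on {0..T}")
    case True
    have "norm (integral {0..T} g) \<le> ?b * measure lborel {0..T}"
      by (rule has_integral_bound_real[OF \<open>0 \<le> ?b\<close> finite.emptyI integrable_integral[OF True]])
        (use \<open>\<And>t. norm (g t) \<le> ?b\<close> in blast)
    then show ?thesis using \<open>0 < T\<close> by simp
  next
    case False
    then show ?thesis using \<open>0 \<le> ?b\<close> \<open>0 < T\<close> by (simp add: not_integrable_integral)
  qed
  then show ?thesis
    unfolding avg_estimates_def g_def[symmetric] m_def[symmetric] using \<open>0 < T\<close> by (simp add: divide_le_eq)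
qed

lemma safe_dir_close:
  fixes B :: real
  assumes "0 < Mp" "0 < \<epsilon>"
  obtains d where "0 < d"
    "\<And>g p :: real^'n. \<And>q g' p' q'. norm g \<le> B \<Longrightarrow> norm p \<le> B \<Longrightarrow> \<bar>q\<bar> \<le> B \<Longrightarrow>
       norm (g' - g) \<le> d \<Longrightarrow> norm (p' - p) \<le> d \<Longrightarrow> \<bar>q' - q\<bar> \<le> d \<Longrightarrow>
       norm (safe_dir c Mp g' p' q' - safe_dir c Mp g p q) \<le> \<epsilon>"
proof -
  define K where "K = (cball 0 (B + 1) \<times> cball 0 (B + 1) \<times> cball 0 (B + 1) :: ((real^'n) \<times> (real^'n) \<times> real) set)"
  define F where "F = (\<lambda>z :: (real^'n) \<times> (real^'n) \<times> real. safe_dir c Mp (fst z) (fst (snd z)) (snd (snd z)))"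
  have "compact K" unfolding K_def by (intro compact_Times compact_cball)
  moreover have "continuous_on K F"
    unfolding F_def by (intro continuous_on_safe_dir[OF \<open>0 < Mp\<close>] continuous_intros)
  ultimately have "uniformly_continuous_on K F" by (intro compact_uniformly_continuous)
  then obtain d where d: "0 < d" "\<And>z z'. z \<in> K \<Longrightarrow> z' \<in> K \<Longrightarrow> dist z' z < d \<Longrightarrow> dist (F z') (F z) < \<epsilon>"
    using \<open>0 < \<epsilon>\<close> unfolding uniformly_continuous_on_def by metis
  define d' where "d' = min 1 (d / 4)"
  have d': "0 < d'" "d' \<le> 1" "4 * d' \<le> d" unfolding d'_def using d(1) by auto
  show thesis
  proof (rule that[OF d'(1)])
    fix g p g' p' :: "real^'n" and q q' :: real
    assume b: "norm g \<le> B" "norm p \<le> B" "\<bar>q\<bar> \<le> B"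
      and c: "norm (g' - g) \<le> d'" "norm (p' - p) \<le> d'" "\<bar>q' - q\<bar> \<le> d'"
    have "norm g' \<le> B + 1" "norm p' \<le> B + 1" "\<bar>q'\<bar> \<le> B + 1"
      using norm_triangle_sub[of g' g] norm_triangle_sub[of p' p] b c d'(2) by linarith+
    then have in_K: "(g, p, q) \<in> K" "(g', p', q') \<in> K" using b unfolding K_def by auto
    have "dist (g', p', q') (g, p, q) \<le> norm (g' - g) + (norm (p' - p) + \<bar>q' - q\<bar>)"
      unfolding dist_norm diff_Pair
      using norm_Pair_le[of "g' - g" "(p' - p, q' - q)"] norm_Pair_le[of "p' - p" "q' - q"] by simp
    also have "\<dots> < d" using c d' d(1) by linarith
    finally show "norm (safe_dir c Mp g' p' q' - safe_dir c Mp g p q) \<le> \<epsilon>"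
      using d(2)[OF in_K] unfolding F_def dist_norm by simp
  qed
qed

lemma exp_minus_le_inverse:
  fixes s :: real
  assumes "0 < s"
  shows "exp (- s) \<le> 1 / s"
proof -
  have "s \<le> exp s" using exp_ge_add_one_self[of s] by linarith
  then show ?thesis using assms by (simp add: exp_minus inverse_eq_divide frac_le)
qed

text \<open>
  Until \<open>ts\<close> the estimates may be wrong and \<open>\<theta>hat\<close> stays where it is up to \<open>\<epsilon>\<close>; afterwards it follows
  the nominal field up to \<open>\<epsilon>\<close>. The bound \<open>D\<close> on the state is for the existence of solutions.
\<close>

definition follows_nominal ::
  "(real^'n \<Rightarrow> real) \<Rightarrow> (real^'n \<Rightarrow> real) \<Rightarrow> ('n::finite \<Rightarrow> real) \<Rightarrow> real \<Rightarrow> real \<Rightarrow> real^'n \<Rightarrow> real \<Rightarrow> real \<Rightarrow>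
   real \<Rightarrow> real \<Rightarrow> real \<Rightarrow> real \<Rightarrow> real \<Rightarrow> real \<Rightarrow> bool" where
  "follows_nominal J h \<omega> c T \<theta>c Mp \<Delta> \<epsilon> R as a ks D \<longleftrightarrow> (
     \<forall>\<omega>f\<in>{0<..<as}. \<forall>k\<in>{0<..<ks}. \<forall>t0 t1 x.
     t0 \<le> t1 \<and> ses_solution_on {t0..t1} J h \<omega> c Mp a \<omega>f k x \<and>
     norm (error_state J h \<omega> T \<theta>c a (x t0)) \<le> \<Delta> \<and> (\<forall>t\<in>{t0..t1}. fst (x t) \<in> cball \<theta>c R) \<longrightarrow>
     norm (x t1) \<le> D \<and>
     (\<exists>ts\<ge>t0. k * \<omega>f * (ts - t0) \<le> \<epsilon> \<and>
        (\<forall>t\<in>{t0..t1}. t \<le> ts \<longrightarrow> norm (fst (x t) - fst (x t0)) \<le> \<epsilon>) \<and>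
        near_flow (nominal_field J h c Mp) (k * \<omega>f) \<epsilon> (cball \<theta>c R) ts t1 (\<lambda>t. fst (x t))))"

text \<open>
  First \<open>as\<close> bounds the persistent error \<open>C * (a + \<omega>f)\<close> of the estimators. Then \<open>a\<close> determines the
  bounds \<open>X\<close>, \<open>Y\<close>, \<open>Xb\<close> on the initial error and on the estimates, and with them the speed \<open>DF\<close>.
  Finally \<open>k\<close> is chosen so small that \<open>\<theta>hat\<close> is slow for the filters and that it
  moves by at most \<open>\<epsilon>\<close> during the time \<open>V / \<omega>f\<close> in which the initial error decays.
\<close>

lemma slow_dynamics_near_nominal:
  fixes J h :: "real^'n \<Rightarrow> real" and \<omega> :: "'n \<Rightarrow> real"
  assumes C1J: "C1_loc_lipschitz_grad J" and C1h: "C1_loc_lipschitz_grad h"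
    and \<omega>: "\<And>i. 0 < \<omega> i" "inj \<omega>"
    and "0 < c" "0 < Mp" "0 < \<epsilon>" "0 < T" "0 < \<Delta>"
  shows "\<exists>as>0. \<forall>a\<in>{0<..<as}. \<exists>ks>0. \<exists>D. follows_nominal J h \<omega> c T \<theta>c Mp \<Delta> \<epsilon> R as a ks D"
proof -
  let ?N = "real CARD('n)"
  let ?ball = "cball \<theta>c (R + ?N)"
  obtain BJ where BJ: "0 < BJ" "\<And>x. x \<in> ?ball \<Longrightarrow> \<bar>J x\<bar> \<le> BJ" "\<And>x. x \<in> ?ball \<Longrightarrow> norm (grad J x) \<le> BJ"
    by (rule C1_bounds_on_ball[OF C1J, of \<theta>c "R + ?N"]) blast
  obtain Bh where Bh: "0 < Bh" "\<And>x. x \<in> ?ball \<Longrightarrow> \<bar>h x\<bar> \<le> Bh" "\<And>x. x \<in> ?ball \<Longrightarrow> norm (grad h x) \<le> Bh"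
    by (rule C1_bounds_on_ball[OF C1h, of \<theta>c "R + ?N"]) blast
  define B where "B = BJ + Bh"
  have B: "0 < B" and J_le: "\<And>x. x \<in> ?ball \<Longrightarrow> \<bar>J x\<bar> \<le> B" and gJ_le: "\<And>x. x \<in> ?ball \<Longrightarrow> norm (grad J x) \<le> B"
    and h_le: "\<And>x. x \<in> ?ball \<Longrightarrow> \<bar>h x\<bar> \<le> B" and gh_le: "\<And>x. x \<in> ?ball \<Longrightarrow> norm (grad h x) \<le> B"
    unfolding B_def using BJ Bh by (fastforce intro: add_increasing add_increasing2)+
  have sub: "x \<in> ?ball" if "x \<in> cball \<theta>c R" for x using that by (auto intro: order_trans)
  obtain d where d: "0 < d" and close:
    "\<And>g p :: real^'n. \<And>q g' p' q'. norm g \<le> B \<Longrightarrow> norm p \<le> B \<Longrightarrow> \<bar>q\<bar> \<le> B \<Longrightarrow>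
       norm (g' - g) \<le> d \<Longrightarrow> norm (p' - p) \<le> d \<Longrightarrow> \<bar>q' - q\<bar> \<le> d \<Longrightarrow>
       norm (safe_dir c Mp g' p' q' - safe_dir c Mp g p q) \<le> \<epsilon>"
    by (rule safe_dir_close[OF \<open>0 < Mp\<close> \<open>0 < \<epsilon>\<close>, of B c]) blast
  obtain CJ where CJ: "0 < CJ"
    "\<And>a X. 0 < a \<Longrightarrow> a \<le> 1 \<Longrightarrow> 0 \<le> X \<Longrightarrow> \<exists>Y>0. tracks_gradient J \<omega> (cball \<theta>c R) CJ a X Y"
    by (rule estimators_track[OF C1J \<omega>, of \<theta>c R]) blast
  obtain Ch where Ch: "0 < Ch"
    "\<And>a X. 0 < a \<Longrightarrow> a \<le> 1 \<Longrightarrow> 0 \<le> X \<Longrightarrow> \<exists>Y>0. tracks_gradient h \<omega> (cball \<theta>c R) Ch a X Y"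
    by (rule estimators_track[OF C1h \<omega>, of \<theta>c R]) blast
  define C where "C = CJ + Ch"
  have C: "0 < C" "CJ \<le> C" "Ch \<le> C" unfolding C_def using CJ Ch by auto
  define as where "as = min 1 (d / (4 * C))"
  have as: "0 < as" "as \<le> 1" "C * (2 * as) \<le> d / 2"
  proof -
    show "0 < as" "as \<le> 1" unfolding as_def using d C by auto
    have "as \<le> d / (4 * C)" unfolding as_def by simp
    then show "C * (2 * as) \<le> d / 2" using C by (simp add: field_simps)
  qed
  show ?thesis
  proof (rule exI[of _ as], intro conjI ballI)
    fix a assume "a \<in> {0<..<as}"
    then have a: "0 < a" "a < as" "a \<le> 1" using as by auto
    define X where "X = \<Delta> + 2 * (B * (?N * (2 / a)) + B)"
    have "0 < B * (?N * (2 / a))" using B a by simp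
    from add_pos_pos[OF this B] have X: "0 < X"
      unfolding X_def by (intro add_pos_pos[OF \<open>0 < \<Delta>\<close>] mult_pos_pos[OF zero_less_numeral])
    obtain YJ where YJ: "0 < YJ" "tracks_gradient J \<omega> (cball \<theta>c R) CJ a X YJ" using CJ(2)[of a X] a X by auto
    obtain Yh where Yh: "0 < Yh" "tracks_gradient h \<omega> (cball \<theta>c R) Ch a X Yh" using Ch(2)[of a X] a X by auto
    \<comment> \<open>after the scaled time \<open>V\<close> the initial error has decayed to \<open>d / 2\<close>, as \<open>exp (- V) \<le> 1 / V\<close>\<close>
    define V where "V = 2 * (YJ + Yh) / d"
    have V: "0 < V" unfolding V_def using YJ Yh d by simp
    define Xb where "Xb = B + X + ?N * ((2 * B + X) * (2 / a) + X)"
    have "0 \<le> ?N * ((2 * B + X) * (2 / a) + X)"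
      using B X a by (intro mult_nonneg_nonneg add_nonneg_nonneg) auto
    then have Xb: "B + X \<le> Xb" "?N * ((2 * B + X) * (2 / a) + X) \<le> Xb" "0 < Xb"
      unfolding Xb_def using B X by auto
    define DF where "DF = Xb + Mp * (Xb * Xb + c * Xb) * Xb"
    have DF: "0 < DF" unfolding DF_def using Xb \<open>0 < Mp\<close> \<open>0 < c\<close> by (intro add_pos_pos mult_pos_pos)
    define ks where "ks = min (a / DF) (\<epsilon> / (V * (DF + 1)))"
    have ks: "0 < ks" unfolding ks_def using a DF \<open>0 < \<epsilon>\<close> V by simp
    have main: "norm (x t1) \<le> norm \<theta>c + R + 4 * Xb \<and>
        (\<exists>ts\<ge>t0. k * \<omega>f * (ts - t0) \<le> \<epsilon> \<and>
          (\<forall>t\<in>{t0..t1}. t \<le> ts \<longrightarrow> norm (fst (x t) - fst (x t0)) \<le> \<epsilon>) \<and>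
          near_flow (nominal_field J h c Mp) (k * \<omega>f) \<epsilon> (cball \<theta>c R) ts t1 (\<lambda>t. fst (x t)))"
      if params: "\<omega>f \<in> {0<..<as}" "k \<in> {0<..<ks}"
        and asm: "t0 \<le> t1 \<and> ses_solution_on {t0..t1} J h \<omega> c Mp a \<omega>f k x \<and>
          norm (error_state J h \<omega> T \<theta>c a (x t0)) \<le> \<Delta> \<and> (\<forall>t\<in>{t0..t1}. fst (x t) \<in> cball \<theta>c R)"
      for \<omega>f k t0 t1 and x :: "real \<Rightarrow> 'n ses_state"
    proof (rule conjI)
      have w: "0 < \<omega>f" "\<omega>f < as" "\<omega>f \<le> 1" and k: "0 < k" "k < ks" using params as by auto
      have kDF: "k * DF \<le> a"
      proof -
        have "k \<le> a / DF" using k unfolding ks_def by simp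
        then show ?thesis using DF by (simp add: pos_le_divide_eq)
      qed
      have kV: "k * (V * (DF + 1)) \<le> \<epsilon>"
      proof -
        have "k \<le> \<epsilon> / (V * (DF + 1))" using k unfolding ks_def by simp
        then show ?thesis using DF V by (simp add: pos_le_divide_eq)
      qed
      have "t0 \<le> t1" and sol: "ses_solution_on {t0..t1} J h \<omega> c Mp a \<omega>f k x"
        and err: "norm (error_state J h \<omega> T \<theta>c a (x t0)) \<le> \<Delta>"
        and ball: "\<And>t. t \<in> {t0..t1} \<Longrightarrow> fst (x t) \<in> cball \<theta>c R"
        using asm by blast+
      define y where "y = (\<lambda>t. fst (x t))"
      define GJ where "GJ = (\<lambda>t. fst (snd (x t)))"
      define \<eta>J where "\<eta>J = (\<lambda>t. fst (snd (snd (x t))))"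
      define Gh where "Gh = (\<lambda>t. fst (snd (snd (snd (x t)))))"
      define \<eta>h where "\<eta>h = (\<lambda>t. snd (snd (snd (snd (x t)))))"
      define F where "F = (\<lambda>t. safe_dir c Mp (GJ t) (Gh t) (\<eta>h t))"
      have estJ: "estimator_on J \<omega> a \<omega>f t0 t1 y \<eta>J GJ"
        and esth: "estimator_on h \<omega> a \<omega>f t0 t1 y \<eta>h Gh"
        and y': "\<And>t. t \<in> {t0..t1} \<Longrightarrow> (y has_vector_derivative (k * \<omega>f) *\<^sub>R F t) (at t within {t0..t1})"
        using ses_solution_components[OF sol] unfolding y_def GJ_def \<eta>J_def Gh_def \<eta>h_def F_def by blast+
      have yball: "y t \<in> cball \<theta>c R" if "t \<in> {t0..t1}" for t using ball[OF that] by (simp add: y_def)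
      have "norm (snd (x t0)) \<le> X"
      proof -
        let ?E = "error_state J h \<omega> T \<theta>c a (x t0)"
        have "norm (snd ?E) \<le> \<Delta>"
          using norm_snd_le[of "snd ?E" "fst ?E"] err unfolding prod.collapse by linarith
        then have "norm (snd (x t0) - avg_estimates J h \<omega> T (fst (x t0)) a) \<le> \<Delta>"
          by (simp add: error_state_def Let_def mu_def)
        moreover have "norm (avg_estimates J h \<omega> T (fst (x t0)) a) \<le> 2 * (B * (?N * (2 / a)) + B)"
          by (rule avg_estimates_bounded[OF J_le h_le \<open>0 < T\<close> a(1,3) ball]) (use \<open>t0 \<le> t1\<close> in auto)
        ultimately show ?thesis
          unfolding X_def using norm_triangle_sub[of "snd (x t0)" "avg_estimates J h \<omega> T (fst (x t0)) a"] by linarith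
      qed
      then have init: "norm (GJ t0) \<le> X" "\<bar>\<eta>J t0\<bar> \<le> X" "norm (Gh t0) \<le> X" "\<bar>\<eta>h t0\<bar> \<le> X"
        using estimate_components_le_norm(1-4)[of "snd (x t0)"]
        unfolding GJ_def \<eta>J_def Gh_def \<eta>h_def by linarith+
      have bounded: "norm (GJ t) \<le> Xb \<and> \<bar>\<eta>J t\<bar> \<le> Xb \<and> norm (Gh t) \<le> Xb \<and> \<bar>\<eta>h t\<bar> \<le> Xb"
        if t: "t \<in> {t0..t1}" for t
      proof -
        have le: "t0 \<le> t" "t \<le> t1" and yt: "\<And>s. s \<in> {t0..t} \<Longrightarrow> y s \<in> cball \<theta>c R" using t yball by auto
        note bJ = estimators_bounded[OF J_le le(1) a(1,3) w(1) estimator_on_subinterval[OF estJ le(2)] yt init(2,1)]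
        note bh = estimators_bounded[OF h_le le(1) a(1,3) w(1) estimator_on_subinterval[OF esth le(2)] yt init(4,3)]
        show ?thesis using bJ bh Xb by (auto intro: order_trans)
      qed
      have F_le: "norm (F t) \<le> DF" if "t \<in> {t0..t1}" for t
        unfolding F_def DF_def using bounded[OF that] by (intro norm_safe_dir_le \<open>0 < Mp\<close> \<open>0 < c\<close>) auto
      have speed: "norm ((k * \<omega>f) *\<^sub>R F t) \<le> k * \<omega>f * DF" if "t \<in> {t0..t1}" for t
        using F_le[OF that] k w by (simp add: mult_left_mono)
      have "k * \<omega>f * DF = \<omega>f * (k * DF)" by simp
      also have "\<dots> \<le> \<omega>f * a" using kDF w by (intro mult_left_mono) auto
      finally have slow: "norm ((k * \<omega>f) *\<^sub>R F t) \<le> \<omega>f * a" if "t \<in> {t0..t1}" for t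
        using speed[OF that] by linarith
      show "norm (x t1) \<le> norm \<theta>c + R + 4 * Xb"
      proof -
        have "norm (snd (x t1)) \<le> 4 * Xb"
          using estimate_components_le_norm(5)[of "snd (x t1)"] bounded[of t1] \<open>t0 \<le> t1\<close>
          unfolding GJ_def \<eta>J_def Gh_def \<eta>h_def by simp
        moreover have "norm (fst (x t1)) \<le> norm \<theta>c + R"
          using norm_triangle_sub[of "fst (x t1)" \<theta>c] ball[of t1] \<open>t0 \<le> t1\<close>
          by (simp add: dist_norm norm_minus_commute)
        ultimately show ?thesis using norm_Pair_le[of "fst (x t1)" "snd (x t1)"] by simp
      qed
      define ts where "ts = t0 + V / \<omega>f"
      have tsV: "k * \<omega>f * (ts - t0) = k * V" unfolding ts_def using w by simp
      have kV2: "k * V \<le> \<epsilon>" "k * V * DF \<le> \<epsilon>"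
      proof -
        have "0 < k * V" using k V by simp
        moreover have "0 < k * V * DF" using calculation DF by (rule mult_pos_pos)
        moreover have "k * V * DF + k * V \<le> \<epsilon>" using kV by (simp add: algebra_simps)
        ultimately show "k * V \<le> \<epsilon>" "k * V * DF \<le> \<epsilon>" by linarith+
      qed
      show "\<exists>ts\<ge>t0. k * \<omega>f * (ts - t0) \<le> \<epsilon> \<and>
          (\<forall>t\<in>{t0..t1}. t \<le> ts \<longrightarrow> norm (fst (x t) - fst (x t0)) \<le> \<epsilon>) \<and>
          near_flow (nominal_field J h c Mp) (k * \<omega>f) \<epsilon> (cball \<theta>c R) ts t1 (\<lambda>t. fst (x t))"
      proof (intro exI[of _ ts] conjI ballI impI)
        show "t0 \<le> ts" unfolding ts_def using V w by simp
        show "k * \<omega>f * (ts - t0) \<le> \<epsilon>" unfolding tsV by (rule kV2(1))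
        fix t assume t: "t \<in> {t0..t1}" "t \<le> ts"
        have "norm (y t - y t0) \<le> k * \<omega>f * DF * t - k * \<omega>f * DF * t0"
        proof (rule norm_diff_le_if_deriv_bound[where f' = "\<lambda>t. (k * \<omega>f) *\<^sub>R F t" and \<phi>' = "\<lambda>_. k * \<omega>f * DF"])
          fix s assume s: "s \<in> {t0..t}"
          show "(y has_vector_derivative (k * \<omega>f) *\<^sub>R F s) (at s within {t0..t})"
            by (rule has_vector_derivative_within_subset[OF y']) (use s t in auto)
          show "norm ((k * \<omega>f) *\<^sub>R F s) \<le> k * \<omega>f * DF" by (rule speed) (use s t in auto)
          show "((\<lambda>t. k * \<omega>f * DF * t) has_real_derivative k * \<omega>f * DF) (at s within {t0..t})"
            by (auto intro!: derivative_eq_intros)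
        qed (use t in simp)
        also have "\<dots> = k * \<omega>f * DF * (t - t0)" by (simp add: right_diff_distrib)
        also have "\<dots> \<le> k * \<omega>f * DF * (ts - t0)" using t k w DF by (intro mult_left_mono) auto
        also have "\<dots> = k * \<omega>f * (ts - t0) * DF" by simp
        also have "\<dots> \<le> \<epsilon>" unfolding tsV by (rule kV2(2))
        finally show "norm (fst (x t) - fst (x t0)) \<le> \<epsilon>" by (simp add: y_def)
      next
        show "near_flow (nominal_field J h c Mp) (k * \<omega>f) \<epsilon> (cball \<theta>c R) ts t1 (\<lambda>t. fst (x t))"
          unfolding near_flow_def y_def[symmetric]
        proof (intro exI[of _ "\<lambda>t. (k * \<omega>f) *\<^sub>R F t"] ballI conjI)
          fix t assume "t \<in> {ts..t1}"
          then have t: "t \<in> {t0..t1}" "ts \<le> t" and sub': "{ts..t1} \<subseteq> {t0..t1}"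
            using V w unfolding ts_def by (auto intro: order_trans[of t0 "t0 + V / \<omega>f"])
          show "(y has_vector_derivative (k * \<omega>f) *\<^sub>R F t) (at t within {ts..t1})"
            by (rule has_vector_derivative_within_subset[OF y'[OF t(1)] sub'])
          show "y t \<in> cball \<theta>c R" by (rule yball[OF t(1)])
          have decay: "(YJ + Yh) * exp (- \<omega>f * (t - t0)) \<le> d / 2"
          proof -
            have "V \<le> \<omega>f * (t - t0)" using t(2) w unfolding ts_def by (simp add: field_simps)
            then have "exp (- (\<omega>f * (t - t0))) \<le> exp (- V)" by simp
            also have "\<dots> \<le> 1 / V" by (rule exp_minus_le_inverse[OF V])
            finally have "(YJ + Yh) * exp (- (\<omega>f * (t - t0))) \<le> (YJ + Yh) * (1 / V)"
              using YJ Yh by (intro mult_left_mono) auto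
            moreover have half: "s * (1 / (2 * s / d)) = d / 2" if "0 < s" for s using that d by simp
            have "(YJ + Yh) * (1 / V) = d / 2"
              unfolding V_def by (rule half[OF add_pos_pos[OF YJ(1) Yh(1)]])
            ultimately show ?thesis by (simp only: mult_minus_left)
          qed
          have small: "C' * (a + \<omega>f) + Y' * exp (- \<omega>f * (t - t0)) \<le> d"
            if "C' \<le> C" "Y' \<le> YJ + Yh" for C' Y'
          proof -
            have "C' * (a + \<omega>f) \<le> C * (a + \<omega>f)" using that a w by (intro mult_right_mono) auto
            also have "\<dots> \<le> C * (2 * as)" using a w C by (intro mult_left_mono) auto
            finally have "C' * (a + \<omega>f) \<le> d / 2" using as(3) by linarith
            moreover have "Y' * exp (- \<omega>f * (t - t0)) \<le> (YJ + Yh) * exp (- \<omega>f * (t - t0))"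
              using that by (intro mult_right_mono) auto
            ultimately show ?thesis using decay by linarith
          qed
          have pre: "\<forall>s\<in>{t0..t}. (y has_vector_derivative (k * \<omega>f) *\<^sub>R F s) (at s within {t0..t}) \<and>
              norm ((k * \<omega>f) *\<^sub>R F s) \<le> \<omega>f * a \<and> y s \<in> cball \<theta>c R"
            using t slow yball by (auto intro!: has_vector_derivative_within_subset[OF y'])
          have J_track: "norm (GJ t - grad J (y t)) \<le> CJ * (a + \<omega>f) + YJ * exp (- \<omega>f * (t - t0))"
            using YJ(2)[unfolded tracks_gradient_def, rule_format, of \<omega>f t0 t y \<eta>J GJ "\<lambda>t. (k * \<omega>f) *\<^sub>R F t"]
              w t(1) estimator_on_subinterval[OF estJ, of t] pre init by auto
          have h_track: "\<bar>\<eta>h t - h (y t)\<bar> \<le> Ch * (a + \<omega>f) + Yh * exp (- \<omega>f * (t - t0))"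
              "norm (Gh t - grad h (y t)) \<le> Ch * (a + \<omega>f) + Yh * exp (- \<omega>f * (t - t0))"
            using Yh(2)[unfolded tracks_gradient_def, rule_format, of \<omega>f t0 t y \<eta>h Gh "\<lambda>t. (k * \<omega>f) *\<^sub>R F t"]
              w t(1) estimator_on_subinterval[OF esth, of t] pre init by auto
          have "norm (F t - nominal_field J h c Mp (y t)) \<le> \<epsilon>"
            unfolding F_def nominal_field_def
          proof (rule close)
            show "norm (grad J (y t)) \<le> B" "norm (grad h (y t)) \<le> B" "\<bar>h (y t)\<bar> \<le> B"
              using gJ_le gh_le h_le sub[OF yball[OF t(1)]] by blast+
            show "norm (GJ t - grad J (y t)) \<le> d"
              by (rule order_trans[OF J_track small]) (use C Yh in auto)
            show "norm (Gh t - grad h (y t)) \<le> d"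
              by (rule order_trans[OF h_track(2) small]) (use C YJ in auto)
            show "\<bar>\<eta>h t - h (y t)\<bar> \<le> d"
              by (rule order_trans[OF h_track(1) small]) (use C YJ in auto)
          qed
          then show "norm ((k * \<omega>f) *\<^sub>R F t - (k * \<omega>f) *\<^sub>R nominal_field J h c Mp (y t)) \<le> k * \<omega>f * \<epsilon>"
            using k w by (simp add: mult_left_mono flip: scaleR_diff_right)
        qed
      qed
    qed
    show "\<exists>ks>0. \<exists>D. follows_nominal J h \<omega> c T \<theta>c Mp \<Delta> \<epsilon> R as a ks D"
      unfolding follows_nominal_def using ks main by blast
  qed (rule as(1))
qed

section \<open>Local Lipschitz continuity of the field\<close>

text \<open>
  Both properties, uniformly in time, are kept together because only their conjunction is preserved by
  products.
\<close>

definition lip_bdd ::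
  "'a::real_normed_vector set \<Rightarrow> (real \<Rightarrow> 'a \<Rightarrow> 'b::real_normed_vector) \<Rightarrow> bool" where
  "lip_bdd S f \<longleftrightarrow> (\<exists>B L. 0 \<le> B \<and> 0 \<le> L \<and> (\<forall>t. \<forall>x\<in>S. norm (f t x) \<le> B) \<and>
     (\<forall>t. \<forall>x\<in>S. \<forall>y\<in>S. norm (f t x - f t y) \<le> L * norm (x - y)))"

lemma lip_bddI:
  assumes "\<And>t x. x \<in> S \<Longrightarrow> norm (f t x) \<le> B"
    and "\<And>t x y. x \<in> S \<Longrightarrow> y \<in> S \<Longrightarrow> norm (f t x - f t y) \<le> L * norm (x - y)"
  shows "lip_bdd S f"
proof -
  have "L * norm (x - y) \<le> \<bar>L\<bar> * norm (x - y)" for x y :: 'a by (intro mult_right_mono) auto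
  then show ?thesis
    unfolding lip_bdd_def
    by (intro exI[of _ "\<bar>B\<bar>"] exI[of _ "\<bar>L\<bar>"] conjI allI ballI abs_ge_zero
        order_trans[OF assms(1) abs_ge_self] order_trans[OF assms(2)])
qed

lemma lip_bddE:
  assumes "lip_bdd S f"
  obtains B L where "0 \<le> B" "0 \<le> L" "\<And>t x. x \<in> S \<Longrightarrow> norm (f t x) \<le> B"
    and "\<And>t x y. x \<in> S \<Longrightarrow> y \<in> S \<Longrightarrow> norm (f t x - f t y) \<le> L * norm (x - y)"
  using assms unfolding lip_bdd_def by blast

lemma lip_bdd_time:
  "(\<And>t. norm (g t) \<le> B) \<Longrightarrow> lip_bdd S (\<lambda>t x. g t)"
  by (rule lip_bddI[where B = B and L = 0]) auto

lemma lip_bdd_bounded_linear: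
  assumes "bounded_linear f"
  shows "lip_bdd (cball 0 r) (\<lambda>t x. f x)"
proof -
  interpret bounded_linear f by (rule assms)
  obtain K where K: "0 < K" "\<And>x. norm (f x) \<le> norm x * K" using pos_bounded by blast
  show ?thesis
  proof (rule lip_bddI[where B = "r * K" and L = K])
    show "norm (f x) \<le> r * K" if "x \<in> cball 0 r" for x
      by (rule order_trans[OF K(2) mult_right_mono]) (use that K(1) in auto)
    show "norm (f x - f y) \<le> K * norm (x - y)" for x y
      using K(2)[of "x - y"] by (simp add: diff mult.commute)
  qed
qed

lemma lip_bdd_bilinear:
  assumes "bounded_bilinear prd" "lip_bdd S f" "lip_bdd S g"
  shows "lip_bdd S (\<lambda>t x. prd (f t x) (g t x))"
proof -
  interpret bounded_bilinear "prd" by (rule assms(1))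
  obtain K where K: "0 < K" "\<And>a b. norm (prd a b) \<le> norm a * norm b * K" using pos_bounded by blast
  obtain Bf Lf where f: "0 \<le> Bf" "0 \<le> Lf" "\<And>t x. x \<in> S \<Longrightarrow> norm (f t x) \<le> Bf"
    "\<And>t x y. x \<in> S \<Longrightarrow> y \<in> S \<Longrightarrow> norm (f t x - f t y) \<le> Lf * norm (x - y)"
    by (rule lip_bddE[OF assms(2)]) blast
  obtain Bg Lg where g: "0 \<le> Bg" "0 \<le> Lg" "\<And>t x. x \<in> S \<Longrightarrow> norm (g t x) \<le> Bg"
    "\<And>t x y. x \<in> S \<Longrightarrow> y \<in> S \<Longrightarrow> norm (g t x - g t y) \<le> Lg * norm (x - y)"
    by (rule lip_bddE[OF assms(3)]) blast
  have le: "norm (prd a b) \<le> u * v * K" if "norm a \<le> u" "norm b \<le> v" "0 \<le> u" for a b u v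
    by (rule order_trans[OF K(2)]) (use that K(1) in \<open>intro mult_right_mono mult_mono; simp\<close>)
  show ?thesis
  proof (rule lip_bddI[where B = "Bf * Bg * K" and L = "(Lf * Bg + Bf * Lg) * K"])
    show "norm (prd (f t x) (g t x)) \<le> Bf * Bg * K" if "x \<in> S" for t x
      using f g that by (intro le) auto
    fix t x y assume xy: "x \<in> S" "y \<in> S"
    have "prd (f t x) (g t x) - prd (f t y) (g t y)
        = prd (f t x - f t y) (g t x) + prd (f t y) (g t x - g t y)"
      by (simp add: diff_left diff_right)
    also have "norm \<dots> \<le> (Lf * norm (x - y)) * Bg * K + Bf * (Lg * norm (x - y)) * K"
      using f g xy by (intro norm_triangle_mono le) auto
    finally show "norm (prd (f t x) (g t x) - prd (f t y) (g t y)) \<le> (Lf * Bg + Bf * Lg) * K * norm (x - y)"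
      by (simp add: algebra_simps)
  qed
qed

lemma lip_bdd_compose:
  fixes F :: "'b::real_normed_vector \<Rightarrow> 'c::real_normed_vector"
  assumes "lip_bdd S f"
    and F: "\<And>r. \<exists>L. \<forall>u\<in>cball 0 r. \<forall>v\<in>cball 0 r. norm (F u - F v) \<le> L * norm (u - v)"
  shows "lip_bdd S (\<lambda>t x. F (f t x))"
proof -
  obtain Bf Lf where f: "0 \<le> Bf" "0 \<le> Lf" "\<And>t x. x \<in> S \<Longrightarrow> norm (f t x) \<le> Bf"
    "\<And>t x y. x \<in> S \<Longrightarrow> y \<in> S \<Longrightarrow> norm (f t x - f t y) \<le> Lf * norm (x - y)"
    by (rule lip_bddE[OF assms(1)]) blast
  obtain L where L: "\<And>u v. norm u \<le> Bf \<Longrightarrow> norm v \<le> Bf \<Longrightarrow> norm (F u - F v) \<le> L * norm (u - v)"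
    using F[of Bf] unfolding Ball_def mem_cball_0 by blast
  have L': "norm (F u - F v) \<le> \<bar>L\<bar> * b" if "norm u \<le> Bf" "norm v \<le> Bf" "norm (u - v) \<le> b" for u v b
  proof -
    have "norm (F u - F v) \<le> L * norm (u - v)" using that L by blast
    also have "\<dots> \<le> \<bar>L\<bar> * b" using that(3) by (intro mult_mono) auto
    finally show ?thesis .
  qed
  show ?thesis
  proof (rule lip_bddI[where B = "norm (F 0) + \<bar>L\<bar> * Bf" and L = "\<bar>L\<bar> * Lf"])
    show "norm (F (f t x)) \<le> norm (F 0) + \<bar>L\<bar> * Bf" if "x \<in> S" for t x
      using L'[of "f t x" 0 Bf] f(1,3) that norm_triangle_sub[of "F (f t x)" "F 0"] by force
    show "norm (F (f t x) - F (f t y)) \<le> \<bar>L\<bar> * Lf * norm (x - y)" if "x \<in> S" "y \<in> S" for t x y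
      using L'[of "f t x" "f t y" "Lf * norm (x - y)"] f that by (simp add: mult.assoc)
  qed
qed

lemma lip_bdd_add:
  assumes "lip_bdd S f" "lip_bdd S g"
  shows "lip_bdd S (\<lambda>t x. f t x + g t x)"
proof -
  obtain Bf Lf where f: "\<And>t x. x \<in> S \<Longrightarrow> norm (f t x) \<le> Bf"
    "\<And>t x y. x \<in> S \<Longrightarrow> y \<in> S \<Longrightarrow> norm (f t x - f t y) \<le> Lf * norm (x - y)"
    by (rule lip_bddE[OF assms(1)]) blast
  obtain Bg Lg where g: "\<And>t x. x \<in> S \<Longrightarrow> norm (g t x) \<le> Bg"
    "\<And>t x y. x \<in> S \<Longrightarrow> y \<in> S \<Longrightarrow> norm (g t x - g t y) \<le> Lg * norm (x - y)"
    by (rule lip_bddE[OF assms(2)]) blast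
  show ?thesis
  proof (rule lip_bddI[where B = "Bf + Bg" and L = "Lf + Lg"])
    show "norm (f t x + g t x) \<le> Bf + Bg" if "x \<in> S" for t x
      using f g that by (intro norm_triangle_mono) auto
    show "norm (f t x + g t x - (f t y + g t y)) \<le> (Lf + Lg) * norm (x - y)" if "x \<in> S" "y \<in> S" for t x y
      unfolding add_diff_add distrib_right using f g that by (intro norm_triangle_mono) auto
  qed
qed

lemma lip_bdd_linear_image:
  "bounded_linear F \<Longrightarrow> lip_bdd S f \<Longrightarrow> lip_bdd S (\<lambda>t x. F (f t x))"
proof (rule lip_bdd_compose, assumption)
  fix r assume "bounded_linear F"
  then interpret bounded_linear F .
  obtain K where "\<And>x. norm (F x) \<le> norm x * K" using bounded by blast
  then show "\<exists>L. \<forall>u\<in>cball 0 r. \<forall>v\<in>cball 0 r. norm (F u - F v) \<le> L * norm (u - v)"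
    by (intro exI[of _ K]) (metis diff mult.commute)
qed

lemma lip_bdd_minus: "lip_bdd S f \<Longrightarrow> lip_bdd S (\<lambda>t x. - f t x)"
  by (intro lip_bdd_linear_image[of uminus] bounded_linear_minus bounded_linear_ident)

lemma lip_bdd_diff:
  "lip_bdd S f \<Longrightarrow> lip_bdd S g \<Longrightarrow> lip_bdd S (\<lambda>t x. f t x - g t x)"
  using lip_bdd_add[OF _ lip_bdd_minus, of S f g] by simp

lemma lip_bdd_Pair:
  assumes "lip_bdd S f" "lip_bdd S g"
  shows "lip_bdd S (\<lambda>t x. (f t x, g t x))"
proof -
  have "lip_bdd S (\<lambda>t x. (f t x, 0) + (0, g t x))"
    by (intro lip_bdd_add lip_bdd_linear_image[of "\<lambda>u. (u, 0)"] lip_bdd_linear_image[of "\<lambda>u. (0, u)"]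
        bounded_linear_Pair bounded_linear_ident bounded_linear_zero assms)
  then show ?thesis by simp
qed

lemma inverse_max_lipschitz:
  fixes u v b :: real
  assumes "0 < b"
  shows "\<bar>1 / max u b - 1 / max v b\<bar> \<le> (1 / b\<^sup>2) * \<bar>u - v\<bar>"
proof -
  have pos: "0 < max u b" "0 < max v b" using assms by (auto simp: less_max_iff_disj)
  have "b * b \<le> max u b * max v b" using assms by (intro mult_mono) auto
  have "\<bar>1 / max u b - 1 / max v b\<bar> = \<bar>max v b - max u b\<bar> / (max u b * max v b)"
    using pos by (simp add: diff_frac_eq abs_mult)
  also have "\<dots> \<le> \<bar>u - v\<bar> / (b * b)"
    using \<open>b * b \<le> _\<close> assms by (intro frac_le) (auto simp: max_def abs_if)
  finally show ?thesis by (simp add: power2_eq_square)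
qed

lemma lip_bdd_capped_inv_sq:
  assumes "0 < Mp" "lip_bdd S p"
  shows "lip_bdd S (\<lambda>t x. capped_inv_sq Mp (p t x))"
proof -
  have "lip_bdd S (\<lambda>t x. 1 / max (p t x \<bullet> p t x) (1 / Mp))"
  proof (rule lip_bdd_compose[where F = "\<lambda>u. 1 / max u (1 / Mp)"])
    show "lip_bdd S (\<lambda>t x. p t x \<bullet> p t x)"
      by (rule lip_bdd_bilinear[OF bounded_bilinear_inner assms(2,2)])
    show "\<exists>L. \<forall>u\<in>cball 0 r. \<forall>v\<in>cball 0 r. norm (1 / max u (1 / Mp) - 1 / max v (1 / Mp)) \<le> L * norm (u - v)"
      for r
      using inverse_max_lipschitz[of "1 / Mp"] assms(1)
      by (intro exI[of _ "1 / (1 / Mp)\<^sup>2"]) simp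
  qed
  then show ?thesis unfolding capped_inv_sq_eq[OF assms(1)] power2_norm_eq_inner .
qed

lemma lip_bdd_C1:
  fixes f :: "real^'n \<Rightarrow> real"
  assumes "C1_loc_lipschitz_grad f" "lip_bdd S g"
  shows "lip_bdd S (\<lambda>t x. f (g t x))"
proof (rule lip_bdd_compose[OF assms(2)])
  fix r :: real
  obtain B where "\<And>x y. x \<in> cball 0 r \<Longrightarrow> y \<in> cball 0 r \<Longrightarrow> \<bar>f x - f y\<bar> \<le> B * norm (x - y)"
    by (rule C1_bounds_on_ball[OF assms(1), of 0 r]) blast
  then show "\<exists>L. \<forall>u\<in>cball 0 r. \<forall>v\<in>cball 0 r. norm (f u - f v) \<le> L * norm (u - v)"
    by (intro exI[of _ B]) simp
qed

lemma lip_bdd_safe_dir: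
  assumes "0 < Mp" "lip_bdd S g" "lip_bdd S p" "lip_bdd S q"
  shows "lip_bdd S (\<lambda>t x. safe_dir c Mp (g t x) (p t x) (q t x))"
proof -
  have "lip_bdd S (\<lambda>t x. max (g t x \<bullet> p t x - c * q t x) 0)"
  proof (rule lip_bdd_compose[where F = "\<lambda>u. max u 0"])
    show "lip_bdd S (\<lambda>t x. g t x \<bullet> p t x - c * q t x)"
      by (intro lip_bdd_diff lip_bdd_bilinear[OF bounded_bilinear_inner]
          lip_bdd_linear_image[OF bounded_linear_mult_right] assms)
    show "\<exists>L. \<forall>u\<in>cball 0 r. \<forall>v\<in>cball 0 r. norm (max u 0 - max v 0) \<le> L * norm (u - v :: real)" for r
      by (intro exI[of _ 1]) (auto simp: max_def)
  qed
  then show ?thesis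
    unfolding safe_dir_def
    by (intro lip_bdd_add lip_bdd_minus lip_bdd_bilinear[OF bounded_bilinear_scaleR]
        lip_bdd_bilinear[OF bounded_bilinear_mult] lip_bdd_capped_inv_sq assms)
qed

lemma lip_bdd_ses_field:
  fixes J h :: "real^'n \<Rightarrow> real"
  assumes "C1_loc_lipschitz_grad J" "C1_loc_lipschitz_grad h" "0 < Mp" "0 < a"
  shows "lip_bdd (cball 0 r) (ses_field J h \<omega> c Mp a \<omega>f k)"
proof -
  let ?S = "cball 0 r :: 'n ses_state set"
  have proj: "lip_bdd ?S (\<lambda>t z. fst z)" "lip_bdd ?S (\<lambda>t z. fst (snd z))" "lip_bdd ?S (\<lambda>t z. fst (snd (snd z)))"
    "lip_bdd ?S (\<lambda>t z. fst (snd (snd (snd z))))" "lip_bdd ?S (\<lambda>t z. snd (snd (snd (snd z))))"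
    by (intro lip_bdd_bounded_linear bounded_linear_intros bounded_linear_fst_comp bounded_linear_snd_comp)+
  have S: "lip_bdd ?S (\<lambda>t z. probe_S a \<omega> t :: real^'n)"
    by (rule lip_bdd_time[OF norm_probe_S_le[OF assms(4)]])
  have M: "lip_bdd ?S (\<lambda>t z. demod_M a \<omega> t :: real^'n)"
    by (rule lip_bdd_time[OF norm_demod_M_le[OF assms(4)]])
  have "lip_bdd ?S (\<lambda>t z. ses_field J h \<omega> c Mp a \<omega>f k t z)"
    unfolding ses_field_eq Let_def
    by (intro lip_bdd_Pair lip_bdd_linear_image[OF bounded_linear_scaleR_right]
        lip_bdd_linear_image[OF bounded_linear_mult_right] lip_bdd_diff
        lip_bdd_bilinear[OF bounded_bilinear_scaleR] lip_bdd_safe_dir lip_bdd_C1 lip_bdd_add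
        assms proj S M)
  then show ?thesis .
qed

lemma continuous_on_ses_field:
  fixes J h :: "real^'n \<Rightarrow> real"
  assumes "C1_loc_lipschitz_grad J" "C1_loc_lipschitz_grad h" "0 < Mp"
  shows "continuous_on UNIV (\<lambda>(t, z). ses_field J h \<omega> c Mp a \<omega>f k t z)"
proof -
  have J: "continuous_on UNIV (\<lambda>z :: real \<times> 'n ses_state. f (fst (snd z) + probe_S a \<omega> (fst z)))"
    if "C1_loc_lipschitz_grad f" for f
    by (rule continuous_on_compose2[OF C1_continuous_on[OF that, of UNIV]])
      (auto simp: probe_S_def intro!: continuous_intros)
  show ?thesis
    unfolding ses_field_eq Let_def case_prod_beta' demod_M_def
    by (intro continuous_intros continuous_on_safe_dir J assms)
qed

section \<open>Practical safety\<close>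

lemma compose_decay_bounds:
  fixes q0 q1 q2 :: real
  assumes "q0 * exp (- u) - d \<le> q1" and "q1 * exp (- v) - d' \<le> q2" and "0 \<le> d" "0 \<le> v"
  shows "q0 * exp (- (u + v)) - (d + d') \<le> q2"
proof -
  have "(q0 * exp (- u) - d) * exp (- v) \<le> q1 * exp (- v)" using assms(1) by (intro mult_right_mono) auto
  moreover have "d * exp (- v) \<le> d * 1" using assms by (intro mult_left_mono) auto
  moreover have "(q0 * exp (- u) - d) * exp (- v) = q0 * exp (- (u + v)) - d * exp (- v)"
    by (simp add: left_diff_distrib exp_add[symmetric] mult.assoc)
  ultimately show ?thesis using assms(2) by linarith
qed

lemma decay_lower_bound_short:
  fixes q0 q1 :: real
  assumes "\<bar>q0\<bar> \<le> b" "0 \<le> u" "\<bar>q1 - q0\<bar> \<le> e"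
  shows "q0 * exp (- u) - (e + b * u) \<le> q1"
proof -
  have "1 - exp (- u) \<le> u" using exp_ge_add_one_self[of "- u"] by linarith
  moreover have "0 \<le> 1 - exp (- u)" using assms(2) by simp
  ultimately have "\<bar>q0\<bar> * (1 - exp (- u)) \<le> b * u" using assms(1) by (intro mult_mono) auto
  moreover have "\<bar>q0 * (1 - exp (- u))\<bar> = \<bar>q0\<bar> * (1 - exp (- u))"
    using \<open>0 \<le> 1 - exp (- u)\<close> by (simp add: abs_mult)
  ultimately have "- (q0 * (1 - exp (- u))) \<le> b * u" by linarith
  then show ?thesis using assms(3) by (simp add: right_diff_distrib)
qed

definition practically_safe ::
  "(real^'n \<Rightarrow> real) \<Rightarrow> (real^'n \<Rightarrow> real) \<Rightarrow> ('n::finite \<Rightarrow> real) \<Rightarrow> real \<Rightarrow> real \<Rightarrow> real^'n \<Rightarrow> real \<Rightarrow> real \<Rightarrow>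
   real \<Rightarrow> real \<Rightarrow> real \<Rightarrow> real \<Rightarrow> real \<Rightarrow> real \<Rightarrow> bool" where
  "practically_safe J h \<omega> c T \<theta>c Mp \<Delta> \<delta> H as a ks D \<longleftrightarrow> (
     \<forall>\<omega>f\<in>{0<..<as}. \<forall>k\<in>{0<..<ks}. \<forall>t0 t1 x.
     t0 \<le> t1 \<and> ses_solution_on {t0..t1} J h \<omega> c Mp a \<omega>f k x \<and>
     norm (error_state J h \<omega> T \<theta>c a (x t0)) \<le> \<Delta> \<and>
     ((assm_A4 J h \<theta>c \<and> assm_A5 J h \<theta>c) \<or> (\<exists>\<theta>. h \<theta> \<le> 0) \<or> k * \<omega>f * (t1 - t0) \<le> H) \<longrightarrow>
     norm (x t1) \<le> D \<and>
     h (applied_param a \<omega> x t0) * exp (- (c * (k * \<omega>f) * (t1 - t0))) - \<delta> \<le> h (applied_param a \<omega> x t1))"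

text \<open>
  While \<open>\<theta>hat\<close> is in the ball of radius \<open>R\<close>, the initial phase costs at most \<open>\<delta> / 4\<close> and the nominal phase another
  \<open>\<delta> / 4\<close>, and both leave \<open>\<theta>hat\<close> in the ball of radius \<open>R - 1\<close>. So the larger ball is never
  left. Passing from \<open>\<theta>hat\<close> to the applied parameter costs \<open>\<delta> / 8\<close> at each end.
\<close>

lemma ses_confined_and_safe:
  fixes J h :: "real^'n \<Rightarrow> real" and \<theta>c :: "real^'n" and \<omega> :: "'n \<Rightarrow> real"
  assumes A1: "assm_A1 J h \<theta>c" and A2: "assm_A2 h"
    and \<omega>: "\<And>i. 0 < \<omega> i" "inj \<omega>" and "0 < c" "0 < T"
    and confinement: "(assm_A4 J h \<theta>c \<and> assm_A5 J h \<theta>c) \<or> assm_A6 h"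
    and "0 < \<Delta>" "0 < \<delta>" "0 < H"
  shows "\<exists>Mp>0. \<exists>as>0. \<forall>a\<in>{0<..<as}. \<exists>ks>0. \<exists>D. practically_safe J h \<omega> c T \<theta>c Mp \<Delta> \<delta> H as a ks D"
proof -
  let ?N = "real CARD('n)"
  let ?P = "(assm_A4 J h \<theta>c \<and> assm_A5 J h \<theta>c) \<or> (\<exists>\<theta>. h \<theta> \<le> 0)"
  have C1J: "C1_loc_lipschitz_grad J" using A1 unfolding assm_A1_def by blast
  have C1h: "C1_loc_lipschitz_grad h" using A2 unfolding assm_A2_def by blast
  have r: "0 \<le> \<Delta> + 1" "0 < \<delta> / 4" using \<open>0 < \<Delta>\<close> \<open>0 < \<delta>\<close> by auto
  obtain Mp R \<epsilon>1 where Mp: "0 < Mp" and R: "\<Delta> + 1 + 1 \<le> R" and "0 < \<epsilon>1"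
    and nominal: "\<And>\<kappa> t0 t1 y. 0 < \<kappa> \<Longrightarrow> t0 \<le> t1 \<Longrightarrow>
      near_flow (nominal_field J h c Mp) \<kappa> \<epsilon>1 (cball \<theta>c R) t0 t1 y \<Longrightarrow> y t0 \<in> cball \<theta>c (\<Delta> + 1) \<Longrightarrow>
      (assm_A4 J h \<theta>c \<and> assm_A5 J h \<theta>c) \<or> (\<exists>\<theta>. h \<theta> \<le> 0) \<or> \<kappa> * (t1 - t0) \<le> H \<Longrightarrow>
      y t1 \<in> cball \<theta>c (R - 1) \<and> h (y t0) * exp (- c * \<kappa> * (t1 - t0)) - \<delta> / 4 \<le> h (y t1)"
    by (rule nominal_flow_safe_and_confined[OF A1 A2 confinement r(1) \<open>0 < c\<close> \<open>0 < H\<close> r(2)]) blast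
  obtain B where B: "0 < B" "\<And>x. x \<in> cball \<theta>c (R + ?N) \<Longrightarrow> \<bar>h x\<bar> \<le> B"
    "\<And>x y. x \<in> cball \<theta>c (R + ?N) \<Longrightarrow> y \<in> cball \<theta>c (R + ?N) \<Longrightarrow> \<bar>h x - h y\<bar> \<le> B * norm (x - y)"
    by (rule C1_bounds_on_ball[OF C1h, of \<theta>c "R + ?N"]) blast
  define \<epsilon> where "\<epsilon> = min (min \<epsilon>1 1) (\<delta> / (4 * (B * (1 + c))))"
  have Bc: "0 < B * (1 + c)" using B(1) \<open>0 < c\<close> by simp
  have \<epsilon>: "0 < \<epsilon>" "\<epsilon> \<le> \<epsilon>1" "\<epsilon> \<le> 1" "B * (1 + c) * \<epsilon> \<le> \<delta> / 4"
  proof -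
    show "0 < \<epsilon>" "\<epsilon> \<le> \<epsilon>1" "\<epsilon> \<le> 1" unfolding \<epsilon>_def using \<open>0 < \<epsilon>1\<close> \<open>0 < \<delta>\<close> Bc by auto
    have "\<epsilon> \<le> (\<delta> / 4) / (B * (1 + c))" unfolding \<epsilon>_def by simp
    then show "B * (1 + c) * \<epsilon> \<le> \<delta> / 4" using Bc by (simp only: pos_le_divide_eq mult.commute)
  qed
  obtain as0 where as0: "0 < as0"
    and slow: "\<And>a. a \<in> {0<..<as0} \<Longrightarrow> \<exists>ks>0. \<exists>D. follows_nominal J h \<omega> c T \<theta>c Mp \<Delta> \<epsilon> R as0 a ks D"
    using slow_dynamics_near_nominal[OF C1J C1h \<omega> \<open>0 < c\<close> Mp \<epsilon>(1) \<open>0 < T\<close> \<open>0 < \<Delta>\<close>, of \<theta>c R] by blast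
  define as where "as = min (min as0 1) (\<delta> / (8 * (B * ?N)))"
  have BN: "0 < B * ?N" using B(1) by simp
  have as: "0 < as" "as \<le> as0" "as \<le> 1" "B * ?N * as \<le> \<delta> / 8"
  proof -
    show "0 < as" "as \<le> as0" "as \<le> 1" unfolding as_def using as0 \<open>0 < \<delta>\<close> BN by auto
    have "as \<le> (\<delta> / 8) / (B * ?N)" unfolding as_def by simp
    then show "B * ?N * as \<le> \<delta> / 8" using BN by (simp only: pos_le_divide_eq mult.commute)
  qed
  show ?thesis
  proof (rule exI[of _ Mp], rule conjI, rule Mp, rule exI[of _ as], intro conjI ballI)
    fix a assume "a \<in> {0<..<as}"
    then have a: "0 < a" "a < as" "a \<le> 1" "a \<in> {0<..<as0}" using as by auto
    obtain ks D where ks: "0 < ks" and follows: "follows_nominal J h \<omega> c T \<theta>c Mp \<Delta> \<epsilon> R as0 a ks D"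
      using slow[OF a(4)] by blast
    note slow_a = follows[unfolded follows_nominal_def, rule_format]
    have main: "norm (x t1) \<le> D \<and>
        h (applied_param a \<omega> x t0) * exp (- (c * (k * \<omega>f) * (t1 - t0))) - \<delta> \<le> h (applied_param a \<omega> x t1)"
      if params: "\<omega>f \<in> {0<..<as}" "k \<in> {0<..<ks}" and "t0 \<le> t1"
        and sol: "ses_solution_on {t0..t1} J h \<omega> c Mp a \<omega>f k x"
        and err: "norm (error_state J h \<omega> T \<theta>c a (x t0)) \<le> \<Delta>"
        and allowed: "?P \<or> k * \<omega>f * (t1 - t0) \<le> H"
      for \<omega>f k t0 t1 and x :: "real \<Rightarrow> 'n ses_state"
    proof -
      have w: "0 < \<omega>f" "\<omega>f \<in> {0<..<as0}" and "0 < k" using params as by auto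
      define \<kappa> where "\<kappa> = k * \<omega>f"
      have \<kappa>: "0 < \<kappa>" unfolding \<kappa>_def using w \<open>0 < k\<close> by simp
      define y where "y = (\<lambda>t. fst (x t))"
      have y0: "y t0 \<in> cball \<theta>c \<Delta>"
      proof -
        have "norm (fst (error_state J h \<omega> T \<theta>c a (x t0))) \<le> \<Delta>"
          using norm_fst_le[of "fst (error_state J h \<omega> T \<theta>c a (x t0))" "snd (error_state J h \<omega> T \<theta>c a (x t0))"] err
          unfolding prod.collapse by linarith
        then show ?thesis by (simp add: error_state_def Let_def y_def dist_norm norm_minus_commute)
      qed
      have step: "norm (x t) \<le> D \<and> y t \<in> cball \<theta>c (R - 1) \<and>
          h (y t0) * exp (- (c * \<kappa> * (t - t0))) - \<delta> / 2 \<le> h (y t)"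
        if t: "t \<in> {t0..t1}" and ball: "\<And>s. s \<in> {t0..t} \<Longrightarrow> y s \<in> cball \<theta>c R" for t
      proof -
        have pre: "t0 \<le> t \<and> ses_solution_on {t0..t} J h \<omega> c Mp a \<omega>f k x \<and>
            norm (error_state J h \<omega> T \<theta>c a (x t0)) \<le> \<Delta> \<and> (\<forall>s\<in>{t0..t}. fst (x s) \<in> cball \<theta>c R)"
          using t err ball ses_solution_on_subset[OF sol] unfolding y_def by auto
        from slow_a[OF w(2) params(2) pre] obtain ts where D: "norm (x t) \<le> D"
          and ts: "t0 \<le> ts" "\<kappa> * (ts - t0) \<le> \<epsilon>"
          and short: "\<And>s. s \<in> {t0..t} \<Longrightarrow> s \<le> ts \<Longrightarrow> norm (y s - y t0) \<le> \<epsilon>"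
          and flow: "near_flow (nominal_field J h c Mp) \<kappa> \<epsilon> (cball \<theta>c R) ts t y"
          unfolding \<kappa>_def y_def by blast
        have in_ball: "y s \<in> cball \<theta>c (R + ?N)" if "s \<in> {t0..t}" for s
          using ball[OF that] by (auto intro: order_trans)
        have near: "y s \<in> cball \<theta>c (\<Delta> + 1)" if "s \<in> {t0..t}" "s \<le> ts" for s
        proof -
          have "dist (y t0) (y s) \<le> 1"
            using short[OF that] \<epsilon>(3) by (simp add: dist_norm norm_minus_commute)
          then show ?thesis using y0 dist_triangle[of \<theta>c "y s" "y t0"] by simp
        qed
        have phase1: "h (y t0) * exp (- (c * \<kappa> * (s - t0))) - \<delta> / 4 \<le> h (y s)"
          if s: "s \<in> {t0..t}" "s \<le> ts" for s
        proof -
          have "\<bar>h (y t0)\<bar> \<le> B" using B(2) in_ball t by auto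
          moreover have "0 \<le> c * \<kappa> * (s - t0)" using s \<kappa> \<open>0 < c\<close> by simp
          moreover have "\<bar>h (y s) - h (y t0)\<bar> \<le> B * \<epsilon>"
          proof -
            have "\<bar>h (y s) - h (y t0)\<bar> \<le> B * norm (y s - y t0)" using in_ball s t by (intro B(3)) auto
            also have "\<dots> \<le> B * \<epsilon>" using short[OF s] B(1) by (intro mult_left_mono) auto
            finally show ?thesis .
          qed
          ultimately have "h (y t0) * exp (- (c * \<kappa> * (s - t0))) - (B * \<epsilon> + B * (c * \<kappa> * (s - t0))) \<le> h (y s)"
            by (rule decay_lower_bound_short)
          moreover have "\<kappa> * (s - t0) \<le> \<epsilon>"
            by (rule order_trans[OF mult_left_mono ts(2)]) (use s \<kappa> in auto)
          then have "(B * c) * (\<kappa> * (s - t0)) \<le> (B * c) * \<epsilon>"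
            using B(1) \<open>0 < c\<close> by (intro mult_left_mono) auto
          ultimately show ?thesis using \<epsilon>(4) by (simp add: algebra_simps)
        qed
        show ?thesis
        proof (cases "t \<le> ts")
          case True
          have "t \<in> {t0..t}" using t by simp
          then have "y t \<in> cball \<theta>c (\<Delta> + 1)" using near True by blast
          then have "y t \<in> cball \<theta>c (R - 1)" using R by auto
          then show ?thesis using D phase1[OF \<open>t \<in> {t0..t}\<close> True] \<open>0 < \<delta>\<close> by auto
        next
          case False
          have ts_in: "ts \<in> {t0..t}" using ts False by simp
          have "\<kappa> * (t - ts) \<le> \<kappa> * (t1 - t0)" using t ts \<kappa> by (intro mult_left_mono) auto
          then have "(assm_A4 J h \<theta>c \<and> assm_A5 J h \<theta>c) \<or> (\<exists>\<theta>. h \<theta> \<le> 0) \<or> \<kappa> * (t - ts) \<le> H"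
            using allowed unfolding \<kappa>_def by auto
          from nominal[OF \<kappa> _ near_flow_mono[OF flow \<epsilon>(2)] near[OF ts_in] this]
          have "y t \<in> cball \<theta>c (R - 1)" and "h (y ts) * exp (- (c * \<kappa> * (t - ts))) - \<delta> / 4 \<le> h (y t)"
            using False \<kappa> by auto
          moreover have "h (y t0) * exp (- (c * \<kappa> * (ts - t0) + c * \<kappa> * (t - ts))) - (\<delta> / 4 + \<delta> / 4) \<le> h (y t)"
            by (rule compose_decay_bounds[OF phase1[OF ts_in]])
              (use calculation False \<kappa> \<open>0 < c\<close> \<open>0 < \<delta>\<close> in auto)
          moreover have "c * \<kappa> * (ts - t0) + c * \<kappa> * (t - ts) = c * \<kappa> * (t - t0)" by (simp add: algebra_simps)
          ultimately show ?thesis using D by simp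
        qed
      qed
      have confined: "y t \<in> cball \<theta>c R" if t: "t \<in> {t0..t1}" for t
      proof -
        have "dist \<theta>c (y t) \<le> R"
        proof (rule trapped_by_gap[where u = "\<lambda>t. dist \<theta>c (y t)" and R' = "R - 1", OF \<open>t0 \<le> t1\<close> _ _ _ _ t])
          have "continuous_on {t0..t1} y"
            unfolding y_def by (rule continuous_on_vector_derivative[OF ses_solution_components(3)[OF sol]])
          then show "continuous_on {t0..t1} (\<lambda>t. dist \<theta>c (y t))" by (intro continuous_intros)
          show "dist \<theta>c (y s) \<le> R - 1" if "s \<in> {t0..t1}" "\<And>u. u \<in> {t0..s} \<Longrightarrow> dist \<theta>c (y u) \<le> R" for s
            using step[OF that(1)] that(2) by simp
        qed (use y0 R in auto)
        then show ?thesis by simp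
      qed
      have t1: "t1 \<in> {t0..t1}" "t0 \<in> {t0..t1}" using \<open>t0 \<le> t1\<close> by auto
      have probe: "\<bar>h (y t + probe_S a \<omega> t) - h (y t)\<bar> \<le> \<delta> / 8" if "t \<in> {t0..t1}" for t
      proof -
        have "\<bar>h (y t + probe_S a \<omega> t) - h (y t)\<bar> \<le> B * norm (probe_S a \<omega> t :: real^'n)"
          using B(3)[OF probe_S_in_ball[OF confined[OF that] a(1,3)], of "y t"] confined[OF that] by auto
        also have "\<dots> \<le> B * (?N * as)"
          using norm_probe_S_le[OF a(1), of \<omega> t] a(2) B(1)
          by (intro mult_left_mono) (auto intro: order_trans[OF _ mult_left_mono[of a as ?N]])
        finally show ?thesis using as(4) by (simp add: mult.assoc)
      qed
      have result: "norm (x t1) \<le> D" "h (y t0) * exp (- (c * \<kappa> * (t1 - t0))) - \<delta> / 2 \<le> h (y t1)"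
        using step[OF t1(1) confined] by auto
      let ?E = "exp (- (c * \<kappa> * (t1 - t0)))"
      have "h (y t0 + probe_S a \<omega> t0) \<le> h (y t0) + \<delta> / 8" using probe[OF t1(2)] by linarith
      then have "h (y t0 + probe_S a \<omega> t0) * ?E \<le> (h (y t0) + \<delta> / 8) * ?E"
        by (intro mult_right_mono) auto
      also have "\<dots> \<le> h (y t0) * ?E + \<delta> / 8"
      proof -
        have "\<delta> / 8 * ?E \<le> \<delta> / 8 * 1"
          using \<open>0 < \<delta>\<close> \<kappa> \<open>0 < c\<close> \<open>t0 \<le> t1\<close> by (intro mult_left_mono) auto
        then show ?thesis by (simp add: distrib_right)
      qed
      finally have "h (y t0 + probe_S a \<omega> t0) * ?E - \<delta> \<le> h (y t1 + probe_S a \<omega> t1)"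
        using result(2) probe[OF t1(1)] \<open>0 < \<delta>\<close> by linarith
      then show ?thesis using result(1) unfolding applied_param_def y_def \<kappa>_def by simp
    qed
    show "\<exists>ks>0. \<exists>D. practically_safe J h \<omega> c T \<theta>c Mp \<Delta> \<delta> H as a ks D"
      unfolding practically_safe_def using ks main by blast
  qed (rule as(1))
qed

lemma ses_global_solution:
  fixes J h :: "real^'n \<Rightarrow> real"
  assumes C1: "C1_loc_lipschitz_grad J" "C1_loc_lipschitz_grad h" and "0 < Mp" "0 < a"
    and apriori: "\<And>t1 x. t0 \<le> t1 \<Longrightarrow> x t0 = x0 \<Longrightarrow> ses_solution_on {t0..t1} J h \<omega> c Mp a \<omega>f k x \<Longrightarrow>
      norm (x t1) \<le> D"
  shows "\<exists>x. x t0 = x0 \<and> ses_solution_on {t0..} J h \<omega> c Mp a \<omega>f k x"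
proof -
  define r' where "r' = max D (norm x0)"
  obtain B L where
    "\<And>t z. z \<in> cball 0 (r' + 1) \<Longrightarrow> norm (ses_field J h \<omega> c Mp a \<omega>f k t z) \<le> B"
    "\<And>t z z'. z \<in> cball 0 (r' + 1) \<Longrightarrow> z' \<in> cball 0 (r' + 1) \<Longrightarrow>
      norm (ses_field J h \<omega> c Mp a \<omega>f k t z - ses_field J h \<omega> c Mp a \<omega>f k t z') \<le> L * norm (z - z')"
    by (rule lip_bddE[OF lip_bdd_ses_field[OF C1 \<open>0 < Mp\<close> \<open>0 < a\<close>, of "r' + 1" \<omega> c \<omega>f k]]) blast
  then show ?thesis
    unfolding ses_solution_on_def
  proof (rule ode_global_solution_if_bounded[OF continuous_on_ses_field[OF C1 \<open>0 < Mp\<close>], where r' = r'])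
    show "norm (x t1) \<le> r'" if "t0 \<le> t1" "x t0 = x0"
      "\<And>t. t \<in> {t0..t1} \<Longrightarrow> (x has_vector_derivative ses_field J h \<omega> c Mp a \<omega>f k t (x t)) (at t within {t0..t1})"
      for t1 x
      using apriori[of t1 x, OF that(1,2)] that(3) unfolding ses_solution_on_def r'_def by (simp add: le_max_iff_disj)
  qed (auto simp: r'_def)
qed

text \<open>
  Where the flow is confined only for a scaled time \<open>H\<close>, all values of \<open>h\<close> are positive. Then \<open>H\<close> is
  chosen so that \<open>B * exp (- (c * H)) \<le> \<delta>\<close>, where \<open>B\<close> bounds the initial value of \<open>h\<close>, and after this time
  the lower bound is not positive.
\<close>

theorem theorem6:
  fixes J h :: "real^'n \<Rightarrow> real"
    and \<theta>c :: "real^'n"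
    and \<omega> :: "'n \<Rightarrow> real"
    and c T :: real
  assumes "assm_A1 J h \<theta>c"
    and "assm_A2 h"
    and "assm_A3 J h \<theta>c"
    and "assm_A7 \<omega> c"
    and "(assm_A4 J h \<theta>c \<and> assm_A5 J h \<theta>c) \<or> assm_A6 h"
    and "common_period \<omega> T"
  shows "\<forall>\<Delta>>0. \<exists>\<delta>s>0. \<exists>K>0. \<forall>\<delta>\<in>{0<..<\<delta>s}.
           \<exists>Mp>0. \<exists>as>0. \<exists>\<omega>fs>0. \<exists>ks :: real \<Rightarrow> real.
             \<forall>a\<in>{0<..<as}. \<forall>\<omega>f\<in>{0<..<\<omega>fs}. ks a > 0 \<and>
               (\<forall>k\<in>{0<..<ks a}. \<forall>t0\<ge>0. \<forall>x0.
                  norm (error_state J h \<omega> T \<theta>c a x0) \<le> \<Delta> \<longrightarrow>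
                    (\<forall>t\<ge>t0. \<forall>x. x t0 = x0 \<and> ses_solution_on {t0..t} J h \<omega> c Mp a \<omega>f k x \<longrightarrow>
                       h (applied_param a \<omega> x t)
                         \<ge> h (applied_param a \<omega> x t0) * exp (- c * k * \<omega>f * (t - t0)) - K * \<delta>) \<and>
                    ((assm_A4 J h \<theta>c \<and> assm_A5 J h \<theta>c) \<or> (\<exists>\<theta>. h \<theta> \<le> 0) \<longrightarrow>
                       (\<exists>x. x t0 = x0 \<and> ses_solution_on {t0..} J h \<omega> c Mp a \<omega>f k x)))"
proof (intro allI impI)
  fix \<Delta> :: real assume "0 < \<Delta>"
  let ?P = "(assm_A4 J h \<theta>c \<and> assm_A5 J h \<theta>c) \<or> (\<exists>\<theta>. h \<theta> \<le> 0)"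
  have C1J: "C1_loc_lipschitz_grad J" using assms(1) unfolding assm_A1_def by blast
  have C1h: "C1_loc_lipschitz_grad h" using assms(2) unfolding assm_A2_def by blast
  note A7 = assms(4)[unfolded assm_A7_def]
  have c: "0 < c" by (rule A7[THEN conjunct1])
  have \<omega>: "\<And>i. 0 < \<omega> i" "inj \<omega>"
    using A7[THEN conjunct2, THEN conjunct1]
      A7[THEN conjunct2, THEN conjunct2, THEN conjunct2, THEN conjunct1]
    unfolding inj_def by blast+
  have T: "0 < T" using assms(6) unfolding common_period_def by blast
  obtain B where B: "0 < B" "\<And>x. x \<in> cball \<theta>c (\<Delta> + real CARD('n)) \<Longrightarrow> \<bar>h x\<bar> \<le> B"
    by (rule C1_bounds_on_ball[OF C1h, of \<theta>c "\<Delta> + real CARD('n)"]) blast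
  have main: "\<exists>Mp>0. \<exists>as>0. \<exists>\<omega>fs>0. \<exists>ks :: real \<Rightarrow> real.
             \<forall>a\<in>{0<..<as}. \<forall>\<omega>f\<in>{0<..<\<omega>fs}. ks a > 0 \<and>
               (\<forall>k\<in>{0<..<ks a}. \<forall>t0\<ge>0. \<forall>x0.
                  norm (error_state J h \<omega> T \<theta>c a x0) \<le> \<Delta> \<longrightarrow>
                    (\<forall>t\<ge>t0. \<forall>x. x t0 = x0 \<and> ses_solution_on {t0..t} J h \<omega> c Mp a \<omega>f k x \<longrightarrow>
                       h (applied_param a \<omega> x t)
                         \<ge> h (applied_param a \<omega> x t0) * exp (- c * k * \<omega>f * (t - t0)) - 1 * \<delta>) \<and>
                    (?P \<longrightarrow> (\<exists>x. x t0 = x0 \<and> ses_solution_on {t0..} J h \<omega> c Mp a \<omega>f k x)))"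
    if "0 < \<delta>" for \<delta>
  proof -
    define H where "H = B / (c * \<delta>)"
    have H: "0 < H" unfolding H_def using B(1) c \<open>0 < \<delta>\<close> by simp
    obtain Mp as where Mp: "0 < Mp" and as: "0 < as"
      and ex: "\<forall>a\<in>{0<..<as}. \<exists>ks>0. \<exists>D. practically_safe J h \<omega> c T \<theta>c Mp \<Delta> \<delta> H as a ks D"
      using ses_confined_and_safe[OF assms(1,2) \<omega> c T assms(5) \<open>0 < \<Delta>\<close> \<open>0 < \<delta>\<close> H] by blast
    define as' where "as' = min as 1"
    have as': "0 < as'" "as' \<le> 1" "{0<..<as'} \<subseteq> {0<..<as}" unfolding as'_def using as by auto
    from ex obtain ks D where ks: "\<And>a. a \<in> {0<..<as} \<Longrightarrow> 0 < ks a"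
      and safe: "\<And>a. a \<in> {0<..<as} \<Longrightarrow> practically_safe J h \<omega> c T \<theta>c Mp \<Delta> \<delta> H as a (ks a) (D a)"
      by metis
    have bounds: "norm (x t1) \<le> D a \<and>
       h (applied_param a \<omega> x t0) * exp (- (c * (k * \<omega>f) * (t1 - t0))) - \<delta> \<le> h (applied_param a \<omega> x t1)"
      if "a \<in> {0<..<as}" "\<omega>f \<in> {0<..<as}" "k \<in> {0<..<ks a}" "t0 \<le> t1"
        "ses_solution_on {t0..t1} J h \<omega> c Mp a \<omega>f k x"
        "norm (error_state J h \<omega> T \<theta>c a (x t0)) \<le> \<Delta>" "?P \<or> k * \<omega>f * (t1 - t0) \<le> H"
      for a \<omega>f k t0 t1 x
      using safe[OF that(1), unfolded practically_safe_def, rule_format, OF that(2,3), of t0 t1 x] that(4-7) by blast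
    show ?thesis
    proof (rule exI[of _ Mp], rule conjI, rule Mp, rule exI[of _ as'], rule conjI, rule as'(1),
        rule exI[of _ as'], rule conjI, rule as'(1), rule exI[of _ ks], intro ballI allI conjI impI)
      fix a \<omega>f assume "a \<in> {0<..<as'}" "\<omega>f \<in> {0<..<as'}"
      then have a: "a \<in> {0<..<as}" "0 < a" "a \<le> 1" and w: "\<omega>f \<in> {0<..<as}" "0 < \<omega>f" using as' by auto
      show "0 < ks a" by (rule ks[OF a(1)])
      fix k t0 x0 assume k: "k \<in> {0<..<ks a}" and err: "norm (error_state J h \<omega> T \<theta>c a x0) \<le> \<Delta>"
      have \<kappa>: "0 < k * \<omega>f" using k w by simp
      {
        fix t x assume "t0 \<le> t" and x: "x t0 = x0 \<and> ses_solution_on {t0..t} J h \<omega> c Mp a \<omega>f k x"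
        show "h (applied_param a \<omega> x t0) * exp (- c * k * \<omega>f * (t - t0)) - 1 * \<delta> \<le> h (applied_param a \<omega> x t)"
        proof (cases "?P \<or> k * \<omega>f * (t - t0) \<le> H")
          case True
          have "h (applied_param a \<omega> x t0) * exp (- (c * (k * \<omega>f) * (t - t0))) - \<delta> \<le> h (applied_param a \<omega> x t)"
            using bounds[OF a(1) w(1) k \<open>t0 \<le> t\<close> _ _ True] x err by simp
          then show ?thesis by (simp add: mult.assoc)
        next
          case False
          then have pos: "0 < h \<theta>" for \<theta> by (simp add: not_le)
          have "fst x0 \<in> cball \<theta>c \<Delta>"
            using norm_fst_le[of "fst (error_state J h \<omega> T \<theta>c a x0)" "snd (error_state J h \<omega> T \<theta>c a x0)"] err
            unfolding prod.collapse by (simp add: error_state_def Let_def dist_norm norm_minus_commute)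
          then have "h (applied_param a \<omega> x t0) \<le> B"
            using B(2)[OF probe_S_in_ball[OF _ a(2,3)], of "fst x0" \<omega> t0] x unfolding applied_param_def by simp
          then have "h (applied_param a \<omega> x t0) * exp (- (c * (k * \<omega>f * (t - t0)))) \<le> B * exp (- (c * H))"
            using False c B(1) by (intro mult_mono) auto
          also have "\<dots> \<le> B * (1 / (c * H))"
            using exp_minus_le_inverse[of "c * H"] c H B(1) by (intro mult_left_mono) auto
          also have "\<dots> = \<delta>" unfolding H_def using B(1) c \<open>0 < \<delta>\<close> by simp
          finally show ?thesis using pos[of "applied_param a \<omega> x t"] by (simp add: mult.assoc)
        qed
      }
      assume ?P
      show "\<exists>x. x t0 = x0 \<and> ses_solution_on {t0..} J h \<omega> c Mp a \<omega>f k x"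
        by (rule ses_global_solution[OF C1J C1h Mp a(2), where D = "D a"])
          (use bounds[OF a(1) w(1) k] err \<open>?P\<close> in blast)
    qed
  qed
  show "\<exists>\<delta>s>0. \<exists>K>0. \<forall>\<delta>\<in>{0<..<\<delta>s}.
           \<exists>Mp>0. \<exists>as>0. \<exists>\<omega>fs>0. \<exists>ks :: real \<Rightarrow> real.
             \<forall>a\<in>{0<..<as}. \<forall>\<omega>f\<in>{0<..<\<omega>fs}. ks a > 0 \<and>
               (\<forall>k\<in>{0<..<ks a}. \<forall>t0\<ge>0. \<forall>x0.
                  norm (error_state J h \<omega> T \<theta>c a x0) \<le> \<Delta> \<longrightarrow>
                    (\<forall>t\<ge>t0. \<forall>x. x t0 = x0 \<and> ses_solution_on {t0..t} J h \<omega> c Mp a \<omega>f k x \<longrightarrow>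
                       h (applied_param a \<omega> x t)
                         \<ge> h (applied_param a \<omega> x t0) * exp (- c * k * \<omega>f * (t - t0)) - K * \<delta>) \<and>
                    (?P \<longrightarrow> (\<exists>x. x t0 = x0 \<and> ses_solution_on {t0..} J h \<omega> c Mp a \<omega>f k x)))"
    by (rule exI[of _ 1], rule conjI, simp, rule exI[of _ 1], rule conjI, simp, rule ballI, rule main) simp
qed

end
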